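(* For every integer $p\geq 1$, there exists a cubic polynomial $f:\mathbb{C}\to\mathbb{C}$ having a superattracting cycle of period $p$ in $\mathbb{C}$ whose Julia set $J(f)$ is a Cantor set with bubbles.
   Context: A superattracting cycle of period $p$ in $\mathbb{C}$ is a periodic cycle of exact period $p$ consisting of points of $\mathbb{C}$ and containing a critical point of $f$. A perfect subset $X$ of the Riemann sphere $\widehat{\mathbb{C}}$ is called a Cantor set with bubbles (Cantor bubbles) if it is the disjoint union of countably many Jordan curves and uncountably many points, and its complement $\widehat{\mathbb{C}}\setminus X$ contains exactly one multiply connected component. Here the Jordan curves and the points are the connected components of $X$: each connected component of $X$ is either a Jordan curve or a single point, with countably infinitely many Jordan curve components and uncountably many point components; and exactly one connected component of $\widehat{\mathbb{C}}\setminus X$ is not simply connected. *)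

theory Defs
  imports "HOL-Analysis.Analysis" "HOL-Computational_Algebra.Polynomial"
begin

section \<open>The Riemann sphere\<close>

text \<open>The Riemann sphere is the unit sphere of \<^typ>\<open>complex \<times> real\<close>, i.e. of Euclidean
  3-space, with the induced topology. The finite points correspond to the complex plane by
  stereographic projection from the north pole, which plays the role of the point at infinity;
  \<^term>\<open>dist\<close> restricted to the sphere is then the chordal metric.\<close>

definition riemann_sphere :: "(complex \<times> real) set" where
  "riemann_sphere = sphere 0 1"

definition north_pole :: "complex \<times> real" where
  "north_pole = (0, 1)"

definition to_sphere :: "complex \<Rightarrow> complex \<times> real" where
  "to_sphere z = ((2 / ((cmod z)\<^sup>2 + 1)) *\<^sub>R z, ((cmod z)\<^sup>2 - 1) / ((cmod z)\<^sup>2 + 1))"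

text \<open>The inverse of \<^term>\<open>to_sphere\<close>; its value at the north pole is irrelevant.\<close>

definition from_sphere :: "complex \<times> real \<Rightarrow> complex" where
  "from_sphere x = fst x /\<^sub>R (1 - snd x)"

lemma from_to_sphere: "from_sphere (to_sphere z) = z"
proof -
  have "(cmod z)\<^sup>2 + 1 > 0"
    by (simp add: add_nonneg_pos)
  then have "1 - ((cmod z)\<^sup>2 - 1) / ((cmod z)\<^sup>2 + 1) = 2 / ((cmod z)\<^sup>2 + 1)"
    by (simp add: field_simps)
  moreover have "(cmod z)\<^sup>2 + 1 \<noteq> 0"
    using \<open>(cmod z)\<^sup>2 + 1 > 0\<close> by linarith
  moreover have "(2 / d) *\<^sub>R z /\<^sub>R (2 / d) = z" if "d \<noteq> 0" for d
    using that by simp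
  ultimately show ?thesis
    unfolding from_sphere_def to_sphere_def fst_conv snd_conv by metis
qed

lemma to_sphere_in: "to_sphere z \<in> riemann_sphere - {north_pole}"
proof -
  have pos: "(cmod z)\<^sup>2 + 1 > 0"
    by (simp add: add_nonneg_pos)
  have "(2 * cmod z / ((cmod z)\<^sup>2 + 1))\<^sup>2 + (((cmod z)\<^sup>2 - 1) / ((cmod z)\<^sup>2 + 1))\<^sup>2
      = ((2 * cmod z)\<^sup>2 + ((cmod z)\<^sup>2 - 1)\<^sup>2) / ((cmod z)\<^sup>2 + 1)\<^sup>2"
    by (simp add: power_divide add_divide_distrib)
  also have "(2 * cmod z)\<^sup>2 + ((cmod z)\<^sup>2 - 1)\<^sup>2 = ((cmod z)\<^sup>2 + 1)\<^sup>2"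
    by (simp add: power2_eq_square algebra_simps)
  also have "((cmod z)\<^sup>2 + 1)\<^sup>2 / ((cmod z)\<^sup>2 + 1)\<^sup>2 = 1"
    using pos by simp
  finally have "norm (to_sphere z) = 1"
    using pos by (simp add: to_sphere_def norm_Pair power_divide)
  moreover have "to_sphere z \<noteq> north_pole"
    using pos by (auto simp: to_sphere_def north_pole_def field_simps)
  ultimately show ?thesis
    by (simp add: riemann_sphere_def)
qed

text \<open>The continuous extension of a nonconstant polynomial to the sphere, fixing infinity.\<close>

definition sphere_map :: "complex poly \<Rightarrow> complex \<times> real \<Rightarrow> complex \<times> real" where
  "sphere_map f x =
     (if x = north_pole then north_pole else to_sphere (poly f (from_sphere x)))"

section \<open>Fatou and Julia sets\<close>

text \<open>Normality in the sense of Montel: every sequence in the family has a subsequence that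
  converges locally uniformly on \<^term>\<open>U\<close>. The limit is not required to belong to the family.\<close>

definition normal_on :: "('a::metric_space) set \<Rightarrow> ('a \<Rightarrow> 'b::metric_space) set \<Rightarrow> bool" where
  "normal_on U \<F> \<longleftrightarrow>
     (\<forall>s :: nat \<Rightarrow> 'a \<Rightarrow> 'b. range s \<subseteq> \<F> \<longrightarrow>
        (\<exists>r g. strict_mono r \<and>
           (\<forall>K. compact K \<and> K \<subseteq> U \<longrightarrow> uniform_limit K (s \<circ> r) g sequentially)))"

definition fatou_set :: "complex poly \<Rightarrow> (complex \<times> real) set" where
  "fatou_set f =
     {x. \<exists>U. openin (top_of_set riemann_sphere) U \<and> x \<in> U \<and>
             normal_on U (range (\<lambda>n. sphere_map f ^^ n))}"

definition julia_set :: "complex poly \<Rightarrow> (complex \<times> real) set" where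
  "julia_set f = riemann_sphere - fatou_set f"

section \<open>Superattracting cycles\<close>

definition periodic_cycle :: "('a \<Rightarrow> 'a) \<Rightarrow> nat \<Rightarrow> 'a set \<Rightarrow> bool" where
  "periodic_cycle f p C \<longleftrightarrow>
     p \<ge> 1 \<and>
     (\<exists>z. (f ^^ p) z = z \<and> (\<forall>k. 0 < k \<and> k < p \<longrightarrow> (f ^^ k) z \<noteq> z) \<and>
          C = (\<lambda>k. (f ^^ k) z) ` {..<p})"

definition superattracting_cycle :: "complex poly \<Rightarrow> nat \<Rightarrow> complex set \<Rightarrow> bool" where
  "superattracting_cycle f p C \<longleftrightarrow>
     periodic_cycle (poly f) p C \<and> (\<exists>c\<in>C. poly (pderiv f) c = 0)"

section \<open>Cantor sets with bubbles\<close>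

definition jordan_curve :: "('a::topological_space) set \<Rightarrow> bool" where
  "jordan_curve J \<longleftrightarrow>
     (\<exists>\<gamma>. simple_path \<gamma> \<and> pathfinish \<gamma> = pathstart \<gamma> \<and> path_image \<gamma> = J)"

definition perfect_set :: "('a::topological_space) set \<Rightarrow> bool" where
  "perfect_set X \<longleftrightarrow> closed X \<and> (\<forall>x\<in>X. x islimpt X)"

definition cantor_bubbles :: "(complex \<times> real) set \<Rightarrow> bool" where
  "cantor_bubbles X \<longleftrightarrow>
     X \<subseteq> riemann_sphere \<and> perfect_set X \<and>
     (\<forall>C\<in>components X. jordan_curve C \<or> (\<exists>x. C = {x})) \<and>
     countable {C \<in> components X. jordan_curve C} \<and>
     infinite {C \<in> components X. jordan_curve C} \<and>
     uncountable {C \<in> components X. \<exists>x. C = {x}} \<and>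
     (\<exists>!U. U \<in> components (riemann_sphere - X) \<and> \<not> simply_connected U)"

end

(* The proof takes f(z) = A z^2 (z - 1) + c with A huge. Every bounded orbit stays in a small disc
   V0 about the critical point 0, mapped two-to-one, and a tiny disc V1 about 1, mapped one-to-one
   and very expanding; the other critical point 2/3 escapes. The parameter c is chosen such that
   the orbit of 0 enters V1, stays there for p - 1 steps and then returns exactly to 0.

   By Montel's theorem the Julia set is the frontier of the set K of bounded orbits. Near 0 the map
   f^p is a small perturbation of a multiple of z^2; in the coordinate ln z it becomes a perturbed
   doubling map, whose invariant curve bounds the component of K that contains 0. A component of K
   that eventually lands on this one is a conformal copy of it, because each step back is either
   one-to-one or a branch of the square root. On every other component a metric that is
   logarithmic in V0 and Euclidean in V1 is expanded infinitely often, so the component is a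
   single point. There are countably many components with interior, but one component for every
   itinerary in {V0, V1}. *)

theory Submission
  imports Defs "HOL-Complex_Analysis.Complex_Analysis"
begin

section \<open>Stereographic projection\<close>

text \<open>Near \<open>0\<close> no Euclidean expansion is available, because the derivative of
  \<open>f\<close> vanishes there; in the coordinate \<open>ln z\<close> squaring becomes linear
  doubling. This coordinate exists on exactly those components of \<open>K\<close> that omit
  \<open>0\<close>: each component is compact with connected complement, and such sets carry
  continuous logarithms of nonvanishing functions. Hence the component of \<open>0\<close> is
  treated apart. A whole turn along the critical orbit has to remain a small perturbation of
  doubling. Each of the \<open>p - 1\<close> visits to \<open>V1\<close> adds an error of order
  \<open>r^2\<close>, so \<open>r\<close> is taken as \<open>1 / (100 p)\<close>; then
  \<open>A = 8 / r^2\<close> makes the discs of radius \<open>r\<close> about \<open>0\<close> and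
  \<open>2 r^2\<close> about \<open>1\<close> catch all bounded orbits. Itineraries in
  \<open>{V0, V1}\<close> are constant on components, so keeping to the critical itinerary forever
  is a property of a component, and it characterises the component of \<open>0\<close>.\<close>

lemma north_pole_in_sphere: "north_pole \<in> riemann_sphere"
  by (simp add: north_pole_def riemann_sphere_def norm_Pair)

lemma continuous_on_to_sphere: "continuous_on S to_sphere"
proof -
  have "(cmod z)\<^sup>2 + 1 \<noteq> 0" for z
    by (smt (verit) zero_le_power2)
  then show ?thesis
    unfolding to_sphere_def by (intro continuous_intros) auto
qed

lemma in_sphere_iff: "x \<in> riemann_sphere \<longleftrightarrow> (cmod (fst x))\<^sup>2 + (snd x)\<^sup>2 = 1"
proof -
  have "x \<in> riemann_sphere \<longleftrightarrow> norm x ^ 2 = 1"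
    by (simp add: riemann_sphere_def power2_eq_1_iff) (smt (verit) norm_ge_zero)
  also have "norm x ^ 2 = (cmod (fst x))\<^sup>2 + (snd x)\<^sup>2"
    by (cases x) (simp add: norm_Pair)
  finally show ?thesis .
qed

lemma snd_less_1:
  assumes "x \<in> riemann_sphere - {north_pole}" shows "snd x < 1"
proof -
  have *: "(cmod (fst x))\<^sup>2 + (snd x)\<^sup>2 = 1"
    using assms by (simp add: in_sphere_iff)
  then have "(snd x)\<^sup>2 \<le> 1"
    by (smt (verit) zero_le_power2)
  then have "snd x \<le> 1"
    by (simp add: abs_square_le_1 abs_le_iff)
  moreover have "snd x \<noteq> 1"
  proof
    assume "snd x = 1"
    with * have "fst x = 0" by simp
    with \<open>snd x = 1\<close> have "x = north_pole"
      by (simp add: north_pole_def prod_eq_iff)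
    with assms show False by simp
  qed
  ultimately show ?thesis by simp
qed

lemma to_from_sphere:
  assumes "x \<in> riemann_sphere - {north_pole}" shows "to_sphere (from_sphere x) = x"
proof -
  define s where "s = snd x"
  have s: "s < 1" using snd_less_1 [OF assms] by (simp add: s_def)
  have "(cmod (fst x))\<^sup>2 = 1 - s\<^sup>2"
    using assms by (simp add: in_sphere_iff s_def)
  also have "\<dots> = (1 - s) * (1 + s)"
    by (simp add: power2_eq_square algebra_simps)
  finally have "(cmod (fst x))\<^sup>2 / (1 - s)\<^sup>2 = (1 + s) / (1 - s)"
    using s by (simp add: power2_eq_square)
  then have "(cmod (from_sphere x))\<^sup>2 = (1 + s) / (1 - s)"
    using s by (simp add: from_sphere_def s_def [symmetric] power_mult_distrib power_inverse
        divide_inverse mult.commute)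
  then have 1: "(cmod (from_sphere x))\<^sup>2 + 1 = 2 / (1 - s)"
    and 2: "(cmod (from_sphere x))\<^sup>2 - 1 = 2 * s / (1 - s)"
    using s by (simp_all add: field_simps)
  have 3: "2 / (2 / (1 - s)) = 1 - s" "2 * s / (1 - s) / (2 / (1 - s)) = s"
    using s by simp_all
  show ?thesis
    unfolding to_sphere_def 1 2 3 using s
    by (simp add: from_sphere_def s_def [symmetric] prod_eq_iff)
qed

lemma homeomorphism_to_sphere:
  "homeomorphism UNIV (riemann_sphere - {north_pole}) to_sphere from_sphere"
proof
  show "continuous_on (riemann_sphere - {north_pole}) from_sphere"
    unfolding from_sphere_def using snd_less_1
    by (intro continuous_intros) force
  show "to_sphere ` UNIV \<subseteq> riemann_sphere - {north_pole}"
    using to_sphere_in by (meson image_subset_iff)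
qed (auto simp: from_to_sphere to_from_sphere continuous_on_to_sphere)

lemma inj_to_sphere: "inj to_sphere"
  by (metis from_to_sphere injI)

lemma to_sphere_ne_north: "to_sphere z \<noteq> north_pole"
  using to_sphere_in by blast

lemma openin_sphere_to_sphere:
  assumes "open S" shows "openin (top_of_set riemann_sphere) (to_sphere ` S)"
proof -
  have "openin (top_of_set (riemann_sphere - {north_pole})) (to_sphere ` S)"
    using homeomorphism_imp_open_map [OF homeomorphism_to_sphere] assms by simp
  moreover have "openin (top_of_set riemann_sphere) (riemann_sphere - {north_pole})"
    by (simp add: openin_delete)
  ultimately show ?thesis
    using openin_trans by blast
qed

lemma openin_sphere_compl:
  assumes "compact S" shows "openin (top_of_set riemann_sphere) (riemann_sphere - to_sphere ` S)"
proof -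
  have "closed (to_sphere ` S)"
    by (intro compact_imp_closed compact_continuous_image continuous_on_to_sphere assms)
  then show ?thesis
    by (simp add: openin_open_Int Diff_eq open_Compl)
qed

text \<open>The exact chordal distance to the north pole is
  \<open>2 / sqrt ((cmod w)^2 + 1)\<close>.\<close>

lemma dist_to_sphere_north: "w \<noteq> 0 \<Longrightarrow> dist (to_sphere w) north_pole \<le> 2 / cmod w"
proof -
  assume w: "w \<noteq> 0"
  define q where "q = (cmod w)\<^sup>2 + 1"
  have q: "q > 0" "(cmod w)\<^sup>2 = q - 1" by (auto simp: q_def add_nonneg_pos)
  have 1: "(q - 2) / q - 1 = - 2 / q"
    using q by (simp add: field_simps)
  have "(dist (to_sphere w) north_pole)\<^sup>2 = (2 / q * cmod w)\<^sup>2 + ((q - 2) / q - 1)\<^sup>2"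
    by (simp add: to_sphere_def north_pole_def dist_norm norm_Pair q_def)
  also have "\<dots> = (2 / q)\<^sup>2 * (q - 1) + (- 2 / q)\<^sup>2"
    unfolding 1 by (simp only: power_mult_distrib q(2))
  also have "\<dots> = (2 / q)\<^sup>2 * q"
    by (simp only: minus_divide_left [symmetric] power2_minus right_diff_distrib mult_1_right diff_add_cancel)
  also have "\<dots> = 4 / q"
    using q by (simp add: power2_eq_square)
  also have "\<dots> \<le> 4 / (cmod w)\<^sup>2"
    using w by (intro divide_left_mono) (simp_all add: q_def add_nonneg_pos)
  also have "\<dots> = (2 / cmod w)\<^sup>2"
    by (simp add: power_divide)
  finally show ?thesis
    using power2_le_imp_le by fastforce
qed

lemma sphere_map_iterate:
  "(sphere_map f ^^ n) (to_sphere z) = to_sphere ((poly f ^^ n) z)"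
  by (induction n) (auto simp: sphere_map_def to_sphere_ne_north from_to_sphere)

lemma sphere_map_iterate_north: "(sphere_map f ^^ n) north_pole = north_pole"
  by (induction n) (auto simp: sphere_map_def)

section \<open>Polynomials with an escape radius\<close>

locale escaping_poly =
  fixes f :: "complex poly" and R :: real
  assumes R: "R \<ge> 1"
    and escape: "cmod z > R \<Longrightarrow> cmod (poly f z) \<ge> 2 * cmod z"
begin

abbreviation itr :: "nat \<Rightarrow> complex \<Rightarrow> complex" where
  "itr n \<equiv> poly f ^^ n"

definition K :: "complex set" where
  "K = {z. \<forall>n. cmod (itr n z) \<le> R}"

lemma iter_escape:
  assumes "cmod (itr n z) > R"
  shows "cmod (itr (n + k) z) > R \<and> cmod (itr (n + k) z) \<ge> 2 ^ k * R"
proof (induction k)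
  case 0
  then show ?case using assms by simp
next
  case (Suc k)
  then have "cmod (itr (n + Suc k) z) \<ge> 2 * cmod (itr (n + k) z)"
    using escape by simp
  with Suc R show ?case by auto
qed

lemma holomorphic_itr: "itr n holomorphic_on S"
proof (induction n)
  case (Suc n)
  have "(\<lambda>z. poly f (itr n z)) holomorphic_on S"
    by (intro holomorphic_intros Suc)
  then show ?case by (simp add: o_def)
qed (auto simp: id_def)

lemma continuous_on_itr: "continuous_on S (itr n)"
  by (simp add: holomorphic_itr holomorphic_on_imp_continuous_on)

lemma K_bound: "z \<in> K \<Longrightarrow> cmod (itr n z) \<le> R"
  by (simp add: K_def)

lemma K_subset_cball: "K \<subseteq> cball 0 R"
  using K_bound [where n = 0] by auto

lemma compact_K: "compact K"
proof -
  have "K = (\<Inter>n. itr n -` cball 0 R)"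
    by (auto simp: K_def)
  moreover have "closed (itr n -` cball 0 R)" for n
    using continuous_closed_vimage continuous_on_eq_continuous_at continuous_on_itr by blast
  ultimately have "closed K" by auto
  then show ?thesis
    using K_subset_cball bounded_cball bounded_subset compact_eq_bounded_closed by metis
qed

lemma f_in_K_iff: "poly f z \<in> K \<longleftrightarrow> z \<in> K"
proof
  assume z: "poly f z \<in> K"
  have "cmod (itr n z) \<le> R" for n
  proof (rule ccontr)
    assume "\<not> cmod (itr n z) \<le> R"
    then have "cmod (itr (n + 1) z) > R"
      using iter_escape by (metis not_le)
    then show False
      using K_bound [OF z, of n] by (simp add: funpow_swap1)
  qed
  then show "z \<in> K" by (simp add: K_def)
next
  assume "z \<in> K"
  then have "cmod (itr (Suc n) z) \<le> R" for n
    using K_bound by blast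
  then show "poly f z \<in> K" by (simp add: K_def funpow_swap1)
qed

lemma itr_in_K_iff: "itr n z \<in> K \<longleftrightarrow> z \<in> K"
  by (induction n) (auto simp: f_in_K_iff)

text \<open>Maximum modulus principle for every iterate at once. All statements that
  \<open>K\<close> and its components have no holes come from here.\<close>

lemma subset_K_if_frontier:
  assumes "bounded S" "frontier S \<subseteq> K" shows "S \<subseteq> K"
proof
  fix z assume "z \<in> S"
  have "cmod (itr n z) \<le> R" for n
    by (rule maximum_modulus_frontier [of "itr n" S])
      (use assms \<open>z \<in> S\<close> K_bound in \<open>auto intro: holomorphic_itr continuous_on_itr\<close>)
  then show "z \<in> K" by (simp add: K_def)
qed

lemma inside_subset_K: "closed S \<Longrightarrow> bounded S \<Longrightarrow> S \<subseteq> K \<Longrightarrow> inside S \<subseteq> K"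
  by (meson bounded_inside frontier_inside_subset order_trans subset_K_if_frontier)

lemma connected_Compl_K: "connected (- K)"
proof -
  have "inside K \<subseteq> K"
    using compact_K by (intro inside_subset_K) (auto simp: compact_imp_closed compact_imp_bounded)
  then have "inside K = {}"
    using inside_no_overlap by blast
  then have "outside K = - K"
    using inside_Un_outside [of K] by simp
  moreover have "connected (outside K)"
    by (rule connected_outside) (auto simp: compact_K compact_imp_bounded)
  ultimately show ?thesis by simp
qed

text \<open>Filling the holes of a component keeps it connected and inside \<open>K\<close>, so by
  maximality there are no holes.\<close>

lemma component_facts:
  assumes "E \<in> components K"
  shows "compact E" "connected E" "E \<noteq> {}" "E \<subseteq> K" "connected (- E)"
proof -
  show E: "compact E" "connected E" "E \<noteq> {}" "E \<subseteq> K"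
    using assms compact_components [OF compact_K assms] in_components_connected [OF assms]
      in_components_nonempty [OF assms] in_components_subset [OF assms] by simp_all
  have cb: "closed E" "bounded E"
    using E by (auto simp: compact_imp_closed compact_imp_bounded)
  have "inside E \<subseteq> K"
    using E cb inside_subset_K by blast
  moreover have "connected (E \<union> inside E)"
    using E cb by (simp add: connected_with_inside)
  ultimately have "inside E \<subseteq> E"
    using components_maximal [OF assms, of "E \<union> inside E"] E by blast
  then have "inside E = {}"
    using inside_no_overlap by blast
  then have "outside E = - E"
    using inside_Un_outside [of E] by simp
  then show "connected (- E)"
    using connected_outside [of E] cb by simp
qed

text \<open>Finitely many of the open sets \<open>U n\<close> cover \<open>S\<close>; past the
  largest of these escape times each step doubles the modulus.\<close>

lemma escape_uniform:
  assumes "compact S" "S \<inter> K = {}"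
  obtains N where "\<And>y n. y \<in> S \<Longrightarrow> n \<ge> N \<Longrightarrow> cmod (itr n y) \<ge> 2 ^ (n - N) * R"
proof -
  define U where "U n = {y. cmod (itr n y) > R}" for n
  have "open (U n)" for n
    unfolding U_def by (intro open_Collect_less continuous_intros continuous_on_itr)
  moreover have "S \<subseteq> (\<Union>n. U n)"
  proof
    fix y assume "y \<in> S"
    then have "y \<notin> K" using assms(2) by blast
    then show "y \<in> (\<Union>n. U n)" by (auto simp: K_def U_def not_le)
  qed
  ultimately obtain F where F: "finite F" "S \<subseteq> (\<Union>n\<in>F. U n)"
    by (rule compactE_image [OF assms(1), of UNIV U]) auto
  define N where "N = Max (insert 0 F)"
  have "cmod (itr n y) \<ge> 2 ^ (n - N) * R" if "y \<in> S" "n \<ge> N" for y n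
  proof -
    obtain m where m: "m \<in> F" "cmod (itr m y) > R"
      using F \<open>y \<in> S\<close> by (auto simp: U_def)
    then have "m \<le> N" using F by (simp add: N_def)
    then have "cmod (itr (m + (n - m)) y) \<ge> 2 ^ (n - m) * R"
      using iter_escape m by blast
    moreover have "(2::real) ^ (n - m) * R \<ge> 2 ^ (n - N) * R"
      using \<open>m \<le> N\<close> R by (intro mult_right_mono power_increasing) auto
    ultimately show ?thesis
      using that \<open>m \<le> N\<close> by simp
  qed
  then show thesis using that by blast
qed

text \<open>An isolated point would have a small circle around it that escapes uniformly, while the
  iterates at the centre stay bounded; this contradicts the minimum modulus principle for
  \<open>f\<^sup>n - w\<close>, where \<open>w\<close> is a point of \<open>K\<close> that \<open>f\<^sup>n\<close> omits.\<close>

lemma K_islimpt: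
  assumes "a \<in> K" "b \<in> K" "a \<noteq> b" "x \<in> K"
  shows "x islimpt K"
proof (rule ccontr)
  assume "\<not> x islimpt K"
  then obtain e where e: "e > 0" "\<And>y. y \<in> K \<Longrightarrow> y \<noteq> x \<Longrightarrow> dist y x \<ge> e"
    unfolding islimpt_approachable by (meson not_le)
  define \<rho> where "\<rho> = e / 2"
  have out: "y \<notin> K" if "dist y x \<le> \<rho>" "y \<noteq> x" for y
    using e that by (force simp: \<rho>_def)
  have "\<rho> > 0" using e by (simp add: \<rho>_def)
  have "sphere x \<rho> \<inter> K = {}"
    using out \<open>\<rho> > 0\<close> by (auto simp: dist_commute)
  then obtain N where N: "\<And>y n. y \<in> sphere x \<rho> \<Longrightarrow> n \<ge> N \<Longrightarrow> cmod (itr n y) \<ge> 2 ^ (n - N) * R"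
    using escape_uniform [of "sphere x \<rho>"] by auto
  define n where "n = N + 2"
  obtain w where w: "w \<in> K" "w \<noteq> itr n x"
    using assms by metis
  define g where "g y = itr n y - w" for y
  have g0: "g y \<noteq> 0" if "y \<in> cball x \<rho>" for y
    using out [of y] that w itr_in_K_iff [of n y] by (auto simp: g_def dist_commute)
  have "cmod (1 / g x) \<le> 1 / (3 * R)"
  proof (rule maximum_modulus_frontier [of "\<lambda>y. 1 / g y" "cball x \<rho>"])
    have hol: "(\<lambda>y. 1 / g y) holomorphic_on cball x \<rho>"
      unfolding g_def using g0
      by (intro holomorphic_intros holomorphic_itr) (auto simp: g_def)
    then show "(\<lambda>y. 1 / g y) holomorphic_on interior (cball x \<rho>)"
      using holomorphic_on_subset interior_subset by blast
    show "continuous_on (closure (cball x \<rho>)) (\<lambda>y. 1 / g y)"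
      using hol by (simp add: holomorphic_on_imp_continuous_on)
    fix y assume "y \<in> frontier (cball x \<rho>)"
    then have "y \<in> sphere x \<rho>" using \<open>\<rho> > 0\<close> by simp
    then have "cmod (itr n y) \<ge> 4 * R"
      using N [of y n] by (simp add: n_def)
    moreover have "cmod w \<le> R" using w K_subset_cball by auto
    ultimately have "cmod (g y) \<ge> 3 * R"
      unfolding g_def using norm_triangle_ineq2 [of "itr n y" w] by linarith
    then show "cmod (1 / g y) \<le> 1 / (3 * R)"
      using R by (simp add: norm_divide divide_simps)
  qed (use \<open>\<rho> > 0\<close> in auto)
  moreover have "cmod (g x) \<le> 2 * R"
    using norm_triangle_ineq4 [of "itr n x" w] K_bound [OF \<open>x \<in> K\<close>, of n] w K_subset_cball
    by (auto simp: g_def)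
  moreover have "g x \<noteq> 0" using w by (simp add: g_def)
  ultimately show False
    using R by (simp add: norm_divide field_simps)
qed

end

text \<open>A sequence drawn from the family of iterates has arbitrary exponents \<open>k n\<close>.
  Normality is thereby reduced to a constant sequence and to exponents that tend to
  infinity.\<close>

lemma subseq_constant_or_tendsto_top:
  fixes k :: "nat \<Rightarrow> nat"
  obtains r m where "strict_mono (r :: nat \<Rightarrow> nat)" "\<And>n. k (r n) = m"
  | "filterlim k at_top sequentially"
proof (cases "\<exists>m. infinite {n. k n = m}")
  case True
  then obtain m where m: "infinite {n. k n = m}" ..
  then have "strict_mono (enumerate {n. k n = m})" "k (enumerate {n. k n = m} n) = m" for n
    using strict_mono_enumerate enumerate_in_set [OF m, of n] by auto
  then show ?thesis using that(1) by blast
next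
  case False
  have "\<forall>\<^sub>F n in sequentially. Z \<le> k n" for Z
  proof -
    have "{n. \<not> Z \<le> k n} = (\<Union>m<Z. {n. k n = m})" by auto
    then have "finite {n. \<not> Z \<le> k n}" using False by auto
    then show ?thesis
      by (simp add: cofinite_eq_sequentially [symmetric] eventually_cofinite)
  qed
  then show ?thesis using that(2) by (simp add: filterlim_at_top)
qed

context escaping_poly
begin

text \<open>Infinity and the points that have escaped by a fixed time \<open>N\<close> form an open
  set, on which the iterates tend to infinity uniformly, at chordal speed
  \<open>2 / 2^j\<close>.\<close>

lemma basin_subset_fatou:
  assumes "x = north_pole \<or> (\<exists>z. x = to_sphere z \<and> z \<notin> K)"
  shows "x \<in> fatou_set f"
proof -
  obtain N where N: "x = north_pole \<or> (\<exists>z. x = to_sphere z \<and> cmod (itr N z) > R)"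
    using assms by (force simp: K_def not_le)
  define S where "S = {z. cmod (itr N z) \<le> R}"
  define U where "U = riemann_sphere - to_sphere ` S"
  have "S \<subseteq> cball 0 R"
  proof
    fix z assume "z \<in> S"
    then show "z \<in> cball 0 R"
      using iter_escape [of 0 z N] by (force simp: S_def)
  qed
  moreover have "closed S"
    unfolding S_def by (intro closed_Collect_le continuous_intros continuous_on_itr)
  ultimately have "compact S"
    by (meson bounded_cball bounded_subset compact_eq_bounded_closed)
  then have op: "openin (top_of_set riemann_sphere) U"
    unfolding U_def by (rule openin_sphere_compl)
  have "to_sphere z \<in> U" if "cmod (itr N z) > R" for z
    using that to_sphere_in by (auto simp: U_def S_def inj_image_mem_iff [OF inj_to_sphere])
  moreover have "north_pole \<in> U"
    using north_pole_in_sphere to_sphere_ne_north by (auto simp: U_def) (metis to_sphere_ne_north)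
  ultimately have "x \<in> U"
    using N by blast
  have U: "y = north_pole \<or> (\<exists>z. y = to_sphere z \<and> cmod (itr N z) > R)" if "y \<in> U" for y
  proof (cases "y = north_pole")
    case False
    with that have y: "y = to_sphere (from_sphere y)"
      using to_from_sphere [of y] by (simp add: U_def)
    then have "from_sphere y \<notin> S"
      using that by (auto simp: U_def)
    with y show ?thesis by (auto simp: S_def not_le)
  qed auto
  have near: "dist ((sphere_map f ^^ (N + j)) y) north_pole \<le> 2 / 2 ^ j" if "y \<in> U" for y j
  proof (cases "y = north_pole")
    case True
    then show ?thesis by (simp add: sphere_map_iterate_north)
  next
    case False
    then obtain z where z: "y = to_sphere z" "cmod (itr N z) > R"
      using U [OF \<open>y \<in> U\<close>] by blast
    then have "cmod (itr (N + j) z) \<ge> 2 ^ j * R"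
      using iter_escape by blast
    moreover have "2 ^ j * R \<ge> 2 ^ j" using R by simp
    ultimately have c: "cmod (itr (N + j) z) \<ge> 2 ^ j" by linarith
    then have "itr (N + j) z \<noteq> 0"
      by (metis norm_zero not_le zero_less_numeral zero_less_power)
    then have "dist ((sphere_map f ^^ (N + j)) y) north_pole \<le> 2 / cmod (itr (N + j) z)"
      using dist_to_sphere_north z sphere_map_iterate by metis
    also have "\<dots> \<le> 2 / 2 ^ j"
      using c by (intro frac_le) auto
    finally show ?thesis .
  qed
  have "normal_on U (range (\<lambda>n. sphere_map f ^^ n))"
    unfolding normal_on_def
  proof (intro allI impI)
    fix s :: "nat \<Rightarrow> complex \<times> real \<Rightarrow> complex \<times> real"
    assume "range s \<subseteq> range (\<lambda>n. sphere_map f ^^ n)"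
    then have "\<forall>n. \<exists>k. s n = sphere_map f ^^ k" by blast
    then obtain k where k: "\<And>n. s n = sphere_map f ^^ (k n)" by metis
    show "\<exists>r g. strict_mono r \<and> (\<forall>K. compact K \<and> K \<subseteq> U \<longrightarrow> uniform_limit K (s \<circ> r) g sequentially)"
    proof (rule subseq_constant_or_tendsto_top [of k])
      fix r m assume r: "strict_mono (r :: nat \<Rightarrow> nat)" "\<And>n. k (r n) = m"
      then have "s \<circ> r = (\<lambda>n. sphere_map f ^^ m)"
        by (auto simp: k)
      then show ?thesis using r by (metis uniform_limit_const)
    next
      assume top: "filterlim k at_top sequentially"
      have "uniform_limit U s (\<lambda>_. north_pole) sequentially"
      proof (rule uniform_limitI)
        fix e :: real assume "e > 0"
        then obtain j where j: "(1 / 2) ^ j < e / 2"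
          using real_arch_pow_inv [of "e / 2" "1 / 2"] by auto
        have "\<forall>\<^sub>F n in sequentially. k n \<ge> N + j"
          using top by (simp add: filterlim_at_top)
        then show "\<forall>\<^sub>F n in sequentially. \<forall>y\<in>U. dist (s n y) north_pole < e"
        proof eventually_elim
          case (elim n)
          have "dist (s n y) north_pole < e" if "y \<in> U" for y
          proof -
            have "dist (s n y) north_pole \<le> 2 / 2 ^ (k n - N)"
              using near [OF that, of "k n - N"] elim by (simp add: k)
            also have "\<dots> \<le> 2 / 2 ^ j"
              using elim by (intro divide_left_mono power_increasing) auto
            also have "\<dots> < e" using j by (simp add: power_divide)
            finally show ?thesis .
          qed
          then show ?case by blast
        qed
      qed
      then have "uniform_limit C (s \<circ> id) (\<lambda>_. north_pole) sequentially" if "C \<subseteq> U" for C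
        using that uniform_limit_on_subset by auto
      moreover have "strict_mono (id :: nat \<Rightarrow> nat)" by (simp add: strict_mono_def)
      ultimately show ?thesis by blast
    qed
  qed
  then show ?thesis
    unfolding fatou_set_def using op \<open>x \<in> U\<close> by blast
qed

text \<open>The iterates are bounded by \<open>R\<close> on \<open>interior K\<close>, so Montel's
  theorem applies; uniform continuity of \<open>to_sphere\<close> on the disc of radius
  \<open>R\<close> carries the limits to the sphere.\<close>

lemma interior_subset_fatou:
  assumes "z \<in> interior K" shows "to_sphere z \<in> fatou_set f"
proof -
  define V where "V = interior K"
  have op: "openin (top_of_set riemann_sphere) (to_sphere ` V)"
    by (simp add: V_def openin_sphere_to_sphere)
  have "normal_on (to_sphere ` V) (range (\<lambda>n. sphere_map f ^^ n))"
    unfolding normal_on_def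
  proof (intro allI impI)
    fix s :: "nat \<Rightarrow> complex \<times> real \<Rightarrow> complex \<times> real"
    assume "range s \<subseteq> range (\<lambda>n. sphere_map f ^^ n)"
    then have "\<forall>n. \<exists>k. s n = sphere_map f ^^ k" by blast
    then obtain k where k: "\<And>n. s n = sphere_map f ^^ (k n)" by metis
    obtain g r where r: "strict_mono (r :: nat \<Rightarrow> nat)"
      and ul: "\<And>C. compact C \<Longrightarrow> C \<subseteq> V \<Longrightarrow> uniform_limit C ((\<lambda>n. itr (k n)) \<circ> r) g sequentially"
    proof (rule Montel [of V "range itr" "\<lambda>n. itr (k n)"])
      show "open V" by (simp add: V_def)
      fix C assume C: "compact C" "C \<subseteq> V"
      then have "\<forall>h\<in>range itr. \<forall>z\<in>C. cmod (h z) \<le> R"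
        using interior_subset [of K] K_bound unfolding V_def by blast
      then show "\<exists>B. \<forall>h\<in>range itr. \<forall>z\<in>C. cmod (h z) \<le> B" by blast
    qed (auto intro: holomorphic_itr)
    have "uniform_limit C (s \<circ> r) (\<lambda>x. to_sphere (g (from_sphere x))) sequentially"
      if C: "compact C" "C \<subseteq> to_sphere ` V" for C
    proof -
      define C' where "C' = from_sphere ` C"
      have CC: "C' \<subseteq> V" "C = to_sphere ` C'"
        using C by (auto simp: C'_def from_to_sphere image_iff)
          (metis from_to_sphere imageE subsetD)+
      have "to_sphere ` V \<subseteq> riemann_sphere - {north_pole}"
        by (rule image_subsetI) (rule to_sphere_in)
      then have "C \<subseteq> riemann_sphere - {north_pole}" using C by blast
      then have "compact C'"
        unfolding C'_def using C(1) homeomorphism_to_sphere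
        by (meson compact_continuous_image continuous_on_subset homeomorphism_cont2)
      have lim: "uniform_limit C' ((\<lambda>n. itr (k n)) \<circ> r) g sequentially"
        using ul \<open>compact C'\<close> CC by blast
      have bd: "itr (k n) y \<in> cball 0 R" if "y \<in> C'" for n y
        using that CC K_bound [of y] interior_subset by (auto simp: V_def)
      have "uniform_limit C' (\<lambda>n y. to_sphere (itr (k (r n)) y)) (\<lambda>y. to_sphere (g y)) sequentially"
      proof (rule uniform_limit_compose_uniformly_continuous_on
          [where f = to_sphere and g = "\<lambda>n. itr (k (r n))" and g' = g and B = "cball 0 R"])
        show "uniform_limit C' (\<lambda>n. itr (k (r n))) g sequentially"
          using lim by (simp only: o_def)
        show "uniformly_continuous_on (cball 0 R) to_sphere"
          by (intro compact_uniformly_continuous continuous_on_to_sphere compact_cball)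
        show "\<forall>\<^sub>F n in sequentially. \<forall>y\<in>C'. itr (k (r n)) y \<in> cball 0 R"
          using bd by (intro always_eventually) blast
      qed (rule closed_cball)
      then have lim2: "uniform_limit C (\<lambda>n x. to_sphere (itr (k (r n)) (from_sphere x))) (\<lambda>x. to_sphere (g (from_sphere x))) sequentially"
        by (rule uniform_limit_compose') (simp add: C'_def)
      have eq: "to_sphere (itr (k (r n)) (from_sphere x)) = (s \<circ> r) n x" if "x \<in> C" for n x
        using that CC by (auto simp: k sphere_map_iterate from_to_sphere)
      show ?thesis
        by (rule iffD1 [OF uniform_limit_cong' [OF eq refl] lim2])
    qed
    then show "\<exists>r g. strict_mono r \<and> (\<forall>K. compact K \<and> K \<subseteq> to_sphere ` V \<longrightarrow> uniform_limit K (s \<circ> r) g sequentially)"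
      using r by blast
  qed
  then show ?thesis
    unfolding fatou_set_def using op assms by (auto simp: V_def)
qed

text \<open>A locally uniform limit near a frontier point \<open>z\<close> would be continuous and
  equal to the north pole at the escaping points, which accumulate at \<open>z\<close>, but finite
  at \<open>z\<close> itself, whose orbit is bounded.\<close>

lemma frontier_disjoint_fatou:
  assumes "z \<in> frontier K" shows "to_sphere z \<notin> fatou_set f"
proof
  assume "to_sphere z \<in> fatou_set f"
  then obtain U where op: "openin (top_of_set riemann_sphere) U" and z: "to_sphere z \<in> U"
    and norm: "normal_on U (range (\<lambda>n. sphere_map f ^^ n))"
    by (auto simp: fatou_set_def)
  have "open (to_sphere -` U)"
    using continuous_openin_preimage [OF continuous_on_to_sphere, of UNIV riemann_sphere U]
      to_sphere_in op by (auto simp: vimage_def)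
  then obtain e where e: "e > 0" "cball z e \<subseteq> to_sphere -` U"
    using z open_contains_cball by blast
  obtain r g where r: "strict_mono (r :: nat \<Rightarrow> nat)"
    and ul: "\<And>C. compact C \<Longrightarrow> C \<subseteq> U \<Longrightarrow> uniform_limit C ((\<lambda>n. sphere_map f ^^ n) \<circ> r) g sequentially"
    using norm unfolding normal_on_def by (metis order_refl)
  have "compact (to_sphere ` cball z e)"
    by (intro compact_continuous_image continuous_on_to_sphere) auto
  then have "uniform_limit (to_sphere ` cball z e) ((\<lambda>n. sphere_map f ^^ n) \<circ> r) g sequentially"
    using ul e by blast
  then have lim: "uniform_limit (cball z e) (\<lambda>n y. to_sphere (itr (r n) y)) (\<lambda>y. g (to_sphere y)) sequentially"
    using uniform_limit_compose' [where h = to_sphere and B = "cball z e"]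
    by (fastforce simp: sphere_map_iterate)
  have cont: "continuous_on (cball z e) (\<lambda>y. g (to_sphere y))"
    by (rule uniform_limit_theorem [OF _ lim])
      (auto intro!: always_eventually continuous_on_compose2 [OF continuous_on_to_sphere [of UNIV]]
        continuous_on_itr)
  have ptlim: "(\<lambda>n. to_sphere (itr (r n) y)) \<longlonglongrightarrow> g (to_sphere y)" if "y \<in> cball z e" for y
    using tendsto_uniform_limitI [OF lim that] .
  have esc: "g (to_sphere y) = north_pole" if y: "y \<in> cball z e" "y \<notin> K" for y
  proof -
    obtain N where N: "cmod (itr N y) > R"
      using y by (auto simp: K_def not_le)
    have "(\<lambda>n. dist (to_sphere (itr (r n) y)) north_pole) \<longlonglongrightarrow> 0"
    proof (rule tendsto_sandwich [of "\<lambda>_. 0"])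
      have "dist (to_sphere (itr (r n) y)) north_pole \<le> 2 / 2 ^ (n - N)" if "n \<ge> N" for n
      proof -
        have "r n \<ge> n" using r by (simp add: seq_suble)
        then have "cmod (itr (N + (r n - N)) y) \<ge> 2 ^ (r n - N) * R"
          using iter_escape N by blast
        moreover have "2 ^ (r n - N) * R \<ge> 2 ^ (n - N) * 1"
          using R \<open>r n \<ge> n\<close> by (intro mult_mono power_increasing) auto
        ultimately have c: "cmod (itr (r n) y) \<ge> 2 ^ (n - N)"
          using \<open>r n \<ge> n\<close> \<open>n \<ge> N\<close> by simp
        then have "itr (r n) y \<noteq> 0"
          by (metis norm_zero not_le zero_less_numeral zero_less_power)
        then have "dist (to_sphere (itr (r n) y)) north_pole \<le> 2 / cmod (itr (r n) y)"
          by (rule dist_to_sphere_north)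
        also have "\<dots> \<le> 2 / 2 ^ (n - N)"
          using c by (intro frac_le) auto
        finally show ?thesis .
      qed
      then show "\<forall>\<^sub>F n in sequentially. dist (to_sphere (itr (r n) y)) north_pole \<le> 2 / 2 ^ (n - N)"
        by (auto simp: eventually_sequentially)
      have "(\<lambda>n. 2 * (1 / 2) ^ n :: real) \<longlonglongrightarrow> 2 * 0"
        by (intro tendsto_intros LIMSEQ_realpow_zero) auto
      then have "(\<lambda>n. 2 / 2 ^ n :: real) \<longlonglongrightarrow> 0"
        by (simp add: power_divide)
      then have "(\<lambda>n. 2 / 2 ^ ((n + N) - N) :: real) \<longlonglongrightarrow> 0" by simp
      then show "(\<lambda>n. 2 / 2 ^ (n - N) :: real) \<longlonglongrightarrow> 0"
        by (rule LIMSEQ_offset)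
    qed auto
    then have "(\<lambda>n. to_sphere (itr (r n) y)) \<longlonglongrightarrow> north_pole"
      by (subst tendsto_dist_iff)
    then show ?thesis using ptlim [OF y(1)] LIMSEQ_unique by blast
  qed
  have "closed {y \<in> cball z e. g (to_sphere y) = north_pole}"
    by (rule continuous_closed_preimage_constant [OF cont]) auto
  moreover have "ball z e - K \<subseteq> {y \<in> cball z e. g (to_sphere y) = north_pole}"
    using esc by auto
  ultimately have "closure (ball z e - K) \<subseteq> {y \<in> cball z e. g (to_sphere y) = north_pole}"
    by (rule closure_minimal [rotated])
  moreover have "z \<in> closure (ball z e - K)"
  proof -
    have "z \<in> closure (- K)" using assms by (simp add: frontier_closures)
    then have "z \<in> ball z e \<inter> closure (- K)" using e by simp
    then show ?thesis
      using open_Int_closure_subset [of "ball z e" "- K"] by (auto simp: Diff_eq)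
  qed
  ultimately have "g (to_sphere z) = north_pole" by blast
  moreover have "g (to_sphere z) \<in> to_sphere ` cball 0 R"
  proof (rule Lim_in_closed_set)
    show "closed (to_sphere ` cball 0 R)"
      by (intro compact_imp_closed compact_continuous_image continuous_on_to_sphere) auto
    show "(\<lambda>n. to_sphere (itr (r n) z)) \<longlonglongrightarrow> g (to_sphere z)"
      using ptlim e by simp
    have "z \<in> K" using assms compact_K compact_imp_closed frontier_subset_eq by blast
    then show "\<forall>\<^sub>F n in sequentially. to_sphere (itr (r n) z) \<in> to_sphere ` cball 0 R"
      using K_bound by (intro always_eventually) auto
  qed auto
  ultimately show False using to_sphere_ne_north by force
qed

theorem julia_set_eq: "julia_set f = to_sphere ` frontier K"
proof (rule set_eqI)
  fix x
  show "x \<in> julia_set f \<longleftrightarrow> x \<in> to_sphere ` frontier K"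
  proof (cases "x \<in> riemann_sphere - {north_pole}")
    case True
    define z where "z = from_sphere x"
    have x: "x = to_sphere z" using to_from_sphere [OF True] by (simp add: z_def)
    have "z \<in> interior K \<or> z \<in> frontier K \<or> z \<notin> K"
      using closure_subset by (auto simp: frontier_def)
    moreover have "z \<in> frontier K \<Longrightarrow> z \<notin> interior K \<and> z \<in> K"
      using compact_K compact_imp_closed frontier_subset_eq by (auto simp: frontier_def)
    ultimately have "x \<in> fatou_set f \<longleftrightarrow> z \<notin> frontier K"
      using basin_subset_fatou interior_subset_fatou frontier_disjoint_fatou x by blast
    then show ?thesis
      using True inj_to_sphere x by (auto simp: julia_set_def inj_image_mem_iff)
  next
    case False
    moreover have "north_pole \<in> fatou_set f" using basin_subset_fatou by blast
    ultimately have "x \<notin> julia_set f" by (auto simp: julia_set_def)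
    then show ?thesis
      using to_sphere_in False by blast
  qed
qed

end

section \<open>Closed Jordan domains as components of a compact set\<close>

definition bubble :: "complex set \<Rightarrow> bool" where
  "bubble E \<longleftrightarrow> (\<exists>\<gamma>. simple_path \<gamma> \<and> pathfinish \<gamma> = pathstart \<gamma> \<and>
     E = path_image \<gamma> \<union> inside (path_image \<gamma>))"

lemma bubble_boundary:
  assumes "bubble E"
  obtains \<gamma> where "simple_path \<gamma>" "pathfinish \<gamma> = pathstart \<gamma>"
    "frontier E = path_image \<gamma>" "interior E = inside (path_image \<gamma>)"
proof -
  obtain \<gamma> where \<gamma>: "simple_path \<gamma>" "pathfinish \<gamma> = pathstart \<gamma>"
    "E = path_image \<gamma> \<union> inside (path_image \<gamma>)"
    using assms by (auto simp: bubble_def)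
  note J = Jordan_inside_outside [OF \<gamma>(1,2)]
  have E: "- E = outside (path_image \<gamma>)"
    using J \<gamma>(3) by blast
  then have fr: "frontier E = path_image \<gamma>"
    using J by (metis frontier_complement)
  have "interior E = - closure (outside (path_image \<gamma>))"
    by (metis E closure_complement double_complement)
  also have "\<dots> = - (outside (path_image \<gamma>) \<union> path_image \<gamma>)"
    using J by (simp add: closure_Un_frontier)
  also have "\<dots> = inside (path_image \<gamma>)"
    using J by blast
  finally show thesis using that \<gamma> fr by blast
qed

text \<open>The part of \<open>E\<close> in the connected, unbounded outside of the curve is clopen
  there, since \<open>E\<close> is closed and \<open>E\<close> without the curve is open. It is also
  bounded, hence empty.\<close>

lemma bubbleI:
  assumes \<gamma>: "simple_path \<gamma>" "pathfinish \<gamma> = pathstart \<gamma>"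
    and E: "compact E" "path_image \<gamma> \<subseteq> E" "inside (path_image \<gamma>) \<subseteq> E"
    and op: "open (E - path_image \<gamma>)"
  shows "bubble E" "E = path_image \<gamma> \<union> inside (path_image \<gamma>)"
proof -
  note J = Jordan_inside_outside [OF \<gamma>]
  define W where "W = outside (path_image \<gamma>)"
  have W: "connected W" "\<not> bounded W"
    using J by (auto simp: W_def)
  have "W \<inter> E = {}"
  proof (rule ccontr)
    assume ne: "W \<inter> E \<noteq> {}"
    have disj: "W \<inter> path_image \<gamma> = {}"
      using J unfolding W_def by blast
    have "(E - path_image \<gamma>) \<inter> W = {} \<or> (- E) \<inter> W = {}"
    proof (rule connectedD [OF W(1) op])
      show "open (- E)" using E(1) by (simp add: compact_imp_closed open_Compl)
      show "W \<subseteq> E - path_image \<gamma> \<union> - E" using disj by blast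
    qed blast
    with disj have "W \<subseteq> E" using ne by blast
    then show False
      using W E(1) bounded_subset compact_imp_bounded by blast
  qed
  moreover have "inside (path_image \<gamma>) \<union> W = - path_image \<gamma>"
    using J by (simp add: W_def)
  ultimately show eq: "E = path_image \<gamma> \<union> inside (path_image \<gamma>)"
    using E(2,3) by blast
  show "bubble E"
    unfolding bubble_def using \<gamma> eq by blast
qed

text \<open>A ball contained in \<open>K\<close> that meets a component lies in it, so an interior
  point of \<open>K\<close> is an interior point of its component.\<close>

lemma frontier_Int_component:
  fixes K :: "complex set"
  assumes K: "compact K" and E: "E \<in> components K"
  shows "frontier K \<inter> E = frontier E" "interior K \<inter> E = interior E"
proof -
  have cl: "closed E" "closed K" and sub: "E \<subseteq> K"
    using compact_components [OF K E] K in_components_subset [OF E] by (auto simp: compact_imp_closed)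
  have "x \<in> interior E" if x: "x \<in> interior K" "x \<in> E" for x
  proof -
    obtain e where e: "e > 0" "ball x e \<subseteq> K"
      using x(1) by (auto simp: mem_interior)
    then have "E \<inter> ball x e \<noteq> {}" using x by (metis centre_in_ball disjoint_iff)
    then have "ball x e \<subseteq> E"
      using components_maximal [OF E, of "ball x e"] e by simp
    then show ?thesis using e by (auto simp: mem_interior)
  qed
  then show int: "interior K \<inter> E = interior E"
    using interior_mono [OF sub] interior_subset by blast
  show "frontier K \<inter> E = frontier E"
    using cl sub int by (auto simp: frontier_def)
qed

text \<open>Connectedness keeps each \<open>frontier E\<close> from falling apart, and a connected
  subset of \<open>frontier K\<close> lies in a single component of \<open>K\<close>, so different
  \<open>E\<close> are not joined.\<close>

lemma components_frontier:
  fixes K :: "complex set"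
  assumes K: "compact K"
    and fr: "\<And>E. E \<in> components K \<Longrightarrow> connected (frontier E) \<and> frontier E \<noteq> {}"
  shows "components (frontier K) = frontier ` components K"
proof -
  have frK: "frontier K \<subseteq> K"
    using K by (simp add: compact_imp_closed frontier_subset_closed)
  have *: "C = frontier E" if C: "C \<in> components (frontier K)" and E: "E \<in> components K" and ne: "C \<inter> E \<noteq> {}" for C E
  proof
    have "C \<subseteq> E"
      using components_maximal [OF E in_components_connected [OF C]] in_components_subset [OF C] frK ne by blast
    then show "C \<subseteq> frontier E"
      using in_components_subset [OF C] frontier_Int_component [OF K E] by blast
    then have "C \<inter> frontier E \<noteq> {}" using in_components_nonempty [OF C] by blast
    then show "frontier E \<subseteq> C"
      using components_maximal [OF C, of "frontier E"] fr [OF E] frontier_Int_component [OF K E] by blast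
  qed
  show ?thesis
  proof (rule set_eqI, rule iffI)
    fix C assume C: "C \<in> components (frontier K)"
    then obtain x where x: "x \<in> C" using in_components_nonempty by blast
    then have "x \<in> K" using in_components_subset [OF C] frK by blast
    then obtain E where "E \<in> components K" "x \<in> E"
      using Union_components by blast
    then show "C \<in> frontier ` components K" using * C x by blast
  next
    fix C assume "C \<in> frontier ` components K"
    then obtain E where E: "E \<in> components K" "C = frontier E" by blast
    then obtain x where x: "x \<in> frontier E" using fr by blast
    then have "x \<in> frontier K" "x \<in> E" using frontier_Int_component [OF K E(1)] by blast+
    then obtain D where "D \<in> components (frontier K)" "x \<in> D"
      using Union_components by blast
    then show "C \<in> components (frontier K)" using * E \<open>x \<in> E\<close> by blast
  qed
qed

lemma components_to_sphere: "components (to_sphere ` S) = (`) to_sphere ` components S"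
proof -
  have 1: "to_sphere ` C \<in> components (to_sphere ` S)" if C: "C \<in> components S" for C
    unfolding in_components_maximal
  proof (intro conjI allI impI)
    show "to_sphere ` C \<noteq> {}" "to_sphere ` C \<subseteq> to_sphere ` S"
      using in_components_nonempty [OF C] in_components_subset [OF C] by auto
    show "connected (to_sphere ` C)"
      by (intro connected_continuous_image continuous_on_to_sphere in_components_connected [OF C])
    fix D assume D: "D \<noteq> {} \<and> to_sphere ` C \<subseteq> D \<and> D \<subseteq> to_sphere ` S \<and> connected D"
    have "to_sphere ` S \<subseteq> riemann_sphere - {north_pole}"
      by (rule image_subsetI) (rule to_sphere_in)
    then have "continuous_on D from_sphere"
      using D homeomorphism_to_sphere by (meson continuous_on_subset homeomorphism_cont2)
    then have "connected (from_sphere ` D)"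
      using D connected_continuous_image by blast
    moreover have DD: "D = to_sphere ` from_sphere ` D" "from_sphere ` D \<subseteq> S"
      using D by (auto simp: image_image image_iff from_to_sphere subset_iff)
        (metis from_to_sphere)+
    moreover have "C \<subseteq> from_sphere ` D"
      using D by (metis from_to_sphere image_eqI image_subset_iff subsetI)
    ultimately have "from_sphere ` D \<subseteq> C"
      using components_maximal [OF C] in_components_nonempty [OF C] by (metis inf.absorb_iff1 inf_commute)
    with \<open>C \<subseteq> from_sphere ` D\<close> have "from_sphere ` D = C" by blast
    then show "D = to_sphere ` C" using DD(1) by simp
  qed
  have 2: "D \<in> (`) to_sphere ` components S" if D: "D \<in> components (to_sphere ` S)" for D
  proof -
    have "D \<noteq> {}" "D \<subseteq> to_sphere ` S"
      using in_components_nonempty [OF D] in_components_subset [OF D] .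
    then obtain z where z: "to_sphere z \<in> D" "z \<in> S" by blast
    then obtain C where C: "C \<in> components S" "z \<in> C"
      by (metis UnionE Union_components)
    then have "D = to_sphere ` C"
      using components_eq [OF D 1 [OF C(1)]] z by blast
    then show ?thesis using C by blast
  qed
  show ?thesis using 1 2 by blast
qed

lemma jordan_curve_to_sphere:
  assumes "simple_path \<gamma>" "pathfinish \<gamma> = pathstart \<gamma>"
  shows "jordan_curve (to_sphere ` path_image \<gamma>)"
proof -
  have "path (to_sphere \<circ> \<gamma>)"
    using assms(1) by (intro path_continuous_image continuous_on_to_sphere simple_path_imp_path)
  then have "simple_path (to_sphere \<circ> \<gamma>)"
    using assms(1) by (simp add: simple_path_def loop_free_def inj_eq [OF inj_to_sphere])
  moreover have "pathfinish (to_sphere \<circ> \<gamma>) = pathstart (to_sphere \<circ> \<gamma>)"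
    using assms(2) by (simp add: pathfinish_compose pathstart_compose)
  ultimately show ?thesis
    unfolding jordan_curve_def using path_image_compose by metis
qed

lemma not_jordan_curve_singleton:
  fixes x :: "'a::metric_space" shows "\<not> jordan_curve {x}"
  unfolding jordan_curve_def using simple_path_image_uncountable by (metis countable_finite finite.emptyI finite_insert)

text \<open>The function below is \<open>z / (z - 1)\<close> in the coordinate \<open>z\<close> of the plane.\<close>

lemma not_simply_connected_sphere_compl:
  assumes "0 \<in> K" "1 \<in> K" and circ: "\<And>w. cmod w = 1/2 \<Longrightarrow> w / (w - 1) \<notin> K"
  shows "\<not> simply_connected (riemann_sphere - to_sphere ` K)"
proof
  define U where "U = riemann_sphere - to_sphere ` K"
  \<comment> \<open>With \<open>q = (cmod z)^2 + 1\<close>, the numerator at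
    \<open>to_sphere z\<close> is \<open>2 z cnj z / q\<close> and \<open>cnj (fst x)\<close> is
    \<open>2 cnj z / q\<close>. In this form the function is also defined at the north pole, with
    value \<open>1\<close>.\<close>
  define M where "M x = of_real (1 + snd x) / (of_real (1 + snd x) - cnj (fst x))" for x :: "complex \<times> real"
  assume "simply_connected (riemann_sphere - to_sphere ` K)"
  then have sc: "simply_connected U" by (simp add: U_def)
  have M_sphere: "of_real (1 + snd (to_sphere z)) \<noteq> (0::complex)
      \<and> of_real (1 + snd (to_sphere z)) - cnj (fst (to_sphere z)) \<noteq> 0
      \<and> M (to_sphere z) = z / (z - 1)" if "z \<noteq> 0" "z \<noteq> 1" for z
  proof -
    define q where "q = (cmod z)\<^sup>2 + 1"
    have q: "q > 0" by (auto simp: q_def add_nonneg_pos)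
    have "1 + snd (to_sphere z) = 2 * (cmod z)\<^sup>2 / q"
      using q by (simp add: to_sphere_def flip: q_def) (simp add: q_def field_simps)
    then have 1: "(of_real (1 + snd (to_sphere z)) :: complex) = of_real (2 / q) * (z * cnj z)"
      by (simp add: complex_norm_square [symmetric])
    have 2: "cnj (fst (to_sphere z)) = of_real (2 / q) * cnj z"
      by (simp add: to_sphere_def q_def scaleR_conv_of_real)
    have 3: "of_real (1 + snd (to_sphere z)) - cnj (fst (to_sphere z)) = of_real (2 / q) * (cnj z * (z - 1))"
      unfolding 1 2 by (simp add: algebra_simps)
    have "of_real (2 / q) \<noteq> (0::complex)" using q by simp
    moreover have "cnj z \<noteq> 0" using that by simp
    ultimately show ?thesis
      unfolding M_def 3 unfolding 1 using that by simp
  qed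
  have U: "x = north_pole \<or> (\<exists>z. x = to_sphere z \<and> z \<noteq> 0 \<and> z \<noteq> 1)" if "x \<in> U" for x
    using that assms(1,2) to_from_sphere [of x] unfolding U_def
    by (metis DiffD1 DiffD2 DiffI imageI singletonD)
  have cont: "continuous_on U M"
  proof -
    have "of_real (1 + snd x) - cnj (fst x) \<noteq> 0" if "x \<in> U" for x
      using U [OF that] M_sphere by (auto simp: north_pole_def)
    then show ?thesis
      unfolding M_def by (intro continuous_intros) auto
  qed
  have M0: "M x \<noteq> 0" if "x \<in> U" for x
    using U [OF that] M_sphere by (auto simp: M_def north_pole_def)
  \<comment> \<open>The map \<open>w / (w - 1)\<close> is an involution, hence
    \<open>M (h w) = w\<close> on the circle.\<close>
  define h where "h w = to_sphere (w / (w - 1))" for w :: complex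
  define p where "p = h \<circ> circlepath 0 (1/2)"
  have w1: "w - 1 \<noteq> 0" if "cmod w = 1/2" for w :: complex
    using that by auto
  have "continuous_on (sphere 0 (1/2)) h"
    unfolding h_def using w1
    by (intro continuous_on_compose2 [OF continuous_on_to_sphere [of UNIV]] continuous_intros) auto
  then have "path p"
    unfolding p_def by (intro path_continuous_image) auto
  have hU: "h w \<in> U" if "cmod w = 1/2" for w
    using circ [OF that] to_sphere_in by (auto simp: U_def h_def inj_image_mem_iff [OF inj_to_sphere])
  then have "path_image p \<subseteq> U"
    by (auto simp: p_def path_image_compose)
  have Mh: "M (h w) = w" if "cmod w = 1/2" for w
  proof -
    have "w \<noteq> 0" using that by auto
    moreover have "w / (w - 1) \<noteq> 1" using w1 [OF that] by (simp add: divide_eq_eq)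
    ultimately have "M (h w) = (w / (w - 1)) / (w / (w - 1) - 1)"
      using M_sphere [of "w / (w - 1)"] w1 [OF that] by (simp add: h_def)
    also have "w / (w - 1) - 1 = 1 / (w - 1)"
      using w1 [OF that] by (simp add: field_simps)
    finally show ?thesis using w1 [OF that] by simp
  qed
  obtain a where a: "a \<in> U" using hU [of "1/2"] by auto
  have "pathfinish p = pathstart p"
    by (simp add: p_def pathfinish_compose pathstart_compose)
  then have "homotopic_loops U p (linepath a a)"
    using sc \<open>path p\<close> \<open>path_image p \<subseteq> U\<close> a
    unfolding simply_connected_eq_contractible_loop_any by blast
  \<comment> \<open>The zero \<open>0\<close> and the pole \<open>1\<close> of \<open>M\<close> both
    belong to \<open>K\<close>, so on \<open>U\<close> a null-homotopy of \<open>p\<close> becomes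
    one of the circle within the punctured plane.\<close>
  then have "homotopic_loops (- {0}) (M \<circ> p) (M \<circ> linepath a a)"
    by (rule homotopic_loops_continuous_image [OF _ cont]) (use M0 in auto)
  then have "winding_number (M \<circ> p) 0 = winding_number (M \<circ> linepath a a) 0"
    by (rule winding_number_homotopic_loops)
  moreover have "M \<circ> linepath a a = linepath (M a) (M a)"
    by (auto simp: linepath_def algebra_simps)
  moreover have "winding_number (M \<circ> p) 0 = winding_number (circlepath 0 (1/2)) 0"
  proof (rule winding_number_cong)
    fix t :: real assume "0 \<le> t" "t \<le> 1"
    then have "cmod (circlepath 0 (1/2) t) = 1/2"
      by (simp add: circlepath norm_mult)
    then show "(M \<circ> p) t = circlepath 0 (1/2) t"
      using Mh by (simp add: p_def)
  qed
  ultimately show False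
    using M0 [OF a] winding_number_circlepath_centre [of "1/2" 0] by simp
qed

lemma islimpt_to_sphere: "z islimpt S \<Longrightarrow> to_sphere z islimpt to_sphere ` S"
  unfolding islimpt_def
proof (intro allI impI)
  fix T assume S: "\<forall>T. z \<in> T \<longrightarrow> open T \<longrightarrow> (\<exists>y\<in>S. y \<in> T \<and> y \<noteq> z)" and T: "to_sphere z \<in> T" "open T"
  have "open (to_sphere -` T)"
    using T(2) continuous_on_to_sphere [of UNIV] by (simp add: continuous_on_open_vimage)
  then obtain y where "y \<in> S" "y \<in> to_sphere -` T" "y \<noteq> z"
    using S T(1) by (metis vimageI)
  then show "\<exists>y\<in>to_sphere ` S. y \<in> T \<and> y \<noteq> to_sphere z"
    using inj_to_sphere by (auto simp: inj_eq)
qed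

text \<open>A punctured disc about \<open>x\<close> that misses the frontier is connected and meets
  \<open>K\<close>, so it lies in \<open>K\<close>, which would make \<open>x\<close> an interior
  point.\<close>

lemma frontier_islimpt:
  fixes K :: "complex set"
  assumes "\<And>x. x \<in> K \<Longrightarrow> x islimpt K" and x: "x \<in> frontier K" "x \<in> K"
  shows "x islimpt frontier K"
proof (rule ccontr)
  assume "\<not> x islimpt frontier K"
  then obtain e where e: "e > 0" "\<And>y. y \<in> frontier K \<Longrightarrow> y \<noteq> x \<Longrightarrow> dist y x \<ge> e"
    unfolding islimpt_approachable by (meson not_le)
  define B where "B = ball x e - {x}"
  have "connected B"
    unfolding B_def by (rule connected_punctured_convex) (use e in \<open>auto simp: aff_dim_open\<close>)
  have "B \<inter> frontier K = {}"
    using e by (force simp: B_def dist_commute)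
  moreover have "B \<inter> K \<noteq> {}"
    using assms(1) [OF x(2)] e(1) unfolding islimpt_approachable B_def by (force simp: dist_commute)
  ultimately have "B \<subseteq> K"
    using connected_Int_frontier [OF \<open>connected B\<close>, of K] by blast
  then have "ball x e \<subseteq> K" using x by (auto simp: B_def)
  then have "x \<in> interior K" using e by (auto simp: mem_interior)
  then show False using x by (simp add: frontier_def)
qed

text \<open>The complement of \<open>frontier K\<close> in the sphere splits into the complement of \<open>K\<close>, which is
  separated by the circle \<open>{w / (w - 1) | \<bar>w\<bar> = 1/2}\<close>, and the interiors of the bubbles.\<close>

theorem cantor_bubbles_frontier:
  assumes K: "compact K" "connected (- K)"
    and comp: "\<And>E. E \<in> components K \<Longrightarrow> bubble E \<or> (\<exists>x. E = {x})"
    and inf: "infinite {E \<in> components K. bubble E}"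
    and unc: "uncountable (components K)"
    and lim: "\<And>x. x \<in> K \<Longrightarrow> x islimpt K"
    and K01: "0 \<in> K" "1 \<in> K"
    and circ: "\<And>w. cmod w = 1/2 \<Longrightarrow> w / (w - 1) \<notin> K"
  shows "cantor_bubbles (to_sphere ` frontier K)"
proof -
  define X where "X = to_sphere ` frontier K"
  define g where "g E = to_sphere ` frontier E" for E
  have frK: "frontier K \<subseteq> K"
    using K by (simp add: compact_imp_closed frontier_subset_closed)
  have fr: "connected (frontier E) \<and> frontier E \<noteq> {}" if "E \<in> components K" for E
    using comp [OF that]
  proof
    assume "bubble E"
    then obtain \<gamma> where "simple_path \<gamma>" "frontier E = path_image \<gamma>"
      by (meson bubble_boundary)
    then show ?thesis by (simp add: connected_simple_path_image)
  qed (auto simp: frontier_def)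
  have compX: "components X = g ` components K"
    unfolding X_def g_def using components_to_sphere [of "frontier K"] components_frontier [OF K(1) fr]
    by (simp add: image_image)
  have inj: "inj_on g (components K)"
  proof (rule inj_onI)
    fix E F assume EF: "E \<in> components K" "F \<in> components K" "g E = g F"
    then have "frontier E = frontier F"
      unfolding g_def by (simp add: inj_image_eq_iff [OF inj_to_sphere])
    moreover have "frontier E \<subseteq> E" "frontier F \<subseteq> F"
      using frontier_Int_component [OF K(1)] EF by blast+
    ultimately show "E = F"
      using components_eq [OF EF(1,2)] fr [OF EF(1)] by blast
  qed
  have jord: "jordan_curve (g E)" if "bubble E" for E
    using bubble_boundary [OF that] jordan_curve_to_sphere unfolding g_def by metis
  have pt: "\<exists>x. g E = {x}" if "E \<in> components K" "\<not> bubble E" for E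
    using comp [OF that(1)] that(2) by (auto simp: g_def frontier_def)
  have "closed X"
    unfolding X_def using K
    by (intro compact_imp_closed compact_continuous_image continuous_on_to_sphere compact_frontier)
  then have perf: "perfect_set X"
    using islimpt_to_sphere frontier_islimpt [OF lim] frK by (auto simp: perfect_set_def X_def)
  have sub: "X \<subseteq> riemann_sphere"
    unfolding X_def using to_sphere_in by blast
  have 1: "jordan_curve C \<or> (\<exists>x. C = {x})" if "C \<in> components X" for C
    using that jord pt unfolding compX by blast
  have J: "{C \<in> components X. jordan_curve C} = g ` {E \<in> components K. bubble E}"
  proof (rule set_eqI, rule iffI)
    fix C assume C: "C \<in> {C \<in> components X. jordan_curve C}"
    then obtain E where E: "E \<in> components K" "C = g E" by (auto simp: compX)
    then have "bubble E"
      using C pt [OF E(1)] not_jordan_curve_singleton by fastforce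
    then show "C \<in> g ` {E \<in> components K. bubble E}" using E by blast
  next
    fix C assume "C \<in> g ` {E \<in> components K. bubble E}"
    then show "C \<in> {C \<in> components X. jordan_curve C}" using jord by (auto simp: compX)
  qed
  have "countable {E \<in> components K. bubble E}"
  proof (rule countable_disjoint_nonempty_interior_subsets)
    show "pairwise disjnt {E \<in> components K. bubble E}"
      using pairwise_disjoint_components [of K] by (auto simp: pairwise_def disjnt_def)
    fix E assume E: "E \<in> {E \<in> components K. bubble E}" "interior E = {}"
    then obtain \<gamma> where "simple_path \<gamma>" "pathfinish \<gamma> = pathstart \<gamma>" "interior E = inside (path_image \<gamma>)"
      by (auto elim: bubble_boundary)
    then show "E = {}" using Jordan_inside_outside E by metis
  qed
  then have 2: "countable {C \<in> components X. jordan_curve C}"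
    unfolding J by (rule countable_image)
  have 3: "infinite {C \<in> components X. jordan_curve C}"
  proof
    assume "finite {C \<in> components X. jordan_curve C}"
    then have "finite {E \<in> components K. bubble E}"
      unfolding J by (rule finite_imageD) (rule inj_on_subset [OF inj], blast)
    with inf show False by simp
  qed
  have 4: "uncountable {C \<in> components X. \<exists>x. C = {x}}"
  proof
    assume c: "countable {C \<in> components X. \<exists>x. C = {x}}"
    have "components X \<subseteq> {C \<in> components X. jordan_curve C} \<union> {C \<in> components X. \<exists>x. C = {x}}"
      using 1 by blast
    then have "countable (components X)"
      by (rule countable_subset) (rule countable_Un [OF 2 c])
    then show False
      using unc inj unfolding compX by (simp add: countable_image_inj_eq)
  qed
  define U where "U = riemann_sphere - to_sphere ` K"
  define I where "I = to_sphere ` interior K"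
  have UX: "U \<subseteq> riemann_sphere - X" and IX: "I \<subseteq> riemann_sphere - X"
    using frK to_sphere_in unfolding U_def X_def I_def
    by (auto simp: inj_eq [OF inj_to_sphere] frontier_def)
  have cover: "riemann_sphere - X \<subseteq> U \<union> I"
  proof
    fix x assume x: "x \<in> riemann_sphere - X"
    show "x \<in> U \<union> I"
    proof (cases "x \<in> to_sphere ` K")
      case True
      then obtain z where z: "z \<in> K" "x = to_sphere z" by blast
      then have "z \<notin> frontier K" using x by (auto simp: X_def)
      then have "z \<in> interior K"
        using z closure_subset by (auto simp: frontier_def)
      then show ?thesis using z by (auto simp: I_def)
    qed (use x in \<open>auto simp: U_def\<close>)
  qed
  have UI: "U \<inter> I = {}"
    using interior_subset by (auto simp: U_def I_def)
  have dich: "C \<subseteq> U \<or> C \<subseteq> I" if C: "connected C" "C \<subseteq> riemann_sphere - X" for C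
  proof -
    obtain T where T: "open T" "U = riemann_sphere \<inter> T"
      using openin_sphere_compl [OF K(1)] unfolding U_def by (auto simp: openin_open)
    obtain T' where T': "open T'" "I = riemann_sphere \<inter> T'"
      using openin_sphere_to_sphere [OF open_interior, of K] unfolding I_def by (auto simp: openin_open)
    have "T \<inter> C = {} \<or> T' \<inter> C = {}"
    proof (rule connectedD [OF C(1) T(1) T'(1)])
      show "T \<inter> T' \<inter> C = {}" using C UI T T' by blast
      show "C \<subseteq> T \<union> T'" using C cover T T' by blast
    qed
    then show ?thesis using C cover T T' by blast
  qed
  \<comment> \<open>\<open>U\<close> is the image of \<open>- K\<close> together with the north
    pole, which is a limit of that image because \<open>K\<close> is bounded.\<close>
  have "connected U"
  proof (rule connected_intermediate_closure)
    show "connected (to_sphere ` (- K))"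
      by (intro connected_continuous_image continuous_on_to_sphere K)
    show "to_sphere ` (- K) \<subseteq> U"
      unfolding U_def using to_sphere_in by (auto simp: inj_eq [OF inj_to_sphere])
    have "north_pole \<in> closure (to_sphere ` (- K))"
      unfolding closure_approachable
    proof (intro allI impI)
      fix e :: real assume "e > 0"
      obtain B where B: "\<And>z. z \<in> K \<Longrightarrow> cmod z \<le> B"
        using compact_imp_bounded [OF K(1)] by (auto simp: bounded_iff)
      define t where "t = max (B + 1) (4 / e)"
      have "B \<ge> 0" using B [OF K01(1)] by simp
      then have t: "t > B" "t > 0" "4 / e \<le> t" by (auto simp: t_def)
      then have "of_real t \<notin> K" using B [of "of_real t"] by auto
      moreover have "dist (to_sphere (of_real t)) north_pole \<le> 2 / t"
        using dist_to_sphere_north [of "of_real t"] t by simp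
      moreover have "2 / t < e" using t \<open>e > 0\<close> by (simp add: field_simps)
      ultimately show "\<exists>y\<in>to_sphere ` (- K). dist y north_pole < e"
        by force
    qed
    moreover have "U \<subseteq> insert north_pole (to_sphere ` (- K))"
    proof
      fix x assume x: "x \<in> U"
      show "x \<in> insert north_pole (to_sphere ` (- K))"
      proof (cases "x = north_pole")
        case False
        then have "x = to_sphere (from_sphere x)"
          using x to_from_sphere [of x] by (simp add: U_def)
        then show ?thesis using x unfolding U_def by (metis ComplI DiffD2 image_eqI insertCI)
      qed simp
    qed
    ultimately show "U \<subseteq> closure (to_sphere ` (- K))"
      using closure_subset by blast
  qed
  have "north_pole \<in> U"
    using north_pole_in_sphere to_sphere_ne_north unfolding U_def by (metis Diff_iff image_iff)
  have Ucomp: "U \<in> components (riemann_sphere - X)"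
    unfolding in_components_maximal
    using \<open>connected U\<close> \<open>north_pole \<in> U\<close> UX dich UI by blast
  have "\<not> simply_connected U"
    unfolding U_def by (rule not_simply_connected_sphere_compl [OF K01 circ])
  \<comment> \<open>A component other than \<open>U\<close> is the image of the interior of one
    bubble, that is, of the inside of a Jordan curve, and this is simply connected.\<close>
  moreover have "C = U" if C: "C \<in> components (riemann_sphere - X)" "\<not> simply_connected C" for C
  proof (rule ccontr)
    assume "C \<noteq> U"
    then have "C \<inter> U = {}" using components_nonoverlap [OF C(1) Ucomp] by blast
    then have CI: "C \<subseteq> I" and "C \<noteq> {}"
      using dich [OF in_components_connected [OF C(1)] in_components_subset [OF C(1)]]
        in_components_nonempty [OF C(1)] by blast+
    then obtain z where z: "z \<in> interior K" "to_sphere z \<in> C"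
      unfolding I_def by blast
    define W where "W = from_sphere ` C"
    have WC: "C = to_sphere ` W" "W \<subseteq> interior K"
    proof -
      show "C = to_sphere ` W"
      proof -
        have "to_sphere (from_sphere x) = x" if "x \<in> C" for x
          using that CI by (auto simp: I_def from_to_sphere)
        then show ?thesis unfolding W_def image_image by simp
      qed
      show "W \<subseteq> interior K"
        unfolding W_def using CI by (force simp: I_def from_to_sphere)
    qed
    have "I \<subseteq> riemann_sphere - {north_pole}"
      unfolding I_def by (rule image_subsetI) (rule to_sphere_in)
    then have "continuous_on C from_sphere"
      using CI homeomorphism_to_sphere by (meson continuous_on_subset homeomorphism_cont2)
    then have W: "connected W"
      unfolding W_def using in_components_connected [OF C(1)] connected_continuous_image by blast
    have "z \<in> W" using z by (metis W_def from_to_sphere image_eqI)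
    have "z \<in> K" using z interior_subset by blast
    then obtain E where E: "E \<in> components K" "z \<in> E"
      using Union_components by blast
    have "W \<subseteq> E"
      using components_maximal [OF E(1) W] WC(2) interior_subset \<open>z \<in> W\<close> E(2) by blast
    then have WE: "W \<subseteq> interior E"
      using frontier_Int_component(2) [OF K(1) E(1)] WC(2) by blast
    have "bubble E"
      using comp [OF E(1)] WE \<open>z \<in> W\<close> by (metis empty_iff interior_singleton subsetD)
    then obtain \<gamma> where \<gamma>: "simple_path \<gamma>" "pathfinish \<gamma> = pathstart \<gamma>" "interior E = inside (path_image \<gamma>)"
      by (auto elim: bubble_boundary)
    have ins: "connected (interior E)" "simply_connected (interior E)"
      using Jordan_inside_outside [OF \<gamma>(1,2)] simply_connected_inside_simple_path [OF \<gamma>(1)] \<gamma>(3) by auto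
    have "interior E \<subseteq> interior K"
      using in_components_subset [OF E(1)] by (rule interior_mono)
    then have "to_sphere ` interior E \<subseteq> I" by (auto simp: I_def)
    moreover have "C \<inter> to_sphere ` interior E \<noteq> {}" using WE \<open>z \<in> W\<close> z by blast
    ultimately have "to_sphere ` interior E \<subseteq> C"
      using components_maximal [OF C(1), of "to_sphere ` interior E"] IX
        connected_continuous_image [OF continuous_on_to_sphere ins(1)] by blast
    then have Ceq: "C = to_sphere ` interior E" using WC(1) WE by blast
    have "homeomorphism (interior E) (to_sphere ` interior E) to_sphere from_sphere"
      using homeomorphism_of_subsets [OF homeomorphism_to_sphere]
        image_subsetI [of "interior E", OF to_sphere_in] by blast
    then have "interior E homeomorphic C" unfolding Ceq homeomorphic_def by blast
    then show False using homeomorphic_simply_connected ins(2) C(2) by blast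
  qed
  ultimately have 5: "\<exists>!C. C \<in> components (riemann_sphere - X) \<and> \<not> simply_connected C"
    using Ucomp by blast
  show ?thesis
    unfolding cantor_bubbles_def X_def [symmetric]
    by (intro conjI ballI sub perf 1 2 3 4 5)
qed

section \<open>The invariant curve of a perturbed doubling map\<close>

text \<open>In the coordinate \<open>\<zeta> = ln z\<close> the squaring map becomes \<open>\<zeta> \<mapsto> 2 \<zeta>\<close>. A small perturbation has
  an invariant curve \<open>\<i> t + u t\<close> on which it acts as \<open>t \<mapsto> 2 t\<close>; the function \<open>u\<close> is a fixed point
  of a contraction.\<close>

locale perturbed_doubling =
  fixes \<epsilon> :: "complex \<Rightarrow> complex"
  assumes eps_le: "\<bar>Re \<zeta>\<bar> \<le> 1 \<Longrightarrow> cmod (\<epsilon> \<zeta>) \<le> 1 / 10"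
    and eps_lipschitz: "\<bar>Re \<zeta>\<bar> \<le> 1 \<Longrightarrow> \<bar>Re \<xi>\<bar> \<le> 1 \<Longrightarrow> cmod (\<epsilon> \<zeta> - \<epsilon> \<xi>) \<le> 1 / 10 * cmod (\<zeta> - \<xi>)"
    and eps_periodic: "\<bar>Re \<zeta>\<bar> \<le> 1 \<Longrightarrow> \<epsilon> (\<zeta> + of_real (2 * pi) * \<i>) = \<epsilon> \<zeta>"
begin

lemma continuous_on_eps: "continuous_on {\<zeta>. \<bar>Re \<zeta>\<bar> \<le> 1} \<epsilon>"
  by (rule lipschitz_on_continuous_on [of "1/10"])
    (use eps_lipschitz in \<open>auto simp: lipschitz_on_def dist_norm\<close>)

lemma invariant_curve_exists:
  obtains u :: "real \<Rightarrow> complex"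
  where "continuous_on UNIV u" "\<And>t. cmod (u t) \<le> 1 / 10" "\<And>t. u (t + 2 * pi) = u t"
    "\<And>t. u (2 * t) = 2 * u t + \<epsilon> (\<i> * of_real t + u t)"
proof -
  define S where "S = {u :: real \<Rightarrow>\<^sub>C complex.
    (\<forall>t. apply_bcontfun u t \<in> cball 0 (1/10)) \<and> (\<forall>t. apply_bcontfun u (t + 2 * pi) = apply_bcontfun u t)}"
  \<comment> \<open>The functional equation solved for the term \<open>2 * u t\<close>. Halving
    preserves the bound \<open>1/10\<close> and gives the contraction factor
    \<open>(1 + 1/10) / 2 = 11/20\<close>.\<close>
  define F where "F u t = (apply_bcontfun u (2 * t) - \<epsilon> (\<i> * of_real t + apply_bcontfun u t)) / 2"
    for u :: "real \<Rightarrow>\<^sub>C complex" and t :: real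
  have re: "\<bar>Re (\<i> * of_real t + apply_bcontfun u t)\<bar> \<le> 1" if "u \<in> S" for u t
  proof -
    have "cmod (apply_bcontfun u t) \<le> 1/10" using that by (auto simp: S_def)
    then show ?thesis using abs_Re_le_cmod [of "apply_bcontfun u t"] by simp
  qed
  have Fle: "cmod (F u t) \<le> 1/10" if "u \<in> S" for u t
  proof -
    have "cmod (apply_bcontfun u (2 * t)) \<le> 1/10" using that by (auto simp: S_def)
    then show ?thesis
      using eps_le [OF re [OF that, of t]]
        norm_triangle_ineq4 [of "apply_bcontfun u (2 * t)" "\<epsilon> (\<i> * of_real t + apply_bcontfun u t)"]
      by (simp add: F_def norm_divide)
  qed
  have Fcont: "continuous_on UNIV (F u)" if "u \<in> S" for u
  proof -
    have "continuous_on UNIV (\<lambda>t. \<epsilon> (\<i> * of_real t + apply_bcontfun u t))"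
      by (rule continuous_on_compose2 [OF continuous_on_eps])
        (auto intro!: continuous_intros simp: re [OF that, simplified])
    moreover have "continuous_on UNIV (\<lambda>t. apply_bcontfun u (2 * t))"
      by (rule continuous_on_compose2 [OF continuous_on_apply_bcontfun [of UNIV]]) (auto intro!: continuous_intros)
    ultimately show ?thesis
      unfolding F_def by (intro continuous_intros) auto
  qed
  have Fin: "F u \<in> bcontfun" if "u \<in> S" for u
    using bcontfun_normI [OF Fcont [OF that] Fle [OF that]] .
  have app: "apply_bcontfun (Bcontfun (F u)) = F u" if "u \<in> S" for u
    using Bcontfun_inverse [OF Fin [OF that]] .
  have "closed S"
  proof -
    have "S = (PiC UNIV (\<lambda>_. cball 0 (1/10))) \<inter> {u. \<forall>t. apply_bcontfun u (t + 2 * pi) = apply_bcontfun u t}"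
      unfolding S_def by (auto simp: mem_PiC_iff Pi_def)
    moreover have "closed (PiC (UNIV :: real set) (\<lambda>_. cball (0::complex) (1/10)))"
      by (rule closed_PiC) auto
    moreover have "closed {u :: real \<Rightarrow>\<^sub>C complex. \<forall>t. apply_bcontfun u (t + 2 * pi) = apply_bcontfun u t}"
    proof (intro closed_Collect_all closed_Collect_eq)
      have "continuous_on UNIV (\<lambda>u :: real \<Rightarrow>\<^sub>C complex. apply_bcontfun u t)" for t
        by (rule lipschitz_on_continuous_on [of 1]) (auto simp: lipschitz_on_def dist_bounded)
      then show "continuous_on UNIV (\<lambda>u :: real \<Rightarrow>\<^sub>C complex. apply_bcontfun u (t + 2 * pi))"
        "continuous_on UNIV (\<lambda>u :: real \<Rightarrow>\<^sub>C complex. apply_bcontfun u t)" for t by blast+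
    qed
    ultimately show ?thesis by (simp add: closed_Int)
  qed
  have "\<exists>!u\<in>S. Bcontfun (F u) = u"
  proof (rule Banach_fix)
    show "complete S" using \<open>closed S\<close> by (simp add: complete_eq_closed)
    have "0 \<in> S" by (simp add: S_def)
    then show "S \<noteq> {}" by blast
    show "0 \<le> (11/20 :: real)" "11/20 < (1 :: real)" by auto
    show "(\<lambda>u. Bcontfun (F u)) ` S \<subseteq> S"
    proof (rule image_subsetI)
      fix u assume u: "u \<in> S"
      have "F u (t + 2 * pi) = F u t" for t
      proof -
        have per: "apply_bcontfun u (s + 2 * pi) = apply_bcontfun u s" for s
          using u by (simp add: S_def)
        have "apply_bcontfun u (2 * (t + 2 * pi)) = apply_bcontfun u ((2 * t + 2 * pi) + 2 * pi)"
          by (simp add: algebra_simps)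
        also have "\<dots> = apply_bcontfun u (2 * t)" by (simp only: per)
        finally have 1: "apply_bcontfun u (2 * (t + 2 * pi)) = apply_bcontfun u (2 * t)" .
        have "\<epsilon> (\<i> * of_real (t + 2 * pi) + apply_bcontfun u (t + 2 * pi))
            = \<epsilon> ((\<i> * of_real t + apply_bcontfun u t) + of_real (2 * pi) * \<i>)"
          unfolding per by (simp add: algebra_simps)
        also have "\<dots> = \<epsilon> (\<i> * of_real t + apply_bcontfun u t)"
          by (rule eps_periodic [OF re [OF u]])
        finally show ?thesis unfolding F_def 1 by simp
      qed
      then show "Bcontfun (F u) \<in> S"
        using Fle [OF u] by (simp add: S_def app [OF u])
    qed
    fix u v assume uv: "u \<in> S" "v \<in> S"
    show "dist (Bcontfun (F u)) (Bcontfun (F v)) \<le> 11/20 * dist u v"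
    proof (rule dist_bound)
      fix t
      have d: "dist (apply_bcontfun u s) (apply_bcontfun v s) \<le> dist u v" for s
        by (rule dist_bounded)
      have "cmod (\<epsilon> (\<i> * of_real t + apply_bcontfun u t) - \<epsilon> (\<i> * of_real t + apply_bcontfun v t))
          \<le> 1/10 * cmod ((\<i> * of_real t + apply_bcontfun u t) - (\<i> * of_real t + apply_bcontfun v t))"
        by (rule eps_lipschitz [OF re [OF uv(1)] re [OF uv(2)]])
      also have "\<dots> \<le> 1/10 * dist u v"
        using d [of t] by (simp add: dist_norm)
      finally have 1: "cmod (\<epsilon> (\<i> * of_real t + apply_bcontfun u t) - \<epsilon> (\<i> * of_real t + apply_bcontfun v t))
          \<le> 1/10 * dist u v" .
      have "F u t - F v t = ((apply_bcontfun u (2 * t) - apply_bcontfun v (2 * t))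
          - (\<epsilon> (\<i> * of_real t + apply_bcontfun u t) - \<epsilon> (\<i> * of_real t + apply_bcontfun v t))) / 2"
        by (simp add: F_def diff_divide_distrib)
      then have "cmod (F u t - F v t) \<le> (cmod (apply_bcontfun u (2 * t) - apply_bcontfun v (2 * t))
          + cmod (\<epsilon> (\<i> * of_real t + apply_bcontfun u t) - \<epsilon> (\<i> * of_real t + apply_bcontfun v t))) / 2"
        by (simp only: norm_divide norm_numeral divide_right_mono [OF norm_triangle_ineq4] zero_le_numeral)
      also have "\<dots> \<le> (dist u v + 1/10 * dist u v) / 2"
        using 1 d [of "2 * t"] by (simp add: dist_norm)
      finally show "dist (apply_bcontfun (Bcontfun (F u)) t) (apply_bcontfun (Bcontfun (F v)) t) \<le> 11/20 * dist u v"
        using uv by (simp add: app dist_norm)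
    qed
  qed
  then obtain u where u: "u \<in> S" "Bcontfun (F u) = u" by blast
  have "apply_bcontfun u (2 * t) = 2 * apply_bcontfun u t + \<epsilon> (\<i> * of_real t + apply_bcontfun u t)" for t
  proof -
    have "F u t = apply_bcontfun u t" using app [OF u(1)] u(2) by metis
    then show ?thesis by (simp add: F_def field_simps)
  qed
  then show thesis
    using that [of "apply_bcontfun u"] u(1) by (simp add: S_def)
qed

definition u :: "real \<Rightarrow> complex" where
  "u = (SOME u. continuous_on UNIV u \<and> (\<forall>t. cmod (u t) \<le> 1 / 10) \<and> (\<forall>t. u (t + 2 * pi) = u t) \<and>
    (\<forall>t. u (2 * t) = 2 * u t + \<epsilon> (\<i> * of_real t + u t)))"

lemma u_properties:
  "continuous_on UNIV u" "cmod (u t) \<le> 1 / 10" "u (t + 2 * pi) = u t"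
  "u (2 * t) = 2 * u t + \<epsilon> (\<i> * of_real t + u t)"
proof -
  have "\<exists>u. continuous_on UNIV u \<and> (\<forall>t. cmod (u t) \<le> 1 / 10) \<and> (\<forall>t. u (t + 2 * pi) = u t) \<and>
    (\<forall>t. u (2 * t) = 2 * u t + \<epsilon> (\<i> * of_real t + u t))"
    using invariant_curve_exists by metis
  from someI_ex [OF this] show "continuous_on UNIV u" "cmod (u t) \<le> 1 / 10" "u (t + 2 * pi) = u t"
    "u (2 * t) = 2 * u t + \<epsilon> (\<i> * of_real t + u t)"
    unfolding u_def by blast+
qed

definition \<Gamma> :: "real \<Rightarrow> complex" where "\<Gamma> t = \<i> * of_real t + u t"

lemma Re_Gamma: "\<bar>Re (\<Gamma> t)\<bar> \<le> 1 / 10"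
  using abs_Re_le_cmod [of "u t"] u_properties(2) [of t] by (simp add: \<Gamma>_def)

lemma Gamma_double: "\<Gamma> (2 * t) = 2 * \<Gamma> t + \<epsilon> (\<Gamma> t)"
  using u_properties(4) [of t] by (simp add: \<Gamma>_def algebra_simps)

lemma continuous_on_Gamma: "continuous_on S \<Gamma>"
  unfolding \<Gamma>_def using u_properties(1) continuous_on_subset
  by (intro continuous_intros) auto

lemma Gamma_periodic: "\<Gamma> (t + 2 * pi * of_int k) = \<Gamma> t + 2 * of_real pi * of_int k * \<i>"
proof -
  have nat: "u (t + 2 * pi * of_nat n) = u t" for t n
  proof (induction n)
    case (Suc n)
    have "u (t + 2 * pi * of_nat (Suc n)) = u ((t + 2 * pi * of_nat n) + 2 * pi)"
      by (simp add: algebra_simps)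
    then show ?case using Suc u_properties(3) by simp
  qed simp
  have "u (t + 2 * pi * of_int k) = u t"
  proof (cases "k \<ge> 0")
    case True
    then show ?thesis using nat [of t "nat k"] by simp
  next
    case False
    then show ?thesis using nat [of "t + 2 * pi * of_int k" "nat (- k)"] by simp
  qed
  then show ?thesis by (simp add: \<Gamma>_def algebra_simps)
qed

text \<open>Equality of \<open>\<Gamma>\<close> at \<open>s\<close> and \<open>t'\<close> propagates
  to \<open>2^n s\<close> and \<open>2^n t'\<close> for all \<open>n\<close>. As \<open>u\<close> is
  bounded, these parameters stay close although their distance doubles each time, so
  \<open>s = t'\<close>.\<close>

lemma exp_Gamma_eqD:
  assumes "exp (\<Gamma> s) = exp (\<Gamma> t)"
  shows "\<exists>k::int. s = t + 2 * pi * of_int k"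
proof -
  obtain k :: int where k: "\<Gamma> s = \<Gamma> t + (of_int (2 * k) * pi) * \<i>"
    using assms by (auto simp: exp_eq)
  define t' where "t' = t + 2 * pi * of_int k"
  have "\<Gamma> s = \<Gamma> t'"
    using k unfolding t'_def Gamma_periodic by (simp add: mult_ac)
  then have eq: "\<Gamma> (2 ^ n * s) = \<Gamma> (2 ^ n * t')" for n
    by (induction n) (use Gamma_double in \<open>auto simp: mult.assoc\<close>)
  have bd: "2 ^ n * \<bar>s - t'\<bar> \<le> 1" for n
  proof -
    have "\<i> * of_real (2 ^ n * s - 2 ^ n * t') = u (2 ^ n * t') - u (2 ^ n * s)"
      using eq [of n] by (simp add: \<Gamma>_def algebra_simps)
    then have "cmod (\<i> * of_real (2 ^ n * s - 2 ^ n * t')) \<le> 1/10 + 1/10"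
      using norm_triangle_ineq4 [of "u (2 ^ n * t')" "u (2 ^ n * s)"] u_properties(2)
      by (smt (verit, best))
    then have "\<bar>2 ^ n * s - 2 ^ n * t'\<bar> \<le> 1/10 + 1/10"
      by (simp only: norm_mult norm_of_real norm_ii mult_1_left)
    moreover have "\<bar>2 ^ n * s - 2 ^ n * t'\<bar> = 2 ^ n * \<bar>s - t'\<bar>"
      by (simp add: abs_mult flip: right_diff_distrib)
    ultimately show ?thesis by simp
  qed
  have "s = t'"
  proof (rule ccontr)
    assume "s \<noteq> t'"
    then obtain n where "1 / \<bar>s - t'\<bar> < 2 ^ n"
      using real_arch_pow [of 2 "1 / \<bar>s - t'\<bar>"] by auto
    then show False
      using bd [of n] \<open>s \<noteq> t'\<close> by (simp add: field_simps)
  qed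
  then show ?thesis unfolding t'_def by blast
qed

text \<open>The parameter \<open>t\<close> is the limit of \<open>Im (\<zeta> n) / 2^n\<close>. The
  difference from the orbit of \<open>\<Gamma> t\<close> remains bounded in the strip, yet every
  step expands it by at least \<open>2 - 1/10\<close>; so it vanishes.\<close>

lemma shadowing:
  fixes \<zeta> :: "nat \<Rightarrow> complex"
  assumes strip: "\<And>n. \<bar>Re (\<zeta> n)\<bar> \<le> 1" and orbit: "\<And>n. \<zeta> (Suc n) = 2 * \<zeta> n + \<epsilon> (\<zeta> n)"
  obtains t where "\<zeta> 0 = \<Gamma> t"
proof -
  \<comment> \<open>Step \<open>n\<close> changes \<open>Im (\<zeta> n) / 2^n\<close> by at most
    \<open>(1/10) / 2^(n + 1)\<close>, and all changes from \<open>n\<close> on add up to at most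
    the half-width \<open>(1/10) / 2^n\<close>. So the intervals are nested.\<close>
  define lo hi where "lo n = Im (\<zeta> n) / 2 ^ n - (1/10) / 2 ^ n"
    and "hi n = Im (\<zeta> n) / 2 ^ n + (1/10) / 2 ^ n" for n
  have im: "\<bar>Im (\<zeta> (Suc n)) - 2 * Im (\<zeta> n)\<bar> \<le> 1/10" for n
    using eps_le [OF strip, of n] abs_Im_le_cmod [of "\<epsilon> (\<zeta> n)"] by (simp add: orbit)
  have "lo n \<le> lo (Suc n)" "hi (Suc n) \<le> hi n" for n
  proof -
    have "lo n = (2 * Im (\<zeta> n) - 2/10) / 2 ^ Suc n" "lo (Suc n) = (Im (\<zeta> (Suc n)) - 1/10) / 2 ^ Suc n"
      "hi n = (2 * Im (\<zeta> n) + 2/10) / 2 ^ Suc n" "hi (Suc n) = (Im (\<zeta> (Suc n)) + 1/10) / 2 ^ Suc n"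
      by (simp_all add: lo_def hi_def add_divide_distrib diff_divide_distrib)
    then show "lo n \<le> lo (Suc n)" "hi (Suc n) \<le> hi n"
      using im [of n] by (auto intro!: divide_right_mono simp only:) (auto simp: abs_le_iff)
  qed
  then have mono: "incseq lo" "decseq hi" by (auto intro: incseq_SucI decseq_SucI)
  have lohi: "lo n \<le> hi m" for n m
  proof -
    have "lo n \<le> lo (max n m)" "hi (max n m) \<le> hi m"
      using mono by (auto simp: incseq_def decseq_def)
    moreover have "lo (max n m) \<le> hi (max n m)" by (simp add: lo_def hi_def)
    ultimately show ?thesis by linarith
  qed
  define t where "t = Sup (range lo)"
  have t1: "lo n \<le> t" for n
    unfolding t_def using lohi [of _ 0] by (intro cSup_upper bdd_aboveI) auto
  have t2: "t \<le> hi n" for n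
    unfolding t_def using lohi by (intro cSup_least) auto
  have imt: "\<bar>Im (\<zeta> n) - 2 ^ n * t\<bar> \<le> 1/10" for n
    using t1 [of n] t2 [of n] unfolding abs_le_iff by (auto simp: lo_def hi_def field_simps)
  define D where "D n = \<zeta> n - \<Gamma> (2 ^ n * t)" for n
  have D2: "cmod (D n) \<le> 2" for n
  proof -
    have "\<bar>Re (D n)\<bar> \<le> 1 + 1/10"
      using strip [of n] Re_Gamma [of "2 ^ n * t"] unfolding D_def minus_complex.sel by linarith
    moreover have "\<bar>Im (D n)\<bar> \<le> 1/10 + 1/10"
    proof -
      have "Im (D n) = (Im (\<zeta> n) - 2 ^ n * t) - Im (u (2 ^ n * t))"
        by (simp add: D_def \<Gamma>_def)
      then show ?thesis
        using imt [of n] abs_Im_le_cmod [of "u (2 ^ n * t)"] u_properties(2) [of "2 ^ n * t"] by linarith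
    qed
    ultimately show ?thesis using cmod_le [of "D n"] by linarith
  qed
  have step: "cmod (D (Suc n)) \<ge> 19/10 * cmod (D n)" for n
  proof -
    have G1: "\<bar>Re (\<Gamma> (2 ^ n * t))\<bar> \<le> 1" using Re_Gamma [of "2 ^ n * t"] by linarith
    have "D (Suc n) = 2 * D n + (\<epsilon> (\<zeta> n) - \<epsilon> (\<Gamma> (2 ^ n * t)))"
      using Gamma_double [of "2 ^ n * t"] by (simp add: D_def orbit mult.assoc)
    moreover have "cmod (\<epsilon> (\<zeta> n) - \<epsilon> (\<Gamma> (2 ^ n * t))) \<le> 1/10 * cmod (D n)"
      using eps_lipschitz [OF strip G1] by (simp add: D_def)
    ultimately show ?thesis
      using norm_diff_ineq [of "2 * D n" "\<epsilon> (\<zeta> n) - \<epsilon> (\<Gamma> (2 ^ n * t))"]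
      by (simp add: norm_mult)
  qed
  have pow: "cmod (D n) \<ge> (19/10) ^ n * cmod (D 0)" for n
  proof (induction n)
    case (Suc n)
    then show ?case using step [of n] by simp
  qed simp
  have "D 0 = 0"
  proof (rule ccontr)
    assume "D 0 \<noteq> 0"
    then obtain n where "2 / cmod (D 0) < (19/10) ^ n"
      using real_arch_pow [of "19/10" "2 / cmod (D 0)"] by auto
    then have "2 < (19/10) ^ n * cmod (D 0)"
      using \<open>D 0 \<noteq> 0\<close> by (subst (asm) pos_divide_less_eq) simp_all
    then show False
      using pow [of n] D2 [of n] by linarith
  qed
  then show thesis using that by (simp add: D_def)
qed

definition curve :: "complex \<Rightarrow> real \<Rightarrow> complex" where
  "curve b x = exp (b + \<Gamma> (2 * pi * x))"

lemma simple_path_curve: "simple_path (curve b)"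
  and pathfinish_curve: "pathfinish (curve b) = pathstart (curve b)"
proof -
  have "path (curve b)"
    unfolding path_def curve_def
    by (intro continuous_intros continuous_on_compose2 [OF continuous_on_Gamma [of UNIV]]) auto
  moreover have "x = y \<or> x = 0 \<and> y = 1 \<or> x = 1 \<and> y = 0"
    if xy: "x \<in> {0..1}" "y \<in> {0..1}" "curve b x = curve b y" for x y
  proof -
    have "exp (\<Gamma> (2 * pi * x)) = exp (\<Gamma> (2 * pi * y))"
      using xy(3) by (simp add: curve_def exp_add)
    then obtain k :: int where "2 * pi * x = 2 * pi * y + 2 * pi * of_int k"
      using exp_Gamma_eqD by blast
    then have "2 * pi * x = 2 * pi * (y + of_int k)" by (simp add: algebra_simps)
    then have "x = y + of_int k" by simp
    moreover from this have "\<bar>of_int k :: real\<bar> \<le> 1" using xy by auto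
    then have "k = 0 \<or> k = 1 \<or> k = -1" by linarith
    ultimately show ?thesis using xy by auto
  qed
  ultimately show "simple_path (curve b)"
    unfolding simple_path_def loop_free_def by blast
  have "\<Gamma> (2 * pi) = \<Gamma> 0 + 2 * of_real pi * \<i>"
    using Gamma_periodic [of 0 1] by simp
  then show "pathfinish (curve b) = pathstart (curve b)"
    by (simp add: pathfinish_def pathstart_def curve_def exp_add)
qed

text \<open>Letting \<open>t\<close> run over all reals makes invariance under doubling immediate,
  since \<open>2 * t\<close> may leave the period.\<close>

lemma path_image_curve: "path_image (curve b) = range (\<lambda>t. exp (b + \<Gamma> t))"
proof
  show "path_image (curve b) \<subseteq> range (\<lambda>t. exp (b + \<Gamma> t))"
    by (auto simp: path_image_def curve_def)
  show "range (\<lambda>t. exp (b + \<Gamma> t)) \<subseteq> path_image (curve b)"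
  proof (rule image_subsetI)
    fix t
    define k where "k = \<lfloor>t / (2 * pi)\<rfloor>"
    define x where "x = t / (2 * pi) - of_int k"
    have "x \<in> {0..1}" unfolding x_def k_def atLeastAtMost_iff by linarith
    have "t = 2 * pi * x + 2 * pi * of_int k"
      by (simp add: x_def field_simps)
    then have "\<Gamma> t = \<Gamma> (2 * pi * x) + 2 * of_real pi * of_int k * \<i>"
      using Gamma_periodic by simp
    then have "exp (b + \<Gamma> t) = exp (b + \<Gamma> (2 * pi * x) + 2 * of_real pi * of_int k * \<i>)"
      by (simp add: add.assoc)
    also have "\<dots> = curve b x"
      unfolding curve_def by (subst exp_eq) (auto intro!: exI [of _ k])
    finally show "exp (b + \<Gamma> t) \<in> path_image (curve b)"
      using \<open>x \<in> {0..1}\<close> by (auto simp: path_image_def)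
  qed
qed

end

section \<open>The cubic family\<close>

lemma Ln_lipschitz:
  assumes "cmod (x - 1) \<le> 1/2" "cmod (y - 1) \<le> 1/2"
  shows "cmod (Ln x - Ln y) \<le> 2 * cmod (x - y)"
proof (rule field_differentiable_bound [of "cball 1 (1/2)" Ln inverse])
  fix z :: complex assume z: "z \<in> cball 1 (1/2)"
  then have *: "cmod (1 - z) \<le> 1/2" by (simp add: dist_norm)
  then have "Re z \<ge> 1/2"
    using abs_Re_le_cmod [of "1 - z"] by simp
  then have "z \<notin> \<real>\<^sub>\<le>\<^sub>0" by (auto simp: complex_nonpos_Reals_iff)
  then show "(Ln has_field_derivative inverse z) (at z within cball 1 (1/2))"
    using has_field_derivative_Ln has_field_derivative_at_within by blast
  have "cmod z \<ge> 1/2" using \<open>Re z \<ge> 1/2\<close> complex_Re_le_cmod [of z] by linarith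
  then have "inverse (cmod z) \<le> inverse (1/2)"
    by (intro le_imp_inverse_le) auto
  then show "cmod (inverse z) \<le> 2" by (simp add: norm_inverse)
qed (use assms in \<open>auto simp: dist_norm norm_minus_commute\<close>)

text \<open>The points with \<open>cmod (exp z) \<le> M\<close> form a half-plane, which is convex,
  and \<open>exp\<close> is its own derivative.\<close>

lemma exp_lipschitz:
  assumes "cmod (exp a) \<le> M" "cmod (exp b) \<le> M"
  shows "cmod (exp a - exp b) \<le> M * cmod (a - b)"
proof -
  have M: "M > 0" using assms(1) by (metis exp_not_eq_zero less_le_trans zero_less_norm_iff)
  define S where "S = {z. Re z \<le> ln M}"
  have S: "z \<in> S \<longleftrightarrow> cmod (exp z) \<le> M" for z
    using M by (simp add: S_def norm_exp_eq_Re ln_ge_iff)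
  show ?thesis
  proof (rule field_differentiable_bound [of S exp exp])
    show "convex S" unfolding S_def by (rule convex_halfspace_Re_le)
    show "(exp has_field_derivative exp z) (at z within S)" for z
      by (rule DERIV_exp [THEN has_field_derivative_at_within])
  qed (use assms S in auto)
qed

text \<open>\<open>real p * r = 1 / 100\<close> keeps the sum of up to \<open>p\<close> errors of
  order \<open>r^2\<close> below \<open>r\<close>. The \<open>8\<close> in \<open>A\<close> is
  fitted to the bound \<open>4\<close> in \<open>small_preimage\<close>.\<close>

locale cubic_scale =
  fixes p :: nat and r A :: real
  assumes p: "p \<ge> 1" and r_eq: "r = 1 / (100 * real p)" and A_eq: "A = 8 / r\<^sup>2"
begin

lemma r: "r > 0" "r \<le> 1 / 100" "real p * r = 1 / 100"
  using p by (auto simp: r_eq field_simps)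

lemma A: "A > 0" "A * r\<^sup>2 = 8" "A \<ge> 80000"
proof -
  show "A > 0" "A * r\<^sup>2 = 8" using r by (auto simp: A_eq)
  have "r\<^sup>2 \<le> (1/100)\<^sup>2" using r by (intro power_mono) auto
  then have "8 / r\<^sup>2 \<ge> 8 / (1/100)\<^sup>2" using r by (intro divide_left_mono) auto
  then show "A \<ge> 80000" by (simp add: A_eq power2_eq_square)
qed

lemma r2: "r\<^sup>2 \<le> r / 100" "r\<^sup>2 \<le> 1 / 10000" "r\<^sup>2 > 0"
proof -
  have s: "r * r \<le> r * (1/100)" using r by (intro mult_left_mono) auto
  have "r * r > 0" using r by simp
  then show "r\<^sup>2 \<le> r / 100" "r\<^sup>2 \<le> 1 / 10000" "r\<^sup>2 > 0"
    using r s unfolding power2_eq_square by linarith+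
qed

section \<open>The two pieces and the divided difference of the cubic\<close>

definition V0 :: "complex set" where "V0 = cball 0 r"
definition V1 :: "complex set" where "V1 = cball 1 (2 * r\<^sup>2)"

lemma V1_norm: "w \<in> V1 \<Longrightarrow> cmod (w - 1) \<le> 2 * r\<^sup>2"
  by (simp add: V1_def dist_norm norm_minus_commute)

lemma V0_norm: "w \<in> V0 \<Longrightarrow> cmod w \<le> r"
  by (simp add: V0_def)

lemma V_dist: "z \<in> V0 \<Longrightarrow> w \<in> V1 \<Longrightarrow> cmod (w - z) \<ge> 1/2"
proof -
  assume "z \<in> V0" "w \<in> V1"
  then have "cmod z \<le> r" "cmod (1 - w) \<le> 2 * r\<^sup>2"
    by (auto simp: V0_def V1_def dist_norm)
  moreover have "1 \<le> cmod (w - z) + cmod z + cmod (1 - w)"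
    using norm_triangle_ineq [of "w - z" z] norm_triangle_ineq [of w "1 - w"] by simp
  ultimately show ?thesis using r r2 by linarith
qed

lemma V_disjoint: "V0 \<inter> V1 = {}"
  using V_dist by fastforce

text \<open>One of \<open>cmod z\<close> and \<open>cmod (z - 1)\<close> is at least
  \<open>1/2\<close>. What remains is \<open>A * (cmod z)^2 \<le> 8 = A * r^2\<close> or
  \<open>A * cmod (z - 1) \<le> 16 = A * (2 * r^2)\<close>, which explains the radii of
  \<open>V0\<close> and \<open>V1\<close>.\<close>

lemma small_preimage:
  assumes "A * (cmod z)\<^sup>2 * cmod (z - 1) \<le> 4" shows "z \<in> V0 \<union> V1"
proof (cases "cmod z < 1/2")
  case True
  then have "cmod (z - 1) \<ge> 1/2"
    using norm_triangle_ineq2 [of 1 z] by (simp add: norm_minus_commute)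
  then have "A * (cmod z)\<^sup>2 * (1/2) \<le> A * (cmod z)\<^sup>2 * cmod (z - 1)"
    using A by (intro mult_left_mono) auto
  then have "A * (cmod z)\<^sup>2 \<le> A * r\<^sup>2" using assms A by linarith
  then have "(cmod z)\<^sup>2 \<le> r\<^sup>2" using mult_le_cancel_left_pos [OF A(1)] by blast
  then have "cmod z \<le> r" using r by (simp add: power2_le_iff_abs_le)
  then show ?thesis by (simp add: V0_def)
next
  case False
  then have z: "(cmod z)\<^sup>2 \<ge> 1/4"
    using power_mono [of "1/2" "cmod z" 2] by (simp add: power2_eq_square)
  then have "A * (1/4) * cmod (z - 1) \<le> A * (cmod z)\<^sup>2 * cmod (z - 1)"
    using A by (intro mult_right_mono mult_left_mono) auto
  then have "A * cmod (z - 1) \<le> A * (2 * r\<^sup>2)" using assms A by linarith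
  then have "cmod (z - 1) \<le> 2 * r\<^sup>2" using mult_le_cancel_left_pos [OF A(1)] by blast
  then show ?thesis by (simp add: V1_def dist_norm norm_minus_commute)
qed

text \<open>The divided difference of \<open>z^2 (z - 1)\<close>; its value \<open>1\<close> at
  \<open>(1, 1)\<close> is the derivative at \<open>1\<close>.\<close>

definition Q :: "complex \<Rightarrow> complex \<Rightarrow> complex" where
  "Q w a = w\<^sup>2 + w * a + a\<^sup>2 - w - a"

lemma Q_near_1:
  assumes "w \<in> V1" "a \<in> V1" shows "cmod (Q w a - 1) \<le> 9 * r\<^sup>2"
proof -
  define s t where "s = w - 1" and "t = a - 1"
  have st: "cmod s \<le> 2 * r\<^sup>2" "cmod t \<le> 2 * r\<^sup>2"
    using assms V1_norm by (auto simp: s_def t_def)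
  have "Q w a - 1 = 2 * s + 2 * t + s * s + s * t + t * t"
    by (simp add: Q_def s_def t_def algebra_simps power2_eq_square)
  then have "cmod (Q w a - 1) \<le> cmod (2 * s) + cmod (2 * t) + cmod (s * s) + cmod (s * t) + cmod (t * t)"
    by (simp only:) (intro order_trans [OF norm_triangle_ineq add_right_mono] order_refl)
  also have "\<dots> \<le> 2 * (2 * r\<^sup>2) + 2 * (2 * r\<^sup>2) + 2 * r\<^sup>2 * (2 * r\<^sup>2) + 2 * r\<^sup>2 * (2 * r\<^sup>2) + 2 * r\<^sup>2 * (2 * r\<^sup>2)"
    unfolding norm_mult using st r2 by (intro add_mono mult_mono) auto
  also have "\<dots> = 8 * r\<^sup>2 + 12 * r\<^sup>2 * r\<^sup>2" by simp
  also have "12 * r\<^sup>2 * r\<^sup>2 \<le> 12 * r\<^sup>2 * (1/12)"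
    using r2 by (intro mult_left_mono) auto
  finally show ?thesis by simp
qed

lemma Q_lipschitz:
  assumes "w \<in> V1" "w' \<in> V1" "a \<in> V1" shows "cmod (Q w a - Q w' a) \<le> 3 * cmod (w - w')"
proof -
  have "Q w a - Q w' a = (w - w') * (2 + ((w - 1) + (w' - 1) + (a - 1)))"
    by (simp add: Q_def algebra_simps power2_eq_square)
  moreover have "cmod (2 + ((w - 1) + (w' - 1) + (a - 1))) \<le> 2 + (cmod (w - 1) + cmod (w' - 1) + cmod (a - 1))"
    using norm_triangle_ineq [of 2 "(w - 1) + (w' - 1) + (a - 1)"]
      norm_triangle_ineq [of "(w - 1) + (w' - 1)" "a - 1"] norm_triangle_ineq [of "w - 1" "w' - 1"] by simp
  moreover have "\<dots> \<le> 3"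
    using V1_norm [OF assms(1)] V1_norm [OF assms(2)] V1_norm [OF assms(3)] r2 by linarith
  ultimately show ?thesis
    using mult_left_mono [of "cmod (2 + ((w - 1) + (w' - 1) + (a - 1)))" 3 "cmod (w - w')"]
    by (simp add: norm_mult mult.commute)
qed

lemma norm_Q_ge:
  assumes "w \<in> V1" "w' \<in> V1" shows "cmod (Q w w') \<ge> 1/2"
  using Q_near_1 [OF assms] r2 norm_triangle_ineq2 [of 1 "1 - Q w w'"]
  by (simp add: norm_minus_commute)

text \<open>The equation is the fixed point equation of \<open>w \<mapsto> 1 + v / (A w^2)\<close>,
  which maps the disc of radius \<open>8 / A = r^2\<close> to itself, so Brouwer's theorem applies.
  The other half of the radius of \<open>V1\<close> is room for points near the critical orbit, used
  in \<open>small_follow\<close>.\<close>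

lemma preimage_V1:
  assumes "cmod v \<le> 4" obtains w where "w \<in> cball 1 (r\<^sup>2)" "of_real A * w\<^sup>2 * (w - 1) = v"
proof -
  define h where "h w = 1 + v / (of_real A * w\<^sup>2)" for w :: complex
  have w: "cmod w \<ge> 9/10" if "w \<in> cball 1 (r\<^sup>2)" for w
    using that norm_triangle_ineq2 [of 1 "1 - w"] r2 by (simp add: dist_norm)
  obtain w where w': "w \<in> cball 1 (r\<^sup>2)" "h w = w"
  proof (rule brouwer_ball)
    show "0 < r\<^sup>2" using r2 by simp
    have ne: "w \<noteq> 0" if "w \<in> cball 1 (r\<^sup>2)" for w :: complex using w [OF that] by auto
    then show "continuous_on (cball 1 (r\<^sup>2)) h"
      unfolding h_def using A by (intro continuous_intros) auto
    show "h \<in> cball 1 (r\<^sup>2) \<rightarrow> cball 1 (r\<^sup>2)"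
    proof
      fix w :: complex assume wc: "w \<in> cball 1 (r\<^sup>2)"
      have "(9/10)\<^sup>2 \<le> (cmod w)\<^sup>2" using w [OF wc] by (intro power_mono) auto
      then have "1/2 \<le> (cmod w)\<^sup>2" by (simp add: power2_eq_square)
      then have "A * (1/2) \<le> A * (cmod w)\<^sup>2" using A by (intro mult_left_mono) auto
      then have "cmod v / (A * (cmod w)\<^sup>2) \<le> 4 / (A * (1/2))"
        using assms A by (intro frac_le) auto
      also have "\<dots> = r\<^sup>2" by (simp add: A_eq)
      finally show "h w \<in> cball 1 (r\<^sup>2)"
        using A by (simp add: h_def dist_norm norm_divide norm_mult norm_power)
    qed
  qed
  have "w \<noteq> 0" using w [OF w'(1)] by auto
  then have "of_real A * w\<^sup>2 * (h w - 1) = v"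
    using A by (simp add: h_def)
  with w' show thesis using that by simp
qed

text \<open>A parameter for which the critical orbit visits \<open>V1\<close> exactly \<open>p - 1\<close> times in a row and
  then returns to \<open>0\<close>: pull \<open>0\<close> back \<open>p - 1\<close> times by the inverse branch \<open>h\<close> near \<open>1\<close>; the result
  is a self-map of a disc in the parameter plane, and any fixed point will do.\<close>

lemma parameter_exists:
  "\<exists>c :: complex. ((\<lambda>z. of_real A * z\<^sup>2 * (z - 1) + c) ^^ p) 0 = 0 \<and>
    (\<forall>i. 0 < i \<and> i < p \<longrightarrow> ((\<lambda>z. of_real A * z\<^sup>2 * (z - 1) + c) ^^ i) 0 \<in> cball 1 (r\<^sup>2))"
proof (cases "p = 1")
  case True
  then show ?thesis by (intro exI [of _ 0]) auto
next
  case False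
  define B where "B = cball (1::complex) (r\<^sup>2)"
  have BV: "w \<in> V1" if "w \<in> B" for w using that r2 unfolding B_def V1_def mem_cball by linarith
  define h where "h v = (SOME w. w \<in> B \<and> of_real A * w\<^sup>2 * (w - 1) = v)" for v
  have h: "h v \<in> B" "of_real A * (h v)\<^sup>2 * (h v - 1) = v" if "cmod v \<le> 4" for v
  proof -
    have "\<exists>w. w \<in> B \<and> of_real A * w\<^sup>2 * (w - 1) = v"
      using preimage_V1 [OF that] unfolding B_def by blast
    from someI_ex [OF this] show "h v \<in> B" "of_real A * (h v)\<^sup>2 * (h v - 1) = v"
      unfolding h_def by auto
  qed
  have conth: "continuous_on (cball 0 4) h"
  proof (rule lipschitz_on_continuous_on [of "2 / A"], rule lipschitz_onI)
    fix v w :: complex assume "v \<in> cball 0 4" "w \<in> cball 0 4"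
    then have vw: "cmod v \<le> 4" "cmod w \<le> 4" by auto
    have "v - w = of_real A * (h v)\<^sup>2 * (h v - 1) - of_real A * (h w)\<^sup>2 * (h w - 1)"
      using h vw by simp
    also have "\<dots> = of_real A * (h v - h w) * Q (h v) (h w)"
      by (simp add: Q_def algebra_simps power2_eq_square)
    finally have "cmod (v - w) = A * cmod (h v - h w) * cmod (Q (h v) (h w))"
      using A by (simp add: norm_mult)
    moreover have "A * cmod (h v - h w) * (1/2) \<le> A * cmod (h v - h w) * cmod (Q (h v) (h w))"
      using norm_Q_ge [OF BV BV, OF h(1) h(1)] vw A by (intro mult_left_mono) auto
    ultimately show "dist (h v) (h w) \<le> 2 / A * dist v w"
      using A by (simp add: dist_norm field_simps)
  qed (use A in auto)
  \<comment> \<open>\<open>Y n c\<close> is the \<open>n\<close>-th preimage of \<open>0\<close>,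
    along the branch near \<open>1\<close>, for the map with parameter \<open>c\<close>.\<close>
  define Y where "Y n c = ((\<lambda>y. h (y - c)) ^^ n) 0" for n c
  have Y0: "Y 0 c = 0" and YS: "Y (Suc n) c = h (Y n c - c)" for n c by (simp_all add: Y_def)
  have nB: "cmod c \<le> 1 + r\<^sup>2" if "c \<in> B" for c
    using that norm_triangle_ineq2 [of c 1] by (simp add: B_def dist_norm norm_minus_commute)
  have bd: "cmod (Y n c - c) \<le> 4 \<and> Y (Suc n) c \<in> B" if "c \<in> B" for n c
  proof (induction n)
    case 0
    then show ?case using nB [OF that] r2 h(1) by (simp add: Y0 YS)
  next
    case (Suc n)
    have "cmod (Y (Suc n) c - c) \<le> 4"
      using nB [OF that] nB [of "Y (Suc n) c"] Suc r2 norm_triangle_ineq4 [of "Y (Suc n) c" c] by linarith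
    then show ?case using h(1) YS [of "Suc n"] by simp
  qed
  have contY: "continuous_on B (Y n)" for n
  proof (induction n)
    case (Suc n)
    have "continuous_on B (\<lambda>c. h (Y n c - c))"
      by (rule continuous_on_compose2 [OF conth]) (use Suc bd in \<open>auto intro!: continuous_intros\<close>)
    then show ?case unfolding YS .
  qed (simp add: Y0)
  \<comment> \<open>Now \<open>Suc n = p - 1\<close>, and a fixed point of \<open>Y (Suc n)\<close>
    is a parameter whose critical value \<open>c\<close> is the \<open>(p - 1)\<close>-st preimage
    of \<open>0\<close>.\<close>
  define n where "n = p - 2"
  have n: "p = Suc (Suc n)" using False p by (simp add: n_def)
  obtain c where c': "c \<in> cball 1 (r\<^sup>2)" "Y (Suc n) c = c"
  proof (rule brouwer_ball [of "r\<^sup>2" 1 "Y (Suc n)"])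
    show "continuous_on (cball 1 (r\<^sup>2)) (Y (Suc n))" using contY by (simp add: B_def)
    show "Y (Suc n) \<in> cball 1 (r\<^sup>2) \<rightarrow> cball 1 (r\<^sup>2)" using bd by (auto simp: B_def)
  qed (use r2 in auto)
  then have c: "c \<in> B" "Y (Suc n) c = c" by (auto simp: B_def)
  define g where "g z = of_real A * z\<^sup>2 * (z - 1) + c" for z
  have gh: "g (h v) = v + c" if "cmod v \<le> 4" for v
    using h(2) [OF that] by (simp add: g_def)
  have orbit: "(g ^^ i) 0 = Y (p - i) c" if "0 < i" "i \<le> p" for i
    using that
  proof (induction i)
    case (Suc i)
    show ?case
    proof (cases "i = 0")
      case True
      then show ?thesis using c n by (simp add: g_def)
    next
      case False
      have "p - i = Suc (p - Suc i)" using Suc.prems by simp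
      then have "(g ^^ i) 0 = h (Y (p - Suc i) c - c)" using Suc False YS by simp
      then show ?thesis using gh bd [OF c(1), of "p - Suc i"] by simp
    qed
  qed simp
  have 1: "(g ^^ i) 0 \<in> B" if "0 < i" "i < p" for i
  proof -
    have "p - i = Suc (p - Suc i)" using that by simp
    then show ?thesis using orbit [of i] bd [OF c(1), of "p - Suc i"] that by simp
  qed
  have 2: "(g ^^ p) 0 = 0" using orbit [of p] p by (simp add: Y0)
  have g: "g = (\<lambda>z. of_real A * z\<^sup>2 * (z - 1) + c)" by (simp add: g_def fun_eq_iff)
  show ?thesis
  proof (intro exI [of _ c] conjI allI impI)
    show "((\<lambda>z. of_real A * z\<^sup>2 * (z - 1) + c) ^^ p) 0 = 0"
      using 2 unfolding g .
    show "((\<lambda>z. of_real A * z\<^sup>2 * (z - 1) + c) ^^ i) 0 \<in> cball 1 (r\<^sup>2)" if "0 < i \<and> i < p" for i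
      using 1 that unfolding g B_def by blast
  qed
qed

end

locale cubic = cubic_scale +
  fixes c :: complex and f :: "complex poly"
  assumes f_eq: "f = [:c, 0, - of_real A, of_real A:]"
    and periodic: "(poly f ^^ p) 0 = 0"
    and critical_orbit: "0 < i \<Longrightarrow> i < p \<Longrightarrow> (poly f ^^ i) 0 \<in> cball 1 (r\<^sup>2)"
begin

lemma poly_f: "poly f z = of_real A * z\<^sup>2 * (z - 1) + c"
  by (simp add: f_eq algebra_simps power2_eq_square)

lemma f_0: "poly f 0 = c" by (simp add: poly_f)

lemma norm_c: "cmod c \<le> 1 + r\<^sup>2"
proof (cases "p = 1")
  case True
  then show ?thesis using periodic r2 by (simp add: f_0)
next
  case False
  then have "dist 1 c \<le> r\<^sup>2" using critical_orbit [of 1] p by (simp add: f_0)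
  then show ?thesis
    using norm_triangle_ineq2 [of c 1] by (simp add: dist_norm norm_minus_commute)
qed

sublocale escaping_poly f 2
proof
  fix z assume z: "2 < cmod z"
  have z1: "cmod (z - 1) \<ge> 1" using norm_triangle_ineq2 [of z 1] z by simp
  then have "A * (cmod z)\<^sup>2 * cmod (z - 1) \<ge> A * (cmod z)\<^sup>2 * 1"
    using A z1 by (intro mult_left_mono) auto
  moreover have "A * (cmod z)\<^sup>2 \<ge> 3 * cmod z"
  proof -
    have "1 * cmod z \<le> cmod z * cmod z" using z by (intro mult_right_mono) auto
    then show ?thesis using A z by (intro mult_mono) (auto simp: power2_eq_square)
  qed
  moreover have "cmod (poly f z) \<ge> A * (cmod z)\<^sup>2 * cmod (z - 1) - cmod c"
    using norm_triangle_ineq2 [of "of_real A * z\<^sup>2 * (z - 1)" "- c"] A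
    by (simp add: poly_f norm_mult norm_power)
  ultimately show "2 * cmod z \<le> cmod (poly f z)"
    using norm_c r2 z by linarith
qed simp

lemma V_cover:
  assumes "cmod (poly f z) \<le> 2" shows "z \<in> V0 \<union> V1"
proof -
  have "cmod (of_real A * z\<^sup>2 * (z - 1)) \<le> cmod (poly f z) + cmod c"
    using norm_triangle_ineq4 [of "poly f z" c] by (simp add: poly_f)
  then have "A * (cmod z)\<^sup>2 * cmod (z - 1) \<le> 4"
    using assms norm_c r2 A by (simp add: norm_mult norm_power)
  then show ?thesis by (rule small_preimage)
qed

lemma K_subset_V: "K \<subseteq> V0 \<union> V1"
  using V_cover K_bound [of _ 1] by auto

lemma f_diff: "poly f w - poly f a = of_real A * (w - a) * Q w a"
  by (simp add: poly_f Q_def algebra_simps power2_eq_square)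

lemma V1_expand:
  assumes "w \<in> V1" "w' \<in> V1" shows "cmod (poly f w - poly f w') \<ge> A / 2 * cmod (w - w')"
proof -
  have "A * cmod (w - w') * (1/2) \<le> A * cmod (w - w') * cmod (Q w w')"
    using norm_Q_ge [OF assms] A by (intro mult_left_mono) auto
  then show ?thesis using A by (simp add: f_diff norm_mult)
qed

section \<open>The logarithmic coordinate along the critical orbit\<close>

abbreviation crit :: "nat \<Rightarrow> complex" where "crit i \<equiv> itr i 0"

lemma crit_V1: "0 < i \<Longrightarrow> i < p \<Longrightarrow> crit i \<in> V1"
  using critical_orbit [of i] r2 unfolding V1_def mem_cball by linarith

definition follow :: "nat \<Rightarrow> complex set" where
  "follow j = {z \<in> V0. \<forall>i. 0 < i \<and> i \<le> j \<longrightarrow> itr i z \<in> V1}"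

text \<open>A logarithm of the correction to squaring: the first step contributes
  \<open>1 - z\<close>, and by \<open>f_diff\<close> each later one multiplies the difference from
  the critical orbit by \<open>A\<close> times a value of \<open>Q\<close>. All these factors are
  near \<open>1\<close>, so the principal branch serves.\<close>

definition eps :: "nat \<Rightarrow> complex \<Rightarrow> complex" where
  "eps j z = Ln (1 - z) + (\<Sum>i=1..j. Ln (Q (itr i z) (crit i)))"

lemma eps_Suc: "eps (Suc j) z = eps j z + Ln (Q (itr (Suc j) z) (crit (Suc j)))"
  by (simp add: eps_def)

lemma follow_Suc: "z \<in> follow (Suc j) \<longleftrightarrow> z \<in> follow j \<and> itr (Suc j) z \<in> V1"
  by (auto simp: follow_def le_Suc_eq)

lemma follow_formula:
  assumes "j < p" "z \<in> follow j"
  shows "itr (Suc j) z - crit (Suc j) = - (of_real A ^ Suc j) * z\<^sup>2 * exp (eps j z)"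
  using assms
proof (induction j)
  case 0
  then have "cmod z \<le> r" by (auto simp: follow_def V0_def)
  then have "1 - z \<noteq> 0" using r by auto
  then show ?case by (simp add: eps_def poly_f algebra_simps)
next
  case (Suc j)
  define w a where "w = itr (Suc j) z" and "a = crit (Suc j)"
  have V: "w \<in> V1" "a \<in> V1"
    using Suc.prems crit_V1 [of "Suc j"] by (auto simp: w_def a_def follow_def)
  then have "Q w a \<noteq> 0"
    using Q_near_1 [of w a] r2 by auto
  moreover have "w - a = - (of_real A ^ Suc j) * z\<^sup>2 * exp (eps j z)"
    unfolding w_def a_def using Suc by (simp add: follow_Suc)
  moreover have "itr (Suc (Suc j)) z - crit (Suc (Suc j)) = of_real A * (w - a) * Q w a"
    by (simp add: w_def a_def f_diff)
  ultimately show ?case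
    unfolding eps_Suc exp_add w_def [symmetric] a_def [symmetric] by (simp only: exp_Ln) simp
qed

text \<open>Shared by \<open>eps_le\<close> and \<open>eps_lipschitz\<close>: the first step costs
  \<open>2 * r\<close>, each visit to \<open>V1\<close> at most \<open>54 * r^2\<close>, and
  \<open>real j * r \<le> 1/100\<close>.\<close>

lemma eps_coeff:
  assumes "j \<le> p" shows "2 * r + 54 * real j * r\<^sup>2 \<le> 3 * r"
proof -
  have "real j * r \<le> real p * r" using assms r by (intro mult_right_mono) auto
  then have "real j * r * r \<le> 1/100 * r" using r by (intro mult_right_mono) auto
  then show ?thesis using r by (simp add: power2_eq_square)
qed

lemma eps_le:
  assumes "j < p" "z \<in> follow j" shows "cmod (eps j z) \<le> 1/10"
proof -
  have "cmod (eps j z) \<le> 2 * r + 54 * real j * r\<^sup>2"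
    using assms
  proof (induction j)
    case 0
    then have "cmod z \<le> r" by (auto simp: follow_def V0_def)
    then show ?case
      using Ln_lipschitz [of "1 - z" 1] r by (simp add: eps_def)
  next
    case (Suc j)
    define w a where "w = itr (Suc j) z" and "a = crit (Suc j)"
    have V: "w \<in> V1" "a \<in> V1"
      using Suc.prems crit_V1 [of "Suc j"] by (auto simp: w_def a_def follow_def)
    have "cmod (Ln (Q w a)) \<le> 2 * cmod (Q w a - 1)"
      using Ln_lipschitz [of "Q w a" 1] Q_near_1 [OF V] r2 by simp
    \<comment> \<open>The estimate gives \<open>18 * r^2\<close>; the constant \<open>54\<close> is
      the one that arises in \<open>eps_lipschitz\<close>.\<close>
    then have "cmod (Ln (Q w a)) \<le> 54 * r\<^sup>2"
      using Q_near_1 [OF V] r2 by linarith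
    moreover have "cmod (eps j z) \<le> 2 * r + 54 * real j * r\<^sup>2"
      using Suc by (simp add: follow_Suc)
    ultimately show ?case
      using norm_triangle_ineq [of "eps j z" "Ln (Q w a)"]
      by (simp add: eps_Suc w_def a_def algebra_simps)
  qed
  also have "\<dots> \<le> 3 * r" using assms by (intro eps_coeff) auto
  finally show ?thesis using r by simp
qed

text \<open>The number \<open>ladd j + 2 \<zeta> + eps j z\<close> is a logarithm of \<open>f\<^sup>j\<^sup>+\<^sup>1 z - f\<^sup>j\<^sup>+\<^sup>1 0\<close> if \<open>\<zeta>\<close> is one of \<open>z\<close>.\<close>

definition ladd :: "nat \<Rightarrow> complex" where
  "ladd j = of_nat (Suc j) * of_real (ln A) + \<i> * of_real pi"

lemma exp_ladd: "exp (ladd j) = - (of_real A ^ Suc j)"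
proof -
  have "exp (of_real (ln A) :: complex) = of_real A"
    by (simp only: exp_of_real exp_ln [OF A(1)])
  then show ?thesis
    unfolding ladd_def exp_add exp_of_nat_mult by simp
qed

lemma follow_log:
  assumes "j < p" "exp \<zeta> \<in> follow j"
  shows "exp (ladd j + 2 * \<zeta> + eps j (exp \<zeta>)) = itr (Suc j) (exp \<zeta>) - crit (Suc j)"
proof -
  have "exp (2 * \<zeta>) = (exp \<zeta>)\<^sup>2" by (simp add: exp_double)
  then show ?thesis
    unfolding follow_formula [OF assms] exp_add exp_ladd by simp
qed

text \<open>The differences from the critical orbit are \<open>exp \<omega>\<close> and
  \<open>exp \<omega>'\<close>, where by induction \<open>\<omega> - \<omega>'\<close> is at most
  \<open>3\<close> times \<open>\<zeta> - \<xi>\<close>. They have modulus at most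
  \<open>3 r^2\<close>, so \<open>w\<close> and \<open>w'\<close> differ by at most
  \<open>9 r^2\<close> times \<open>cmod (\<zeta> - \<xi>)\<close>; the Lipschitz constants
  \<open>3\<close> of \<open>Q\<close> and \<open>2\<close> of \<open>Ln\<close> make this
  \<open>54 r^2\<close>.\<close>

lemma eps_lipschitz:
  assumes "j < p" "exp \<zeta> \<in> follow j" "exp \<xi> \<in> follow j"
  shows "cmod (eps j (exp \<zeta>) - eps j (exp \<xi>)) \<le> 1/10 * cmod (\<zeta> - \<xi>)"
proof -
  have "cmod (eps j (exp \<zeta>) - eps j (exp \<xi>)) \<le> (2 * r + 54 * real j * r\<^sup>2) * cmod (\<zeta> - \<xi>)"
    using assms
  proof (induction j)
    case 0
    then have *: "cmod (exp \<zeta>) \<le> r" "cmod (exp \<xi>) \<le> r" by (auto simp: follow_def V0_def)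
    then have "cmod (exp \<zeta> - exp \<xi>) \<le> r * cmod (\<zeta> - \<xi>)"
      by (rule exp_lipschitz)
    moreover have "cmod (Ln (1 - exp \<zeta>) - Ln (1 - exp \<xi>)) \<le> 2 * cmod ((1 - exp \<zeta>) - (1 - exp \<xi>))"
      using * r by (intro Ln_lipschitz) auto
    ultimately show ?case
      by (simp add: eps_def norm_minus_commute)
  next
    case (Suc j)
    define w w' a where "w = itr (Suc j) (exp \<zeta>)" and "w' = itr (Suc j) (exp \<xi>)" and "a = crit (Suc j)"
    have V: "w \<in> V1" "w' \<in> V1" "a \<in> V1"
      using Suc.prems crit_V1 [of "Suc j"] by (auto simp: w_def w'_def a_def follow_def)
    have a1: "cmod (a - 1) \<le> r\<^sup>2"
      using critical_orbit [of "Suc j"] Suc.prems by (simp add: a_def dist_norm norm_minus_commute)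
    define \<omega> \<omega>' where "\<omega> = ladd j + 2 * \<zeta> + eps j (exp \<zeta>)" and "\<omega>' = ladd j + 2 * \<xi> + eps j (exp \<xi>)"
    have e: "exp \<omega> = w - a" "exp \<omega>' = w' - a"
      using follow_log [of j \<zeta>] follow_log [of j \<xi>] Suc.prems
      by (auto simp: \<omega>_def \<omega>'_def w_def w'_def a_def follow_Suc)
    have IH: "cmod (eps j (exp \<zeta>) - eps j (exp \<xi>)) \<le> (2 * r + 54 * real j * r\<^sup>2) * cmod (\<zeta> - \<xi>)"
      using Suc by (simp add: follow_Suc)
    also have "\<dots> \<le> 1 * cmod (\<zeta> - \<xi>)"
      using eps_coeff [of j] Suc.prems r by (intro mult_right_mono) auto
    finally have "cmod (2 * (\<zeta> - \<xi>) + (eps j (exp \<zeta>) - eps j (exp \<xi>))) \<le> 3 * cmod (\<zeta> - \<xi>)"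
      using norm_triangle_ineq [of "2 * (\<zeta> - \<xi>)" "eps j (exp \<zeta>) - eps j (exp \<xi>)"]
      by (simp add: norm_mult del: distrib_left_numeral right_diff_distrib_numeral)
    moreover have "\<omega> - \<omega>' = 2 * (\<zeta> - \<xi>) + (eps j (exp \<zeta>) - eps j (exp \<xi>))"
      by (simp add: \<omega>_def \<omega>'_def algebra_simps)
    ultimately have d: "cmod (\<omega> - \<omega>') \<le> 3 * cmod (\<zeta> - \<xi>)" by simp
    have "cmod (w - a) \<le> 3 * r\<^sup>2" "cmod (w' - a) \<le> 3 * r\<^sup>2"
      using V1_norm [OF V(1)] V1_norm [OF V(2)] a1
        norm_triangle_ineq4 [of "w - 1" "a - 1"] norm_triangle_ineq4 [of "w' - 1" "a - 1"] by auto
    then have "cmod (exp \<omega> - exp \<omega>') \<le> 3 * r\<^sup>2 * cmod (\<omega> - \<omega>')"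
      by (intro exp_lipschitz) (auto simp: e)
    also have "\<dots> \<le> 3 * r\<^sup>2 * (3 * cmod (\<zeta> - \<xi>))"
      using d by (intro mult_left_mono) auto
    finally have ww: "cmod (w - w') \<le> 9 * r\<^sup>2 * cmod (\<zeta> - \<xi>)"
      by (simp add: e)
    have "cmod (Ln (Q w a) - Ln (Q w' a)) \<le> 2 * cmod (Q w a - Q w' a)"
      using Q_near_1 [OF V(1,3)] Q_near_1 [OF V(2,3)] r2 by (intro Ln_lipschitz) auto
    also have "\<dots> \<le> 2 * (3 * (9 * r\<^sup>2 * cmod (\<zeta> - \<xi>)))"
      using Q_lipschitz [OF V] ww by linarith
    finally have "cmod (Ln (Q w a) - Ln (Q w' a)) \<le> 54 * r\<^sup>2 * cmod (\<zeta> - \<xi>)" by simp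
    moreover have "eps (Suc j) (exp \<zeta>) - eps (Suc j) (exp \<xi>)
        = (eps j (exp \<zeta>) - eps j (exp \<xi>)) + (Ln (Q w a) - Ln (Q w' a))"
      by (simp add: eps_Suc w_def w'_def a_def)
    moreover have "(2 * r + 54 * real (Suc j) * r\<^sup>2) * cmod (\<zeta> - \<xi>)
        = (2 * r + 54 * real j * r\<^sup>2) * cmod (\<zeta> - \<xi>) + 54 * r\<^sup>2 * cmod (\<zeta> - \<xi>)"
      by (simp add: algebra_simps)
    ultimately show ?case
      using IH norm_triangle_ineq [of "eps j (exp \<zeta>) - eps j (exp \<xi>)" "Ln (Q w a) - Ln (Q w' a)"]
      by simp
  qed
  also have "\<dots> \<le> 1/10 * cmod (\<zeta> - \<xi>)"
    using eps_coeff [of j] assms r by (intro mult_right_mono) auto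
  finally show ?thesis .
qed

text \<open>At modulus \<open>1 / A^p\<close> the term \<open>A^p z^2\<close> has the size of
  \<open>z\<close>, and \<open>3 \<ge> exp 1\<close> covers the strip
  \<open>\<bar>Re \<zeta>\<bar> \<le> 1\<close> about it. Before the return the deviation from the
  critical orbit is at most \<open>27 / A^2 \<le> r^2\<close>, and that orbit is within
  \<open>r^2\<close> of \<open>1\<close>.\<close>

lemma small_follow:
  assumes "cmod z \<le> 3 / A ^ p" "j < p" shows "z \<in> follow j"
  using assms(2)
proof (induction j)
  case 0
  have "A ^ 1 \<le> A ^ p" using p A by (intro power_increasing) auto
  then have "3 / A ^ p \<le> 3 / A" using A by (intro divide_left_mono) auto
  also have "3 / A = 3 * r\<^sup>2 / 8" by (simp add: A_eq)
  also have "\<dots> \<le> r" using r2 by linarith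
  finally show ?case using assms by (auto simp: follow_def V0_def)
next
  case (Suc j)
  then have j: "j < p" "z \<in> follow j" by auto
  define w a where "w = itr (Suc j) z" and "a = crit (Suc j)"
  have e3: "cmod (exp (eps j z)) \<le> 3"
  proof -
    have "Re (eps j z) \<le> 1"
      using eps_le [OF j] complex_Re_le_cmod [of "eps j z"] by linarith
    then have "exp (Re (eps j z)) \<le> exp 1" by simp
    then show ?thesis unfolding norm_exp_eq_Re using exp_le by linarith
  qed
  have "cmod (w - a) = A ^ Suc j * (cmod z)\<^sup>2 * cmod (exp (eps j z))"
    unfolding w_def a_def follow_formula [OF j] using A by (simp add: norm_mult norm_power)
  also have "\<dots> \<le> A ^ Suc j * (cmod z)\<^sup>2 * 3"
    using e3 A by (intro mult_left_mono) auto
  also have "A ^ Suc j * (cmod z)\<^sup>2 * 3 \<le> A ^ Suc j * (3 / A ^ p)\<^sup>2 * 3"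
    using assms(1) A by (intro mult_right_mono mult_left_mono power_mono) auto
  also have "\<dots> = 27 * A ^ Suc j / (A ^ p * A ^ p)"
    by (simp add: power2_eq_square)
  also have "\<dots> \<le> 27 * A ^ p / (A ^ p * A ^ p) / A"
  proof -
    have "A * A ^ Suc j \<le> A ^ p"
      using Suc.prems A power_increasing [of "Suc (Suc j)" p A] by simp
    then show ?thesis using A by (simp add: field_simps)
  qed
  also have "\<dots> = 27 / A ^ p / A" using A by (simp add: field_simps)
  also have "\<dots> \<le> 27 / A / A"
    using A p power_increasing [of 1 p A] by (intro divide_right_mono divide_left_mono) auto
  also have "\<dots> \<le> r\<^sup>2"
  proof -
    have "27 / A / A = 27 * r\<^sup>2 / 64 * r\<^sup>2" using r by (simp add: A_eq power2_eq_square)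
    also have "\<dots> \<le> 1 * r\<^sup>2" using r2 by (intro mult_right_mono) auto
    finally show ?thesis by simp
  qed
  finally have "cmod (w - a) \<le> r\<^sup>2" .
  moreover have "cmod (a - 1) \<le> r\<^sup>2"
    using critical_orbit [of "Suc j"] Suc.prems by (simp add: a_def dist_norm norm_minus_commute)
  ultimately have "cmod (w - 1) \<le> 2 * r\<^sup>2"
    using norm_triangle_ineq [of "w - a" "a - 1"] by simp
  then have "w \<in> V1" by (simp add: V1_def dist_norm norm_minus_commute)
  then show ?case using j by (simp add: follow_Suc w_def)
qed

subsection \<open>The component of the critical point\<close>

text \<open>The fixed point of \<open>\<omega> \<mapsto> ladd (p - 1) + 2 * \<omega>\<close>:
  shifting logarithms by \<open>bb\<close> removes the additive constant from the return
  map.\<close>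

definition bb :: complex where
  "bb = - (of_nat p * of_real (ln A)) - \<i> * of_real pi"

lemma ladd_bb: "ladd (p - 1) = - bb"
  using p by (simp add: ladd_def bb_def)

lemma norm_exp_bb: "cmod (exp (bb + \<zeta>)) = exp (Re \<zeta>) / A ^ p"
proof -
  have "exp (real p * ln A) = A ^ p"
    by (simp only: exp_of_nat_mult exp_ln [OF A(1)])
  moreover have "Re (bb + \<zeta>) = Re \<zeta> - real p * ln A"
    by (simp add: bb_def)
  ultimately show ?thesis
    by (simp only: norm_exp_eq_Re exp_diff)
qed

lemma strip_follow:
  assumes "\<bar>Re \<zeta>\<bar> \<le> 1" shows "exp (bb + \<zeta>) \<in> follow (p - 1)"
proof (rule small_follow)
  have "exp (Re \<zeta>) \<le> exp 1" using assms by simp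
  then have "exp (Re \<zeta>) \<le> 3" using exp_le by linarith
  then show "cmod (exp (bb + \<zeta>)) \<le> 3 / A ^ p"
    unfolding norm_exp_bb using A by (intro divide_right_mono) auto
qed (use p in auto)

definition err :: "complex \<Rightarrow> complex" where
  "err \<zeta> = eps (p - 1) (exp (bb + \<zeta>))"

sublocale D: perturbed_doubling err
proof
  fix \<zeta> \<xi> :: complex assume \<zeta>: "\<bar>Re \<zeta>\<bar> \<le> 1"
  show "cmod (err \<zeta>) \<le> 1/10"
    unfolding err_def using eps_le [OF _ strip_follow [OF \<zeta>]] p by simp
  show "err (\<zeta> + of_real (2 * pi) * \<i>) = err \<zeta>"
    by (simp add: err_def exp_add)
  assume \<xi>: "\<bar>Re \<xi>\<bar> \<le> 1"
  show "cmod (err \<zeta> - err \<xi>) \<le> 1/10 * cmod (\<zeta> - \<xi>)"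
    unfolding err_def using eps_lipschitz [OF _ strip_follow [OF \<zeta>] strip_follow [OF \<xi>]] p by simp
qed

lemma return_log:
  assumes "exp (bb + \<zeta>) \<in> follow (p - 1)"
  shows "itr p (exp (bb + \<zeta>)) = exp (bb + (2 * \<zeta> + err \<zeta>))"
proof -
  have "itr p (exp (bb + \<zeta>)) = exp (ladd (p - 1) + 2 * (bb + \<zeta>) + err \<zeta>)"
    using follow_log [of "p - 1" "bb + \<zeta>"] assms p periodic by (simp add: err_def)
  also have "ladd (p - 1) + 2 * (bb + \<zeta>) + err \<zeta> = bb + (2 * \<zeta> + err \<zeta>)"
    unfolding ladd_bb by (simp add: algebra_simps)
  finally show ?thesis .
qed

lemma itr_add: "itr (m + n) z = itr m (itr n z)"
  by (simp add: funpow_add)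

lemma follow_bounded:
  assumes "y \<in> follow (p - 1)" "i < p" shows "cmod (itr i y) \<le> 2"
proof (cases "i = 0")
  case True
  then show ?thesis using assms r by (auto simp: follow_def V0_def)
next
  case False
  then have "itr i y \<in> V1" using assms by (auto simp: follow_def)
  then have "cmod (itr i y - 1) \<le> 2 * r\<^sup>2" by (rule V1_norm)
  then show ?thesis
    using r2 norm_triangle_ineq [of "itr i y - 1" 1] by simp
qed

lemma trapped_in_K:
  assumes "\<And>n. itr (p * n) z \<in> follow (p - 1)" shows "z \<in> K"
proof -
  have "cmod (itr n z) \<le> 2" for n
  proof -
    have "itr n z = itr (n mod p) (itr (p * (n div p)) z)"
      by (simp flip: itr_add)
    then show ?thesis using follow_bounded [OF assms] p by simp
  qed
  then show ?thesis by (simp add: K_def)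
qed

lemma invariant_subset_K:
  assumes "X \<subseteq> follow (p - 1)" "\<And>z. z \<in> X \<Longrightarrow> itr p z \<in> X" shows "X \<subseteq> K"
proof
  fix z assume "z \<in> X"
  then have "itr (p * n) z \<in> X" for n
    by (induction n) (use assms(2) in \<open>auto simp: itr_add\<close>)
  then show "z \<in> K" using assms(1) by (intro trapped_in_K) blast
qed

definition J :: "complex set" where "J = path_image (D.curve bb)"

lemma J_eq: "J = range (\<lambda>t. exp (bb + D.\<Gamma> t))"
  by (simp add: J_def D.path_image_curve)

lemma J_subset_K: "J \<subseteq> K"
proof (rule invariant_subset_K)
  have re: "\<bar>Re (D.\<Gamma> t)\<bar> \<le> 1" for t using D.Re_Gamma [of t] by linarith
  then show "J \<subseteq> follow (p - 1)" using strip_follow by (auto simp: J_eq)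
  fix z assume "z \<in> J"
  then obtain t where t: "z = exp (bb + D.\<Gamma> t)" by (auto simp: J_eq)
  then have "itr p z = exp (bb + D.\<Gamma> (2 * t))"
    using return_log [OF strip_follow [OF re]] by (simp add: D.Gamma_double)
  then show "itr p z \<in> J" by (auto simp: J_eq)
qed

text \<open>In the logarithmic coordinate this is \<open>Re \<zeta> < - 1/2\<close>, together with
  \<open>0\<close>. There \<open>itr p\<close> shrinks the modulus by at least
  \<open>exp (- 1/2 + 1/10)\<close>, since \<open>err\<close> is at most
  \<open>1/10\<close>.\<close>

definition core :: "complex set" where "core = ball 0 (exp (- 1/2) / A ^ p)"

lemma core_subset_K: "core \<subseteq> K"
proof (rule invariant_subset_K)
  have "exp (- 1/2) \<le> (3 :: real)" by (rule order_trans [of _ 1]) auto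
  then have "exp (- 1/2) / A ^ p \<le> 3 / A ^ p"
    using A by (intro divide_right_mono) auto
  then show sub: "core \<subseteq> follow (p - 1)"
    using p by (auto simp: core_def intro!: small_follow)
  fix z assume z: "z \<in> core"
  have "itr p z = - (of_real A ^ p) * z\<^sup>2 * exp (eps (p - 1) z)"
    using follow_formula [of "p - 1" z] z sub p periodic by auto
  then have "cmod (itr p z) = cmod z * (A ^ p * cmod z) * exp (Re (eps (p - 1) z))"
    using A by (simp add: norm_mult norm_power power2_eq_square norm_exp_eq_Re)
  also have "\<dots> \<le> cmod z * exp (- 1/2) * exp (1/10)"
  proof (intro mult_mono)
    show "A ^ p * cmod z \<le> exp (- 1/2)"
      using z A by (simp add: core_def field_simps)
    have "cmod (eps (p - 1) z) \<le> 1/10" using eps_le [of "p - 1" z] z sub p by auto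
    then show "exp (Re (eps (p - 1) z)) \<le> exp (1/10)"
      using complex_Re_le_cmod [of "eps (p - 1) z"] by simp
  qed (use A in auto)
  also have "\<dots> = cmod z * exp (- 2/5)"
    by (simp flip: exp_add)
  also have "\<dots> \<le> cmod z * 1" by (intro mult_left_mono) auto
  finally show "itr p z \<in> core" using z by (simp add: core_def)
qed

text \<open>Avoiding \<open>core\<close> bounds the real parts of the logarithms from below, and
  staying in \<open>V0\<close> bounds them from above; so the logarithmic orbit never leaves the
  strip and \<open>D.shadowing\<close> places it on the curve.\<close>

lemma trapped_in_J:
  assumes tr: "\<And>n. itr (p * n) z \<in> follow (p - 1)" and nc: "\<And>n. itr (p * n) z \<notin> core"
  shows "z \<in> J"
proof -
  have "z \<noteq> 0" using nc [of 0] A by (auto simp: core_def)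
  \<comment> \<open>Only the first logarithm is principal. The others come from the recursion, so
    that the orbit equation holds exactly, without jumps by multiples of
    \<open>2 \<pi> \<i>\<close>.\<close>
  define \<zeta> where "\<zeta> = rec_nat (Ln z - bb) (\<lambda>_ \<zeta>. 2 * \<zeta> + err \<zeta>)"
  have \<zeta>0: "\<zeta> 0 = Ln z - bb" and \<zeta>S: "\<zeta> (Suc n) = 2 * \<zeta> n + err (\<zeta> n)" for n
    by (simp_all add: \<zeta>_def)
  have y: "exp (bb + \<zeta> n) = itr (p * n) z" for n
  proof (induction n)
    case (Suc n)
    then have "itr (p * Suc n) z = itr p (exp (bb + \<zeta> n))"
      by (simp add: itr_add)
    also have "\<dots> = exp (bb + \<zeta> (Suc n))"
      unfolding \<zeta>S by (rule return_log) (use Suc tr in simp)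
    finally show ?case ..
  qed (use \<open>z \<noteq> 0\<close> in \<open>simp add: \<zeta>0\<close>)
  have ex: "exp (Re (\<zeta> n)) = cmod (itr (p * n) z) * A ^ p" for n
    using norm_exp_bb [of "\<zeta> n"] A unfolding y by (simp add: field_simps)
  have lower: "Re (\<zeta> n) \<ge> - 1/2" for n
  proof -
    have "cmod (itr (p * n) z) \<ge> exp (- 1/2) / A ^ p"
      using nc [of n] by (simp add: core_def not_less)
    then have "exp (Re (\<zeta> n)) \<ge> exp (- 1/2)"
      unfolding ex using A by (simp add: field_simps)
    then show ?thesis by simp
  qed
  have ep: "\<bar>Re (err (\<zeta> n))\<bar> \<le> 1/10" for n
    using eps_le [of "p - 1" "itr (p * n) z"] tr [of n] p
      abs_Re_le_cmod [of "err (\<zeta> n)"] unfolding err_def y by auto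
  have upper: "Re (\<zeta> n) \<le> 1/2" for n
  proof (rule ccontr)
    assume n: "\<not> Re (\<zeta> n) \<le> 1/2"
    \<comment> \<open>Beyond \<open>1/2\<close>, doubling with an error of at most
      \<open>1/10\<close> adds at least \<open>2/5\<close> per turn.\<close>
    have grow: "Re (\<zeta> (n + j)) \<ge> 1/2 + 2/5 * real j" for j
    proof (induction j)
      case (Suc j)
      have "Re (\<zeta> (n + Suc j)) = 2 * Re (\<zeta> (n + j)) + Re (err (\<zeta> (n + j)))"
        by (simp add: \<zeta>S)
      then have "Re (\<zeta> (n + Suc j)) \<ge> 2 * Re (\<zeta> (n + j)) - 1/10" using ep [of "n + j"] by linarith
      moreover have "real (Suc j) = real j + 1" by simp
      moreover have "real j \<ge> 0" by simp
      ultimately show ?case using Suc by argo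
    qed (use n in simp)
    have bd: "Re (\<zeta> m) \<le> r * A ^ p" for m
    proof -
      have "cmod (itr (p * m) z) \<le> r" using tr [of m] by (auto simp: follow_def V0_def)
      then have "cmod (itr (p * m) z) * A ^ p \<le> r * A ^ p" using A by (intro mult_right_mono) auto
      then show ?thesis
        using exp_ge_add_one_self [of "Re (\<zeta> m)"] ex [of m] by linarith
    qed
    obtain j where "real j > 5/2 * (r * A ^ p)" using reals_Archimedean2 by blast
    then show False using grow [of j] bd [of "n + j"] by linarith
  qed
  obtain t where "\<zeta> 0 = D.\<Gamma> t"
  proof (rule D.shadowing [of \<zeta>])
    show "\<bar>Re (\<zeta> n)\<bar> \<le> 1" for n using lower [of n] upper [of n] by linarith
  qed (use \<zeta>S in blast)
  then have "z = exp (bb + D.\<Gamma> t)" using y [of 0] by simp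
  then show ?thesis by (auto simp: J_eq)
qed

section \<open>Components, itineraries and trapping\<close>

abbreviation comp :: "complex \<Rightarrow> complex set" where
  "comp z \<equiv> connected_component_set K z"

lemma comp_component: "z \<in> K \<Longrightarrow> comp z \<in> components K"
  by (rule componentsI)

lemma comp_eq: "E \<in> components K \<Longrightarrow> z \<in> E \<Longrightarrow> E = comp z"
  by (metis components_iff connected_component_eq)

lemma in_comp: "z \<in> K \<Longrightarrow> z \<in> comp z"
  by (simp add: connected_component_refl)

lemma itr_comp:
  assumes "z \<in> K" "w \<in> comp z" shows "itr n w \<in> comp (itr n z)"
proof -
  have "connected (itr n ` comp z)"
    by (intro connected_continuous_image continuous_on_itr) auto
  moreover have "itr n ` comp z \<subseteq> K"
    using connected_component_subset [of K z] by (auto simp: itr_in_K_iff)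
  ultimately have "itr n ` comp z \<subseteq> comp (itr n z)"
    using in_comp [OF assms(1)] by (intro connected_component_maximal) auto
  then show ?thesis using assms by blast
qed

text \<open>\<open>V0\<close> and \<open>V1\<close> are closed, disjoint and cover \<open>K\<close>,
  so a connected subset lies in one of them. Hence itineraries are constant on components.\<close>

lemma comp_V:
  assumes "z \<in> K" "w \<in> comp z" shows "w \<in> V0 \<longleftrightarrow> z \<in> V0" "w \<in> V1 \<longleftrightarrow> z \<in> V1"
proof -
  have "comp z \<subseteq> K" by (rule connected_component_subset)
  have "V0 \<inter> comp z = {} \<or> V1 \<inter> comp z = {}"
  proof (rule connected_closedD)
    show "connected (comp z)" by simp
    show "comp z \<subseteq> V0 \<union> V1" using \<open>comp z \<subseteq> K\<close> K_subset_V by blast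
  qed (use V_disjoint in \<open>auto simp: V0_def V1_def\<close>)
  then show "w \<in> V0 \<longleftrightarrow> z \<in> V0" "w \<in> V1 \<longleftrightarrow> z \<in> V1"
    using in_comp [OF assms(1)] assms(2) \<open>comp z \<subseteq> K\<close> K_subset_V V_disjoint by blast+
qed

lemma itr_comp_V:
  assumes "z \<in> K" "w \<in> comp z"
  shows "itr n w \<in> V0 \<longleftrightarrow> itr n z \<in> V0" "itr n w \<in> V1 \<longleftrightarrow> itr n z \<in> V1"
  using comp_V [OF _ itr_comp [OF assms]] assms(1) itr_in_K_iff by blast+

lemma follow_comp:
  assumes "z \<in> K" "w \<in> comp z" shows "w \<in> follow j \<longleftrightarrow> z \<in> follow j"
  using comp_V [OF assms] itr_comp_V [OF assms] by (simp add: follow_def)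

lemma crit_periodic: "crit (p * n + i) = crit i"
proof -
  have "crit (p * n) = 0"
    by (induction n) (auto simp: itr_add periodic)
  then show ?thesis by (metis add.commute itr_add)
qed

lemma zero_trapped: "itr (p * n) 0 \<in> follow (p - 1)"
  using crit_periodic [of n 0] crit_V1 r p by (auto simp: follow_def V0_def)

lemma zero_in_K: "0 \<in> K"
  using trapped_in_K zero_trapped by blast

text \<open>Off the invariant curve a trapped component consists of points attracted to the critical cycle,
  hence of interior points; a component without points of the curve would be open and compact.\<close>

lemma trapped_interior:
  assumes "z \<in> K" "\<And>n. itr (p * n) z \<in> follow (p - 1)" "w \<in> comp z" "w \<notin> J"
  shows "w \<in> interior (comp z)"
proof -
  have "w \<in> K" using assms(3) connected_component_subset by blast
  have "itr (p * n) w \<in> follow (p - 1)" for n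
    using follow_comp [OF _ itr_comp [OF assms(1,3)]] assms(1,2) itr_in_K_iff by blast
  then obtain n where n: "itr (p * n) w \<in> core"
    using trapped_in_J assms(4) by blast
  have "open (itr (p * n) -` core)"
    using continuous_on_itr [of UNIV "p * n"] unfolding core_def
    by (simp add: continuous_on_open_vimage)
  moreover have "itr (p * n) -` core \<subseteq> K"
    using core_subset_K itr_in_K_iff by blast
  ultimately have "w \<in> interior K" using n by (meson interiorI vimageI)
  then show ?thesis
    using frontier_Int_component(2) [OF compact_K comp_component [OF assms(1)]] assms(3) by blast
qed

lemma connected_J: "connected J"
  unfolding J_def by (intro connected_path_image simple_path_imp_path D.simple_path_curve)

lemma trapped_J_subset:
  assumes "z \<in> K" "\<And>n. itr (p * n) z \<in> follow (p - 1)"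
  shows "J \<subseteq> comp z"
proof -
  have E: "comp z \<in> components K" using assms(1) by (rule comp_component)
  have "comp z \<inter> J \<noteq> {}"
  proof
    assume "comp z \<inter> J = {}"
    then have "comp z \<subseteq> interior (comp z)"
      using trapped_interior [OF assms] by blast
    then have "open (comp z)" using interior_subset by (metis open_interior subset_antisym)
    moreover have "compact (comp z)" using component_facts(1) [OF E] .
    ultimately show False
      using component_facts(3) [OF E] clopen [of "comp z"] compact_imp_closed compact_imp_bounded
        not_bounded_UNIV by metis
  qed
  then show ?thesis
    using components_maximal [OF E connected_J J_subset_K] by blast
qed

definition K0 :: "complex set" where "K0 = comp 0"

lemma K0_component: "K0 \<in> components K"
  unfolding K0_def by (rule comp_component [OF zero_in_K])

lemma zero_in_K0: "0 \<in> K0"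
  unfolding K0_def by (rule in_comp [OF zero_in_K])

text \<open>Every trapped component contains \<open>J\<close>, so there is only one. This criterion
  recognises \<open>K0\<close> in \<open>comp_crit_value\<close> and
  \<open>wandering_component_point\<close>.\<close>

lemma trapped_eq_K0:
  assumes "z \<in> K" "\<And>n. itr (p * n) z \<in> follow (p - 1)"
  shows "comp z = K0"
proof -
  have "J \<subseteq> comp z" "J \<subseteq> K0"
    using trapped_J_subset [OF assms] trapped_J_subset [OF zero_in_K zero_trapped] by (auto simp: K0_def)
  moreover have "J \<noteq> {}" by (simp add: J_eq)
  ultimately show ?thesis
    using components_eq [OF comp_component [OF assms(1)] K0_component] by blast
qed

lemma component_inside:
  assumes E: "E \<in> components K" and S: "closed S" "connected S" "S \<noteq> {}" "S \<subseteq> E"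
  shows "inside S \<subseteq> E"
proof -
  have "bounded S" "S \<subseteq> K"
    using S component_facts [OF E] compact_imp_bounded bounded_subset by blast+
  then have "inside S \<subseteq> K" using S inside_subset_K by blast
  then have "S \<union> inside S \<subseteq> E"
    using components_maximal [OF E connected_with_inside [OF S(1,2)]] \<open>S \<subseteq> K\<close> S by blast
  then show ?thesis by blast
qed

lemma component_bubbleI:
  assumes E: "E \<in> components K" and \<gamma>: "simple_path \<gamma>" "pathfinish \<gamma> = pathstart \<gamma>"
    and sub: "path_image \<gamma> \<subseteq> E" and op: "open (E - path_image \<gamma>)"
  shows "bubble E"
proof (rule bubbleI [OF \<gamma> _ sub _ op])
  show "compact E" using component_facts [OF E] by blast
  show "inside (path_image \<gamma>) \<subseteq> E"
    using \<gamma> by (intro component_inside [OF E _ _ _ sub])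
      (auto simp: closed_simple_path_image connected_simple_path_image)
qed

lemma bubble_K0: "bubble K0"
proof (rule component_bubbleI [OF K0_component D.simple_path_curve D.pathfinish_curve])
  show "path_image (D.curve bb) \<subseteq> K0"
    using trapped_J_subset [OF zero_in_K zero_trapped] by (simp add: K0_def J_def)
  have "K0 - J = interior K0 - J"
    using trapped_interior [OF zero_in_K zero_trapped] interior_subset by (auto simp: K0_def)
  moreover have "closed J"
    unfolding J_def by (intro closed_path_image simple_path_imp_path D.simple_path_curve)
  ultimately show "open (K0 - path_image (D.curve bb))"
    by (simp add: J_def open_Diff)
qed

end

text \<open>The difference of two logarithms of the same function takes values in the discrete set
  of multiples of \<open>2 \<pi> \<i>\<close>.\<close>

lemma exp_eq_connected_const:
  assumes S: "connected S" and cont: "continuous_on S a" "continuous_on S b"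
    and eq: "\<And>x. x \<in> S \<Longrightarrow> exp (a x) = exp (b x :: complex)" and xy: "x \<in> S" "y \<in> S"
  shows "a x - a y = b x - b y"
proof -
  have "(\<lambda>x. a x - b x) constant_on S"
  proof (rule continuous_discrete_range_constant [OF S])
    show "continuous_on S (\<lambda>x. a x - b x)"
      using cont by (intro continuous_intros)
    fix x assume x: "x \<in> S"
    have "2 * pi \<le> cmod ((a y - b y) - (a x - b x))" if y: "y \<in> S" "a y - b y \<noteq> a x - b x" for y
    proof -
      have "exp (a y - b y) = exp (a x - b x)"
        using eq x y(1) by (simp add: exp_diff)
      then obtain n :: int where n: "a y - b y = a x - b x + (of_int (2 * n) * pi) * \<i>"
        by (auto simp: exp_eq)
      then have "n \<noteq> 0" using y by auto
      then have "\<bar>real_of_int n\<bar> \<ge> 1" by linarith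
      then show ?thesis using n by (simp add: norm_mult)
    qed
    then show "\<exists>e>0. \<forall>y. y \<in> S \<and> a y - b y \<noteq> a x - b x \<longrightarrow> e \<le> cmod ((a y - b y) - (a x - b x))"
      by (intro exI [of _ "2 * pi"]) auto
  qed
  then obtain k where "\<And>x. x \<in> S \<Longrightarrow> a x - b x = k"
    by (auto simp: constant_on_def)
  then have "a x - b x = a y - b y" using xy by simp
  then show ?thesis by (simp add: algebra_simps)
qed

text \<open>Compact plane sets that do not separate the plane are Borsukian. Components of
  \<open>K\<close> are of this kind by \<open>component_facts\<close>; the logarithm yields square
  roots in \<open>pullback_V0\<close> and the coordinate in
  \<open>wandering_component_point\<close>.\<close>

lemma continuous_log_on_full_compact:
  fixes E :: "complex set" and g :: "complex \<Rightarrow> complex"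
  assumes "compact E" "connected (- E)" "continuous_on E g" "\<And>x. x \<in> E \<Longrightarrow> g x \<noteq> 0"
  obtains l where "continuous_on E l" "\<And>x. x \<in> E \<Longrightarrow> g x = exp (l x)"
proof -
  have "Borsukian E" using assms(1,2) by (simp add: Borsukian_separation_compact)
  then show thesis
    using assms(3,4) that unfolding Borsukian_continuous_logarithm by (metis ComplI Pi_I singletonD)
qed

context cubic
begin

subsection \<open>Preimages of bubbles\<close>

text \<open>A continuous section \<open>g\<close> of \<open>f\<close> is injective, so it carries
  the Jordan curve to a Jordan curve, and by invariance of domain it carries the inside to an open
  set.\<close>

lemma pullback_bubble:
  assumes E: "E \<in> components K" and E': "bubble E'" and g: "continuous_on E' g" "g ` E' = E"
    and fg: "\<And>w. w \<in> E' \<Longrightarrow> poly f (g w) = w"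
  shows "bubble E"
proof -
  obtain \<gamma> where \<gamma>: "simple_path \<gamma>" "pathfinish \<gamma> = pathstart \<gamma>" "E' = path_image \<gamma> \<union> inside (path_image \<gamma>)"
    using E' by (auto simp: bubble_def)
  note jordan = Jordan_inside_outside [OF \<gamma>(1,2)]
  have inj: "inj_on g E'" using fg by (metis inj_onI)
  have "path (g \<circ> \<gamma>)"
    using \<gamma> g by (intro path_continuous_image simple_path_imp_path) (auto intro: continuous_on_subset)
  moreover have "loop_free (g \<circ> \<gamma>)"
  proof -
    have "\<gamma> x = \<gamma> y" if "x \<in> {0..1}" "y \<in> {0..1}" "g (\<gamma> x) = g (\<gamma> y)" for x y
      using inj_onD [OF inj that(3)] that(1,2) \<gamma>(3) by (auto simp: path_image_def)
    then show ?thesis using \<gamma>(1) by (simp add: simple_path_def loop_free_def)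
  qed
  ultimately have sp: "simple_path (g \<circ> \<gamma>)" by (simp add: simple_path_def)
  show ?thesis
  proof (rule component_bubbleI [OF E sp])
    show "pathfinish (g \<circ> \<gamma>) = pathstart (g \<circ> \<gamma>)"
      using \<gamma> by (simp add: pathfinish_compose pathstart_compose)
    show "path_image (g \<circ> \<gamma>) \<subseteq> E"
      using g \<gamma>(3) by (auto simp: path_image_compose)
    have "E - path_image (g \<circ> \<gamma>) = g ` (E' - path_image \<gamma>)"
      unfolding path_image_compose g(2) [symmetric]
      using inj_on_image_set_diff [OF inj, of E' "path_image \<gamma>"] \<gamma>(3) by auto
    also have "E' - path_image \<gamma> = inside (path_image \<gamma>)"
      using \<gamma>(3) jordan by blast
    finally have "E - path_image (g \<circ> \<gamma>) = g ` inside (path_image \<gamma>)" .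
    moreover have "open (g ` inside (path_image \<gamma>))"
      using g inj \<gamma>(3) jordan
      by (intro invariance_of_domain) (auto intro: continuous_on_subset inj_on_subset)
    ultimately show "open (E - path_image (g \<circ> \<gamma>))" by simp
  qed
qed

lemma image_component_eq:
  assumes E: "E \<in> components K" and E': "E' \<subseteq> K" "connected E'" and g: "continuous_on E' g"
    and fg: "\<And>w. w \<in> E' \<Longrightarrow> poly f (g w) = w" and z: "z \<in> E" "poly f z \<in> E'" "g (poly f z) = z"
  shows "g ` E' \<subseteq> E"
proof (rule components_maximal [OF E])
  show "connected (g ` E')" using g E'(2) by (rule connected_continuous_image)
  show "g ` E' \<subseteq> K"
  proof (rule image_subsetI)
    fix w assume "w \<in> E'"
    then have "poly f (g w) \<in> K" using fg E'(1) by auto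
    then show "g w \<in> K" by (simp only: f_in_K_iff)
  qed
  have "z \<in> g ` E'" using imageI [OF z(2), of g] z(3) by simp
  then show "E \<inter> g ` E' \<noteq> {}" using z(1) by blast
qed

lemma surj_V1:
  assumes "cmod v \<le> 2" shows "\<exists>w\<in>V1. poly f w = v"
proof -
  have "cmod (v - c) \<le> 4"
    using assms norm_c r2 norm_triangle_ineq4 [of v c] by linarith
  then obtain w where w: "w \<in> cball 1 (r\<^sup>2)" "of_real A * w\<^sup>2 * (w - 1) = v - c"
    using preimage_V1 by blast
  then have "w \<in> V1" using r2 unfolding V1_def mem_cball by linarith
  moreover have "poly f w = v" using w by (simp add: poly_f)
  ultimately show ?thesis by blast
qed

text \<open>A square root of \<open>z^2 (1 - z)\<close>: in this coordinate \<open>f\<close> is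
  exactly quadratic on \<open>V0\<close>.\<close>

definition \<psi> :: "complex \<Rightarrow> complex" where "\<psi> z = z * csqrt (1 - z)"

lemma poly_f_psi: "poly f z = c - of_real A * (\<psi> z)\<^sup>2"
  by (simp add: poly_f \<psi>_def power_mult_distrib algebra_simps)

lemma csqrt_near:
  assumes "z \<in> V0" shows "cmod (csqrt (1 - z) - 1) \<le> r"
proof -
  have z: "cmod z \<le> r" using assms by (rule V0_norm)
  define s where "s = csqrt (1 - z)"
  have "s\<^sup>2 = 1 - z" by (simp add: s_def)
  then have "(s - 1) * (s + 1) = - z" by (simp add: algebra_simps power2_eq_square)
  then have "cmod (s - 1) * cmod (s + 1) \<le> r" using z by (metis norm_minus_cancel norm_mult)
  moreover have "Re s \<ge> 0" unfolding s_def by (rule Re_csqrt)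
  then have "cmod (s + 1) \<ge> 1" using complex_Re_le_cmod [of "s + 1"] by simp
  then have "cmod (s - 1) * 1 \<le> cmod (s - 1) * cmod (s + 1)" by (intro mult_left_mono) auto
  ultimately show ?thesis by (simp add: s_def)
qed

lemma continuous_on_psi: "continuous_on V0 \<psi>"
proof -
  have "1 - z \<notin> \<real>\<^sub>\<le>\<^sub>0" if "z \<in> V0" for z
    using V0_norm [OF that] r abs_Re_le_cmod [of z] by (auto simp: complex_nonpos_Reals_iff)
  then have "continuous_on V0 (\<lambda>z. csqrt (1 - z))"
    by (intro continuous_at_imp_continuous_on ballI isCont_o2 [of _ "\<lambda>z. 1 - z" csqrt]
        continuous_at_csqrt continuous_intros)
  then show ?thesis
    unfolding \<psi>_def by (intro continuous_intros)
qed

text \<open>Let \<open>s\<close> and \<open>t\<close> be the roots of \<open>1 - z\<close> and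
  \<open>1 - w\<close>, both close to \<open>1\<close>. From \<open>z * s = w * t\<close> and
  \<open>z - w = t^2 - s^2\<close> follows \<open>(t - s) * ((t + s) * s - w) = 0\<close>, where the
  second factor is nonzero because \<open>cmod w \<le> r\<close>.\<close>

lemma inj_on_psi: "inj_on \<psi> V0"
proof (rule inj_onI)
  fix z w assume zw: "z \<in> V0" "w \<in> V0" "\<psi> z = \<psi> w"
  then have "poly f z = poly f w" by (simp add: poly_f_psi)
  then have "of_real A * ((z - w) * Q z w) = 0"
    using f_diff [of z w] by (simp add: mult.assoc)
  then have "z = w \<or> Q z w = 0" using A by simp
  moreover have "z = w" if q: "Q z w = 0"
  proof (rule ccontr)
    assume "z \<noteq> w"
    have "cmod w \<le> r" using zw V0_norm by auto
    define s t where "s = csqrt (1 - z)" and "t = csqrt (1 - w)"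
    have st: "cmod (s - 1) \<le> r" "cmod (t - 1) \<le> r" "s\<^sup>2 = 1 - z" "t\<^sup>2 = 1 - w" "z * s = w * t"
      using zw csqrt_near by (auto simp: s_def t_def \<psi>_def)
    have "t\<^sup>2 - s\<^sup>2 = z - w" using st by simp
    then have "z - w = (t - s) * (t + s)" by (simp add: algebra_simps power2_eq_square)
    moreover have "(z - w) * s = w * (t - s)" using st by (simp add: algebra_simps)
    moreover have "(t - s) * ((t + s) * s - w) = (t - s) * (t + s) * s - w * (t - s)"
      by (simp add: algebra_simps)
    ultimately have "(t - s) * ((t + s) * s - w) = 0" by simp
    moreover have "t \<noteq> s" using \<open>z - w = (t - s) * (t + s)\<close> \<open>z \<noteq> w\<close> by auto
    ultimately have "w = (t + s) * s" by simp
    moreover have "cmod ((t + s) * s) \<ge> 1/2"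
    proof -
      have "cmod s \<ge> 99/100" using st r norm_triangle_ineq2 [of 1 "1 - s"] by (simp add: norm_minus_commute)
      moreover have "cmod (t + s) \<ge> 198/100"
        using st r norm_triangle_ineq2 [of 2 "(1 - t) + (1 - s)"] norm_triangle_ineq [of "1 - t" "1 - s"]
        by (simp add: norm_minus_commute algebra_simps)
      ultimately have "cmod (t + s) * cmod s \<ge> 1 * (1/2)" by (intro mult_mono) auto
      then show ?thesis by (simp add: norm_mult)
    qed
    ultimately show False using \<open>cmod w \<le> r\<close> r by simp
  qed
  ultimately show "z = w" by blast
qed

text \<open>On \<open>V0\<close> the map \<open>\<psi>\<close> differs from the identity by at most
  \<open>r / 100\<close>, so a perturbation form of Brouwer's theorem gives surjectivity onto a
  slightly smaller disc.\<close>

lemma surj_psi: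
  assumes "(cmod s)\<^sup>2 \<le> r\<^sup>2 / 2" shows "\<exists>z\<in>V0. \<psi> z = s"
proof -
  have "(cmod s)\<^sup>2 \<le> (8/10 * r)\<^sup>2"
    using assms r2 by (simp add: power_mult_distrib power2_eq_square)
  then have s: "cmod s \<le> 8/10 * r"
    by (rule power2_le_imp_le) (use r in auto)
  show ?thesis unfolding V0_def
  proof (rule brouwer_surjective_cball [of 0 r \<psi> s "{s}"])
    show "continuous_on (cball 0 r) \<psi>" using continuous_on_psi by (simp add: V0_def)
    fix x z :: complex assume x: "x \<in> {s}" and z: "z \<in> cball 0 r"
    have "z - \<psi> z = - (z * (csqrt (1 - z) - 1))" by (simp add: \<psi>_def algebra_simps)
    then have "cmod (z - \<psi> z) = cmod z * cmod (csqrt (1 - z) - 1)" by (simp add: norm_mult)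
    also have "\<dots> \<le> r * (1/100)"
      using z csqrt_near [of z] r by (intro mult_mono) (auto simp: V0_def)
    finally show "x + (z - \<psi> z) \<in> cball 0 r"
      using x s r norm_triangle_ineq [of x "z - \<psi> z"] by simp
  qed (use r in auto)
qed

lemma surj_V0:
  assumes "cmod v \<le> 2" shows "\<exists>w\<in>V0. poly f w = v"
proof -
  define s where "s = csqrt ((c - v) / of_real A)"
  have s: "s\<^sup>2 = (c - v) / of_real A" by (simp add: s_def)
  have "cmod (c - v) \<le> 4"
    using assms norm_c r2 norm_triangle_ineq4 [of c v] by linarith
  then have "cmod (s\<^sup>2) \<le> 4 / A"
    unfolding s norm_divide using A by (simp add: divide_right_mono)
  then have "(cmod s)\<^sup>2 \<le> r\<^sup>2 / 2" by (simp add: norm_power A_eq)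
  then obtain z where "z \<in> V0" "\<psi> z = s" using surj_psi by blast
  then show ?thesis using s A by (auto simp: poly_f_psi intro!: bexI [of _ z])
qed

text \<open>By \<open>V1_expand\<close> the map \<open>f\<close> is injective on \<open>V1\<close>
  with a Lipschitz inverse, which is the section needed for \<open>pullback_bubble\<close>.\<close>

lemma pullback_V1:
  assumes z: "z \<in> K" "z \<in> V1" and b: "bubble (comp (poly f z))"
  shows "bubble (comp z)"
proof -
  define E E' where "E = comp z" and "E' = comp (poly f z)"
  have fz: "poly f z \<in> K" using z f_in_K_iff by simp
  have E: "E \<in> components K" "E' \<in> components K"
    unfolding E_def E'_def using z fz comp_component by auto
  have EV: "E \<subseteq> V1" using comp_V [OF z(1)] z(2) by (auto simp: E_def)
  have fE: "poly f w \<in> E'" if "w \<in> E" for w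
    using itr_comp [OF z(1), of w 1] that by (simp add: E_def E'_def)
  have inj: "x = y" if "x \<in> V1" "y \<in> V1" "poly f x = poly f y" for x y
    using V1_expand [OF that(1,2)] that(3) A by (simp add: mult_le_0_iff)
  define g where "g w = (SOME y. y \<in> V1 \<and> poly f y = w)" for w
  have g: "g w \<in> V1 \<and> poly f (g w) = w" if "w \<in> E'" for w
  proof -
    have "w \<in> K" using that component_facts(4) [OF E(2)] by blast
    then have "\<exists>y. y \<in> V1 \<and> poly f y = w"
      using surj_V1 K_bound [of w 0] by auto
    then show ?thesis unfolding g_def by (rule someI_ex)
  qed
  have gf: "g (poly f w) = w" if "w \<in> E" for w
    using inj [of "g (poly f w)" w] g [OF fE [OF that]] that EV by blast
  have cont: "continuous_on E' g"
  proof (rule lipschitz_on_continuous_on [of "2 / A"])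
    show "(2 / A)-lipschitz_on E' g"
    proof (rule lipschitz_onI)
      fix v w assume "v \<in> E'" "w \<in> E'"
      then show "dist (g v) (g w) \<le> 2 / A * dist v w"
        using V1_expand [of "g v" "g w"] g [of v] g [of w] A by (simp add: dist_norm field_simps)
    qed (use A in auto)
  qed
  have "g ` E' \<subseteq> E"
  proof (rule image_component_eq [OF E(1) _ _ cont])
    show "z \<in> E" "poly f z \<in> E'" unfolding E_def E'_def using z fz in_comp by auto
    then show "g (poly f z) = z" using gf by blast
  qed (use component_facts [OF E(2)] g in auto)
  moreover have "E \<subseteq> g ` E'"
  proof
    fix w assume "w \<in> E"
    then show "w \<in> g ` E'" using imageI [OF fE, of w g] gf by simp
  qed
  ultimately have "g ` E' = E" by blast
  then show ?thesis
    using pullback_bubble [OF E(1) _ cont] b g unfolding E_def E'_def by blast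
qed

text \<open>Since the component of the image does not contain the critical value, it carries a branch of
  the square root of \<open>c - w\<close>.\<close>

lemma pullback_V0:
  assumes z: "z \<in> K" "z \<in> V0" and b: "bubble (comp (poly f z))" and c: "c \<notin> comp (poly f z)"
  shows "bubble (comp z)"
proof -
  define E E' where "E = comp z" and "E' = comp (poly f z)"
  have fz: "poly f z \<in> K" using z f_in_K_iff by simp
  have E: "E \<in> components K" "E' \<in> components K"
    unfolding E_def E'_def using z fz comp_component by auto
  have zE: "z \<in> E" "poly f z \<in> E'" unfolding E_def E'_def using z fz in_comp by auto
  have EV: "E \<subseteq> V0" using comp_V [OF z(1)] z(2) by (auto simp: E_def)
  have fE: "poly f w \<in> E'" if "w \<in> E" for w
    using itr_comp [OF z(1), of w 1] that by (simp add: E_def E'_def)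
  obtain l where l: "continuous_on E' l" "\<And>w. w \<in> E' \<Longrightarrow> (c - w) / of_real A = exp (l w)"
  proof (rule continuous_log_on_full_compact)
    show "continuous_on E' (\<lambda>w. (c - w) / of_real A)"
      using A by (intro continuous_intros) auto
    show "(c - w) / of_real A \<noteq> 0" if "w \<in> E'" for w
      using A c that by (auto simp: E'_def)
  qed (use component_facts [OF E(2)] in auto)
  define \<sigma> where "\<sigma> w = exp (l w / 2)" for w
  have sq: "(\<sigma> w)\<^sup>2 = (c - w) / of_real A" if "w \<in> E'" for w
    using l(2) [OF that] by (simp add: \<sigma>_def flip: exp_double)
  have \<sigma>0: "\<sigma> w \<noteq> 0" for w by (simp add: \<sigma>_def)
  have cont\<sigma>: "continuous_on E' \<sigma>"
    unfolding \<sigma>_def using l(1) by (intro continuous_intros) auto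
  \<comment> \<open>Both \<open>\<psi>\<close> and \<open>\<sigma> \<circ> poly f\<close> are square
    roots of the same function on \<open>E\<close>; their quotient is a constant sign
    \<open>s\<close> by connectedness, and this sign selects the branch \<open>g\<close> that leads
    back to \<open>E\<close>.\<close>
  define q where "q w = \<psi> w / \<sigma> (poly f w)" for w
  have q: "(q w)\<^sup>2 = 1" if "w \<in> E" for w
  proof -
    have "(\<sigma> (poly f w))\<^sup>2 = (\<psi> w)\<^sup>2"
      using sq [OF fE [OF that]] A by (simp add: poly_f_psi)
    then have "(q w)\<^sup>2 = (\<sigma> (poly f w))\<^sup>2 / (\<sigma> (poly f w))\<^sup>2"
      by (simp add: q_def power_divide)
    then show ?thesis using \<sigma>0 [of "poly f w"] by simp
  qed
  have "q constant_on E"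
  proof (rule continuous_finite_range_constant)
    show "connected E" using component_facts [OF E(1)] by blast
    have "continuous_on E (\<lambda>w. \<sigma> (poly f w))"
      by (rule continuous_on_compose2 [OF cont\<sigma>]) (use fE in \<open>auto intro!: continuous_intros\<close>)
    then show "continuous_on E q"
      unfolding q_def using \<sigma>0 continuous_on_subset [OF continuous_on_psi EV]
      by (intro continuous_intros) auto
    have "q ` E \<subseteq> {1, - 1}" using q by (auto simp: power2_eq_1_iff)
    then show "finite (q ` E)" by (rule finite_subset) auto
  qed
  then obtain s where s: "\<And>w. w \<in> E \<Longrightarrow> q w = s" by (auto simp: constant_on_def)
  have s2: "s\<^sup>2 = 1" using q [OF zE(1)] s [OF zE(1)] by simp
  define g where "g w = inv_into V0 \<psi> (s * \<sigma> w)" for w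
  have ran: "s * \<sigma> w \<in> \<psi> ` V0" if "w \<in> E'" for w
  proof -
    have "w \<in> K" using that component_facts(4) [OF E(2)] by blast
    then have "cmod (c - w) \<le> 4"
      using norm_c r2 norm_triangle_ineq4 [of c w] K_bound [of w 0] by simp
    then have "cmod ((s * \<sigma> w)\<^sup>2) \<le> 4 / A"
      unfolding power_mult_distrib s2 sq [OF that] using A by (simp add: norm_divide divide_right_mono)
    then have "(cmod (s * \<sigma> w))\<^sup>2 \<le> r\<^sup>2 / 2" by (simp only: norm_power A_eq) simp
    then show ?thesis using surj_psi by force
  qed
  have g: "g w \<in> V0" "\<psi> (g w) = s * \<sigma> w" if "w \<in> E'" for w
    unfolding g_def using inv_into_into [OF ran [OF that]] f_inv_into_f [OF ran [OF that]] by auto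
  have fg: "poly f (g w) = w" if "w \<in> E'" for w
    unfolding poly_f_psi g(2) [OF that] power_mult_distrib s2 sq [OF that] using A by simp
  have gf: "g (poly f w) = w" if "w \<in> E" for w
  proof -
    have "s * \<sigma> (poly f w) = \<psi> w"
      using s [OF that] \<sigma>0 [of "poly f w"] by (simp add: q_def field_simps)
    then show ?thesis
      unfolding g_def using inv_into_f_f [OF inj_on_psi] that EV by auto
  qed
  have cont: "continuous_on E' g"
    unfolding g_def
  proof (rule continuous_on_compose2 [of "\<psi> ` V0" "inv_into V0 \<psi>" E' "\<lambda>w. s * \<sigma> w"])
    show "continuous_on (\<psi> ` V0) (inv_into V0 \<psi>)"
      using inv_into_f_f [OF inj_on_psi]
      by (intro continuous_on_inv [OF continuous_on_psi]) (auto simp: V0_def)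
  qed (use ran cont\<sigma> in \<open>auto intro!: continuous_intros\<close>)
  have "g ` E' \<subseteq> E"
    using component_facts(4,2) [OF E(2)] cont fg zE gf [OF zE(1)] by (rule image_component_eq [OF E(1)])
  moreover have "E \<subseteq> g ` E'"
  proof
    fix w assume "w \<in> E"
    then show "w \<in> g ` E'" using imageI [OF fE, of w g] gf by simp
  qed
  ultimately have "g ` E' = E" by blast
  then show ?thesis
    using pullback_bubble [OF E(1) _ cont] b fg unfolding E_def E'_def by blast
qed

text \<open>If \<open>c = poly f 0\<close> lies in the component of \<open>poly f z\<close>, then
  \<open>poly f z\<close> shares the itinerary of \<open>c\<close>; as \<open>z\<close> is in
  \<open>V0\<close>, it keeps to the critical itinerary through every turn and is trapped.\<close>

lemma comp_crit_value:
  assumes z: "z \<in> K" "z \<in> V0" and c: "c \<in> comp (poly f z)"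
  shows "comp z = K0"
proof (rule trapped_eq_K0 [OF z(1)])
  fix n
  have fz: "poly f z \<in> K" using z f_in_K_iff by simp
  \<comment> \<open>The comparison starts at \<open>poly f z\<close> and \<open>c\<close>, so only
    times of the form \<open>Suc m\<close> are covered; time \<open>0\<close> is the hypothesis on
    \<open>z\<close>.\<close>
  have *: "itr (Suc m) z \<in> V0 \<longleftrightarrow> crit (Suc m) \<in> V0" "itr (Suc m) z \<in> V1 \<longleftrightarrow> crit (Suc m) \<in> V1" for m
    using itr_comp_V [OF fz c, of m] by (auto simp: funpow_swap1 f_0)
  have "itr (p * n) z \<in> V0"
  proof (cases "p * n")
    case 0
    show ?thesis unfolding 0 using z by simp
  next
    case (Suc m)
    have "crit (Suc m) = 0" unfolding Suc [symmetric] using crit_periodic [of n 0] by simp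
    then show ?thesis using *(1) [of m] Suc r by (simp add: V0_def)
  qed
  moreover have "itr i (itr (p * n) z) \<in> V1" if "0 < i" "i < p" for i
  proof -
    define m where "m = p * n + i - 1"
    have m: "p * n + i = Suc m" using that unfolding m_def by linarith
    have "crit (Suc m) = crit i" unfolding m [symmetric] by (rule crit_periodic)
    then have "itr (Suc m) z \<in> V1" using *(2) crit_V1 [OF that] by metis
    moreover have "itr (Suc m) z = itr i (itr (p * n) z)"
      unfolding m [symmetric] by (simp only: add.commute [of "p * n" i] itr_add)
    ultimately show ?thesis by metis
  qed
  ultimately show "itr (p * n) z \<in> follow (p - 1)"
    using p by (auto simp: follow_def)
qed

text \<open>Bubbles are pulled back one step at a time. The square root has no branch only if the
  critical value lies in the component of the image, and in that case the component is
  \<open>K0\<close> itself.\<close>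

lemma preimage_bubble:
  assumes "z \<in> K" "itr n z \<in> K0" shows "bubble (comp z)"
  using assms
proof (induction n arbitrary: z)
  case 0
  then have "comp z = K0" using comp_eq [OF K0_component] by simp
  then show ?case by (simp add: bubble_K0)
next
  case (Suc n)
  then have fz: "poly f z \<in> K" using f_in_K_iff by simp
  then have b: "bubble (comp (poly f z))"
    using Suc by (simp add: funpow_swap1)
  consider "z \<in> V1" | "z \<in> V0" "c \<notin> comp (poly f z)" | "z \<in> V0" "c \<in> comp (poly f z)"
    using K_subset_V Suc.prems by blast
  then show ?case
  proof cases
    case 1
    then show ?thesis using pullback_V1 Suc.prems b by blast
  next
    case 2
    then show ?thesis using pullback_V0 Suc.prems b by blast
  next
    case 3
    then show ?thesis using comp_crit_value Suc.prems bubble_K0 by simp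
  qed
qed

subsection \<open>The remaining components are points\<close>

lemma continuous_on_Ln_near_1: "continuous_on (cball 1 (1/2)) Ln"
  by (rule lipschitz_on_continuous_on [of 2], rule lipschitz_onI)
    (auto simp: dist_norm norm_minus_commute intro: Ln_lipschitz)

lemma continuous_on_eps: "j < p \<Longrightarrow> continuous_on (follow j) (eps j)"
proof (induction j)
  case 0
  have "continuous_on (follow 0) (\<lambda>z. Ln (1 - z))"
    by (rule continuous_on_compose2 [OF continuous_on_Ln_near_1])
      (use r in \<open>auto simp: follow_def V0_def dist_norm intro!: continuous_intros\<close>)
  then show ?case by (simp add: eps_def)
next
  case (Suc j)
  have sub: "follow (Suc j) \<subseteq> follow j" using follow_Suc by blast
  have "continuous_on (follow (Suc j)) (\<lambda>z. Ln (Q (itr (Suc j) z) (crit (Suc j))))"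
  proof (rule continuous_on_compose2 [OF continuous_on_Ln_near_1])
    show "continuous_on (follow (Suc j)) (\<lambda>z. Q (itr (Suc j) z) (crit (Suc j)))"
      unfolding Q_def by (intro continuous_intros continuous_on_itr)
    show "(\<lambda>z. Q (itr (Suc j) z) (crit (Suc j))) ` follow (Suc j) \<subseteq> cball 1 (1/2)"
    proof (rule image_subsetI)
      fix z assume "z \<in> follow (Suc j)"
      then have "cmod (Q (itr (Suc j) z) (crit (Suc j)) - 1) \<le> 9 * r\<^sup>2"
        using Suc.prems by (intro Q_near_1 crit_V1) (auto simp: follow_Suc)
      then show "Q (itr (Suc j) z) (crit (Suc j)) \<in> cball 1 (1/2)"
        using r2 by (simp add: dist_norm norm_minus_commute)
    qed
  qed
  then show ?case
    unfolding eps_Suc using Suc continuous_on_subset [OF _ sub] by (intro continuous_on_add) auto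
qed

text \<open>On a component \<open>G\<close> following the critical point for \<open>j\<close> steps, any logarithm \<open>H\<close> of
  \<open>f\<^sup>j\<^sup>+\<^sup>1 - f\<^sup>j\<^sup>+\<^sup>1 0\<close> varies almost twice as fast as a logarithm \<open>l\<close> of the identity.\<close>

lemma log_expand:
  assumes j: "j < p" and G: "connected G" "G \<subseteq> follow j"
    and l: "continuous_on G l" "\<And>x. x \<in> G \<Longrightarrow> x = exp (l x)"
    and H: "continuous_on G H" "\<And>x. x \<in> G \<Longrightarrow> exp (H x) = itr (Suc j) x - crit (Suc j)"
    and xy: "x \<in> G" "y \<in> G"
  shows "cmod (H x - H y) \<ge> 19/10 * cmod (l x - l y)"
proof -
  define L where "L x = ladd j + 2 * l x + eps j x" for x
  have "H x - H y = L x - L y"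
  proof (rule exp_eq_connected_const [OF G(1) H(1) _ _ xy])
    show "continuous_on G L"
      unfolding L_def using l(1) continuous_on_subset [OF continuous_on_eps [OF j] G(2)]
      by (intro continuous_intros)
    fix z assume z: "z \<in> G"
    then have "exp (l z) \<in> follow j" using l(2) G(2) by (metis subsetD)
    then show "exp (H z) = exp (L z)"
      using follow_log [OF j] l(2) [OF z] H(2) [OF z] unfolding L_def by metis
  qed
  then have eq: "H x - H y = 2 * (l x - l y) + (eps j x - eps j y)"
    by (simp add: L_def algebra_simps)
  have "cmod (eps j x - eps j y) \<le> 1/10 * cmod (l x - l y)"
    using eps_lipschitz [OF j, of "l x" "l y"] l(2) [OF xy(1)] l(2) [OF xy(2)] xy G(2) by auto
  then show ?thesis
    unfolding eq using norm_diff_ineq [of "2 * (l x - l y)" "eps j x - eps j y"]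
    unfolding norm_mult by simp
qed

text \<open>When a component leaves the critical itinerary, its difference from the critical orbit
  is near \<open>1\<close> or \<open>-1\<close>. There \<open>Ln\<close> is
  \<open>2\<close>-Lipschitz up to the sign, which turns the logarithmic factor \<open>19/10\<close>
  into \<open>19/20\<close> for the Euclidean distance.\<close>

lemma deviate_expand:
  assumes j: "j < p" and G: "connected G" "G \<subseteq> follow j"
    and l: "continuous_on G l" "\<And>x. x \<in> G \<Longrightarrow> x = exp (l x)"
    and V: "itr (Suc j) ` G \<subseteq> V0 \<and> crit (Suc j) \<in> V1 \<or> itr (Suc j) ` G \<subseteq> V1 \<and> crit (Suc j) = 0"
    and xy: "x \<in> G" "y \<in> G"
  shows "cmod (itr (Suc j) x - itr (Suc j) y) \<ge> 19/20 * cmod (l x - l y)"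
proof -
  define a where "a = crit (Suc j)"
  \<comment> \<open>The sign \<open>\<delta>\<close> moves the difference close to \<open>1\<close>,
    and \<open>\<kappa>\<close> is a logarithm of it.\<close>
  obtain \<delta> \<kappa> :: complex where \<delta>: "\<delta> = 1 \<or> \<delta> = - 1" "exp \<kappa> = \<delta>"
    and near: "\<And>z. z \<in> G \<Longrightarrow> \<delta> * (itr (Suc j) z - a) \<in> cball 1 (1/2)"
    using V
  proof
    assume *: "itr (Suc j) ` G \<subseteq> V0 \<and> crit (Suc j) \<in> V1"
    show thesis
    proof (rule that [of "- 1" "\<i> * of_real pi"])
      fix z assume "z \<in> G"
      then have "cmod (itr (Suc j) z) \<le> r" "cmod (a - 1) \<le> 2 * r\<^sup>2"
        using * V0_norm V1_norm by (auto simp: a_def)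
      then have "cmod (itr (Suc j) z - (a - 1)) \<le> 1/2"
        using norm_triangle_ineq4 [of "itr (Suc j) z" "a - 1"] r r2 by linarith
      then show "- 1 * (itr (Suc j) z - a) \<in> cball 1 (1/2)"
        by (simp add: dist_norm algebra_simps)
    qed auto
  next
    assume *: "itr (Suc j) ` G \<subseteq> V1 \<and> crit (Suc j) = 0"
    show thesis
    proof (rule that [of 1 0])
      fix z assume "z \<in> G"
      then have "cmod (itr (Suc j) z - 1) \<le> 2 * r\<^sup>2" using * V1_norm by blast
      then show "1 * (itr (Suc j) z - a) \<in> cball 1 (1/2)"
        using * r2 by (simp add: a_def dist_norm norm_minus_commute)
    qed auto
  qed
  define H where "H z = Ln (\<delta> * (itr (Suc j) z - a)) + \<kappa>" for z
  have "19/10 * cmod (l x - l y) \<le> cmod (H x - H y)"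
  proof (rule log_expand [OF j G l _ _ xy])
    have "continuous_on G (\<lambda>z. Ln (\<delta> * (itr (Suc j) z - a)))"
      by (rule continuous_on_compose2 [OF continuous_on_Ln_near_1])
        (use near in \<open>auto intro!: continuous_intros continuous_on_itr simp del: funpow.simps\<close>)
    then show "continuous_on G H" unfolding H_def by (intro continuous_on_add continuous_on_const)
    fix z assume z: "z \<in> G"
    have nz: "\<delta> * (itr (Suc j) z - a) \<noteq> 0" using near [OF z] by (auto simp del: funpow.simps)
    have "exp (H z) = \<delta> * (itr (Suc j) z - a) * \<delta>"
      unfolding H_def exp_add \<delta>(2) exp_Ln [OF nz] ..
    then show "exp (H z) = itr (Suc j) z - crit (Suc j)"
      using \<delta>(1) unfolding a_def by auto
  qed
  also have "H x - H y = Ln (\<delta> * (itr (Suc j) x - a)) - Ln (\<delta> * (itr (Suc j) y - a))"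
    by (simp add: H_def)
  also have "cmod \<dots> \<le> 2 * cmod (\<delta> * (itr (Suc j) x - a) - \<delta> * (itr (Suc j) y - a))"
    using near [OF xy(1)] near [OF xy(2)] by (intro Ln_lipschitz) (simp_all only: mem_cball dist_norm norm_minus_commute)
  also have "\<delta> * (itr (Suc j) x - a) - \<delta> * (itr (Suc j) y - a) = \<delta> * (itr (Suc j) x - itr (Suc j) y)"
    by (simp only: right_diff_distrib) simp
  also have "cmod \<dots> = cmod (itr (Suc j) x - itr (Suc j) y)"
    using \<delta>(1) by (auto simp only: norm_mult norm_one norm_minus_cancel mult_1_left)
  finally show ?thesis by simp
qed

text \<open>The size \<open>s n\<close> of the pair \<open>f\<^sup>n z, f\<^sup>n z'\<close> is measured by a logarithm in \<open>V0\<close> and by twice the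
  Euclidean distance in \<open>V1\<close>. It grows by a factor \<open>3/2\<close> along suitable times, and it is bounded
  whenever the component leaves the itinerary of the critical point.\<close>

lemma wandering_component_point:
  assumes z: "z \<in> K" and never: "\<And>n. itr n z \<notin> K0" and z': "z' \<in> comp z"
  shows "z' = z"
proof (rule ccontr)
  assume "z' \<noteq> z"
  define G where "G n = comp (itr n z)" for n
  have zn: "itr n z \<in> K" for n using z itr_in_K_iff by simp
  have Gc: "G n \<in> components K" for n unfolding G_def using zn by (rule comp_component)
  have mem: "itr n z \<in> G n" "itr n z' \<in> G n" for n
    unfolding G_def using in_comp [OF zn] itr_comp [OF z z'] by auto
  have Gitr: "itr m ` G n \<subseteq> G (m + n)" for m n
    unfolding G_def itr_add using itr_comp [OF zn] by blast
  have G0: "0 \<notin> G n" for n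
  proof
    assume "0 \<in> G n"
    then have "G n = K0" unfolding K0_def by (rule comp_eq [OF Gc])
    then show False using never mem(1) by blast
  qed
  have "\<exists>l. continuous_on (G n) l \<and> (\<forall>x\<in>G n. x = exp (l x))" for n
    using continuous_log_on_full_compact [of "G n" "\<lambda>x. x"] component_facts [OF Gc [of n]] G0 [of n]
    by (metis continuous_on_id)
  then obtain l where lc: "\<And>n. continuous_on (G n) (l n)" and l: "\<And>n x. x \<in> G n \<Longrightarrow> x = exp (l n x)"
    by metis
  \<comment> \<open>The factor \<open>2\<close> raises the \<open>19/20\<close> of
    \<open>deviate_expand\<close> to a growth by \<open>19/10\<close>.\<close>
  define s where "s n = (if itr n z \<in> V0 then cmod (l n (itr n z) - l n (itr n z'))
    else 2 * cmod (itr n z - itr n z'))" for n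
  have V0': "itr n z' \<in> V0 \<longleftrightarrow> itr n z \<in> V0" "itr n z' \<in> V1 \<longleftrightarrow> itr n z \<in> V1" for n
    using itr_comp_V [OF z z'] by auto
  have sV0: "s n \<ge> 100 * cmod (itr n z - itr n z')" if "itr n z \<in> V0" for n
  proof -
    have "cmod (exp (l n (itr n z)) - exp (l n (itr n z'))) \<le> r * cmod (l n (itr n z) - l n (itr n z'))"
    proof (rule exp_lipschitz)
      show "cmod (exp (l n (itr n z))) \<le> r" "cmod (exp (l n (itr n z'))) \<le> r"
        using that V0' l [OF mem(1)] l [OF mem(2)] V0_norm by metis+
    qed
    also have "\<dots> \<le> 1/100 * cmod (l n (itr n z) - l n (itr n z'))"
      using r by (intro mult_right_mono) auto
    finally show ?thesis
      using that l [OF mem(1), of n] l [OF mem(2), of n] by (simp add: s_def)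
  qed
  have sV1: "s n = 2 * cmod (itr n z - itr n z')" if "itr n z \<in> V1" for n
    using that V_disjoint by (auto simp: s_def)
  have V01: "itr n z \<in> V0 \<or> itr n z \<in> V1" for n
    using zn K_subset_V by blast
  have s_ge: "s n \<ge> 2 * cmod (itr n z - itr n z')" for n
    using V01 [of n] sV0 [of n] sV1 [of n] norm_ge_zero [of "itr n z - itr n z'"] by linarith
  have dist4: "cmod (itr n z - itr n z') \<le> 4" for n
    using norm_triangle_ineq4 [of "itr n z" "itr n z'"] K_bound [OF zn [of n], of 0]
      K_bound [of z' n] z' connected_component_subset [of K z] K_bound [OF z, of n] by force
  have foll: "G n \<subseteq> follow j" if "itr n z \<in> follow j" for n j
    unfolding G_def using follow_comp [OF zn] that by blast
  \<comment> \<open>Growth occurs in both alternatives. A size above \<open>16\<close> is possible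
    only in the second one, because in the first the size is controlled by a Euclidean distance
    between points of \<open>K\<close>.\<close>
  have step: "(\<exists>m>n. s m \<ge> 3/2 * s n \<and> s n \<le> 16) \<or> (itr n z \<in> follow (p - 1) \<and> s (n + p) \<ge> 3/2 * s n)" for n
  proof (cases "itr n z \<in> V1")
    case True
    have "A / 2 * cmod (itr n z - itr n z') \<le> cmod (itr (Suc n) z - itr (Suc n) z')"
      using V1_expand [OF True, of "itr n z'"] True V0' by simp
    moreover have "A / 2 * cmod (itr n z - itr n z') \<ge> 2 * cmod (itr n z - itr n z')"
      using A by (intro mult_right_mono) auto
    ultimately have "s (Suc n) \<ge> 3/2 * s n"
      using s_ge [of "Suc n"] sV1 [OF True] norm_ge_zero [of "itr n z - itr n z'"] by linarith
    moreover have "s n \<le> 16" using sV1 [OF True] dist4 [of n] by simp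
    ultimately show ?thesis by blast
  next
    case False
    then have nV0: "itr n z \<in> V0" using V01 by blast
    then have sn: "s n = cmod (l n (itr n z) - l n (itr n z'))" by (simp add: s_def)
    \<comment> \<open>The maximum of \<open>Fol\<close> is the longest time below \<open>p\<close>
      for which the critical itinerary is followed.\<close>
    define Fol where "Fol = {j. j < p \<and> itr n z \<in> follow j}"
    have "0 \<in> Fol" using nV0 p by (auto simp: Fol_def follow_def)
    moreover have "finite Fol" by (auto simp: Fol_def)
    ultimately have MF: "Max Fol \<in> Fol" "\<And>i. i \<in> Fol \<Longrightarrow> i \<le> Max Fol"
      using Max_in Max_ge by blast+
    define j where "j = Max Fol"
    have j: "j < p" "itr n z \<in> follow j" using MF(1) by (auto simp: Fol_def j_def)
    have jmax: "itr n z \<notin> follow (Suc j)" if "Suc j < p"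
    proof
      assume "itr n z \<in> follow (Suc j)"
      then have "Suc j \<in> Fol" using that by (simp add: Fol_def)
      then show False using MF(2) [of "Suc j"] by (simp add: j_def)
    qed
    have Gn: "connected (G n)" using component_facts [OF Gc] by blast
    define m where "m = Suc j + n"
    have im: "itr (Suc j) (itr n y) = itr m y" for y unfolding m_def itr_add ..
    have imG: "itr (Suc j) ` G n \<subseteq> G m" unfolding m_def by (rule Gitr)
    have GV: "itr m z \<in> V0 \<Longrightarrow> G m \<subseteq> V0" "itr m z \<in> V1 \<Longrightarrow> G m \<subseteq> V1"
      unfolding G_def using comp_V [OF zn] by blast+
    have dev: ?thesis if V: "itr m z \<in> V0 \<and> crit (Suc j) \<in> V1 \<or> itr m z \<in> V1 \<and> crit (Suc j) = 0"
    proof -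
      have "19/20 * cmod (l n (itr n z) - l n (itr n z')) \<le> cmod (itr (Suc j) (itr n z) - itr (Suc j) (itr n z'))"
        using V GV imG mem
        by (intro deviate_expand [OF j(1) Gn foll [OF j(2)] lc l]) blast+
      then have e: "19/20 * s n \<le> cmod (itr m z - itr m z')"
        unfolding im sn .
      then have "s m \<ge> 3/2 * s n" using s_ge [of m] sn norm_ge_zero [of "l n (itr n z) - l n (itr n z')"] by linarith
      moreover have "s n \<le> 16" using e dist4 [of m] by linarith
      moreover have "m > n" by (simp add: m_def)
      ultimately show ?thesis by blast
    qed
    show ?thesis
    \<comment> \<open>An early departure leads to \<open>V0\<close> while the critical orbit is in
      \<open>V1\<close>. After \<open>p\<close> steps the critical orbit is at \<open>0\<close>, so
      departure then means landing in \<open>V1\<close>, and landing in \<open>V0\<close> completes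
      a turn.\<close>
    proof (cases "Suc j < p")
      case True
      then have "itr (Suc j) (itr n z) \<notin> V1" using jmax j(2) follow_Suc by blast
      then have "itr m z \<in> V0" using V01 im by metis
      moreover have "crit (Suc j) \<in> V1" using True by (intro crit_V1) auto
      ultimately show ?thesis using dev by blast
    next
      case False
      then have jp: "Suc j = p" "j = p - 1" using j by auto
      then have c0: "crit (Suc j) = 0" using periodic by simp
      show ?thesis
      proof (cases "itr m z \<in> V1")
        case True
        then show ?thesis using dev c0 by blast
      next
        case False
        then have mV0: "itr m z \<in> V0" using V01 by blast
        have "19/10 * cmod (l n (itr n z) - l n (itr n z'))
            \<le> cmod (l m (itr (Suc j) (itr n z)) - l m (itr (Suc j) (itr n z')))"
        proof (rule log_expand [OF j(1) Gn foll [OF j(2)] lc l _ _ mem])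
          show "continuous_on (G n) (\<lambda>x. l m (itr (Suc j) x))"
            by (rule continuous_on_compose2 [OF lc continuous_on_itr imG])
          fix x assume "x \<in> G n"
          then have "itr (Suc j) x \<in> G m" using imG by blast
          then show "exp (l m (itr (Suc j) x)) = itr (Suc j) x - crit (Suc j)"
            unfolding c0 using l by simp
        qed
        then have "19/10 * s n \<le> s m" unfolding im sn using mV0 by (simp add: s_def)
        then have "s (n + p) \<ge> 3/2 * s n"
          using sn norm_ge_zero [of "l n (itr n z) - l n (itr n z')"] unfolding m_def jp(1) add.commute [of p] by linarith
        then show ?thesis using j(2) jp(2) by simp
      qed
    qed
  qed
  have "s 0 > 0"
    using s_ge [of 0] \<open>z' \<noteq> z\<close> by (metis diff_eq_diff_eq diff_self dual_order.strict_trans1 eq_iff_diff_eq_0 funpow_0 mult_pos_pos zero_less_norm_iff zero_less_numeral)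
  have "\<exists>n. s n \<ge> (3/2) ^ k * s 0" for k
  proof (induction k)
    case (Suc k)
    then obtain n where n: "s n \<ge> (3/2) ^ k * s 0" by blast
    obtain m where "s m \<ge> 3/2 * s n" using step [of n] by blast
    then show ?case using n by (intro exI [of _ m]) simp
  qed (auto intro: exI [of _ 0])
  moreover obtain k where "(3/2) ^ k > 16 / s 0" using real_arch_pow [of "3/2" "16 / s 0"] by auto
  then have "(3/2) ^ k * s 0 > 16" using \<open>s 0 > 0\<close> by (simp only: pos_divide_less_eq)
  ultimately obtain n where n: "s n > 16" by (meson less_le_trans)
  \<comment> \<open>From here on only the second alternative of \<open>step\<close> is left, so
    every further turn keeps to the critical itinerary and the component is trapped.\<close>
  have big: "s (n + p * i) > 16" for i
  proof (induction i)
    case (Suc i)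
    then have "s (n + p * i + p) \<ge> 3/2 * s (n + p * i)" using step [of "n + p * i"] by force
    then have "s (n + p * i + p) > 16" using Suc by linarith
    then show ?case by (simp add: algebra_simps)
  qed (use n in simp)
  have "comp (itr n z) = K0"
  proof (rule trapped_eq_K0 [OF zn])
    fix i
    have "itr (n + p * i) z \<in> follow (p - 1)" using step [of "n + p * i"] big [of i] by force
    then show "itr (p * i) (itr n z) \<in> follow (p - 1)"
      by (simp only: add.commute [of n] itr_add)
  qed
  then show False using never in_comp [OF zn, of n] by blast
qed

lemma component_bubble_or_point:
  assumes "E \<in> components K" shows "bubble E \<or> (\<exists>x. E = {x})"
proof -
  obtain z where z: "z \<in> K" "E = comp z" using assms by (auto simp: components_iff)
  show ?thesis
  proof (cases "\<exists>n. itr n z \<in> K0")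
    case True
    then show ?thesis using preimage_bubble z by blast
  next
    case False
    then have "E = {z}" using wandering_component_point [OF z(1)] in_comp [OF z(1)] z(2) by blast
    then show ?thesis by blast
  qed
qed

subsection \<open>Symbolic dynamics\<close>

text \<open>Both \<open>V0\<close> and \<open>V1\<close> are mapped over the disc of radius
  \<open>2\<close>, which contains them, so finite itineraries are realised by taking preimages, and
  infinite ones by compactness.\<close>

lemma itinerary_exists:
  obtains z where "z \<in> K" "\<And>n. itr n z \<in> (if s n then V1 else V0)"
proof -
  define W where "W b = (if b then V1 else V0)" for b
  have Wc: "compact (W b)" for b by (simp add: W_def V0_def V1_def)
  have W2: "cmod z \<le> 2" if "z \<in> W b" for z b
    using that V0_norm [of z] V1_norm [of z] norm_triangle_ineq [of "z - 1" 1] r r2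
    by (auto simp: W_def split: if_splits)
  have Ws: "\<exists>w\<in>W b. poly f w = v" if "cmod v \<le> 2" for v b
    using surj_V0 [OF that] surj_V1 [OF that] by (auto simp: W_def)
  define C where "C n = {z. \<forall>i\<le>n. itr i z \<in> W (s i)}" for n
  \<comment> \<open>The itinerary \<open>t\<close> varies in the induction, because a preimage
    prepends a symbol to the shifted itinerary.\<close>
  have ne: "\<exists>z. \<forall>i\<le>n. itr i z \<in> W (t i)" for n t
  proof (induction n arbitrary: t)
    case 0
    have "\<exists>z. z \<in> W (t 0)" using Ws [of 0] by auto
    then show ?case by simp
  next
    case (Suc n)
    obtain y where y: "\<And>i. i \<le> n \<Longrightarrow> itr i y \<in> W (t (Suc i))" using Suc [of "\<lambda>i. t (Suc i)"] by blast
    have "cmod y \<le> 2" using W2 y [of 0] by simp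
    then obtain z where z: "z \<in> W (t 0)" "poly f z = y" using Ws by blast
    have "itr i z \<in> W (t i)" if "i \<le> Suc n" for i
    proof (cases i)
      case (Suc k)
      then have "itr i z = itr k y" using z by (simp add: funpow_swap1)
      then show ?thesis using y [of k] that Suc by simp
    qed (use z in simp)
    then show ?case by blast
  qed
  have "\<Inter> (range C) \<noteq> {}"
  proof (rule compact_nest)
    show "C n \<noteq> {}" for n using ne [of n s] by (auto simp: C_def)
    show "C n \<subseteq> C m" if "m \<le> n" for m n using that by (auto simp: C_def)
    fix n
    have "C n = (\<Inter>i\<in>{..n}. itr i -` W (s i))" by (auto simp: C_def)
    moreover have "closed (itr i -` W (s i))" for i
      using continuous_closed_vimage [OF compact_imp_closed [OF Wc]] continuous_on_itr [of UNIV i]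
        continuous_on_eq_continuous_at by blast
    ultimately have "closed (C n)" by auto
    moreover have "C n \<subseteq> W (s 0)" by (auto simp: C_def dest: spec [of _ 0])
    ultimately show "compact (C n)"
      by (metis Wc compact_Int_closed inf.absorb_iff2)
  qed
  then obtain z where z: "\<And>n. z \<in> C n" by blast
  then have zW: "itr n z \<in> W (s n)" for n by (force simp: C_def)
  then have "z \<in> K" using W2 by (auto simp: K_def)
  then show thesis using that zW by (simp add: W_def)
qed

lemma zero_notin_V1: "0 \<notin> V1"
  using V_disjoint r by (force simp: V0_def)

text \<open>Points with different itineraries lie in different components, so the components are at
  least as many as the binary sequences.\<close>

lemma uncountable_components: "uncountable (components K)"
proof
  assume "countable (components K)"
  obtain z where z: "\<And>s. z s \<in> K" "\<And>s n. itr n (z s) \<in> (if s n then V1 else V0)"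
  proof -
    have "\<forall>s. \<exists>z. z \<in> K \<and> (\<forall>n. itr n z \<in> (if s n then V1 else V0))"
    proof
      fix s :: "nat \<Rightarrow> bool"
      show "\<exists>z. z \<in> K \<and> (\<forall>n. itr n z \<in> (if s n then V1 else V0))"
        by (rule itinerary_exists [of s]) blast
    qed
    then show thesis using that by (auto dest!: choice)
  qed
  have inj: "inj (\<lambda>s. comp (z s))"
  proof (rule injI)
    fix s t assume "comp (z s) = comp (z t)"
    then have m: "z t \<in> comp (z s)" using in_comp [OF z(1)] by blast
    have "s n = t n" for n
      using itr_comp_V [OF z(1) m, of n] z(2) [of n s] z(2) [of n t] V_disjoint by (auto split: if_splits)
    then show "s = t" by blast
  qed
  have "range (\<lambda>s. comp (z s)) \<subseteq> components K"
    using comp_component [OF z(1)] by blast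
  then have "countable (range (\<lambda>s. comp (z s)))"
    using \<open>countable (components K)\<close> by (rule countable_subset)
  then have "countable (UNIV :: (nat \<Rightarrow> bool) set)"
    using inj by (rule countable_image_inj_on)
  then have range: "range (from_nat_into (UNIV :: (nat \<Rightarrow> bool) set)) = UNIV"
    by (intro range_from_nat_into) auto
  define e where "e = from_nat_into (UNIV :: (nat \<Rightarrow> bool) set)"
  have "(\<lambda>n. \<not> e n n) \<in> range e" unfolding e_def range by (rule UNIV_I)
  then obtain k where "(\<lambda>n. \<not> e n n) = e k" by (rule imageE)
  from fun_cong [OF this, of k] show False by simp
qed

text \<open>The \<open>n\<close>-th preimage of \<open>0\<close> along the branch near
  \<open>1\<close> enters \<open>V0\<close> for the first time at step \<open>n\<close>, so these
  preimages lie in pairwise different components.\<close>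

lemma infinite_bubbles: "infinite {E \<in> components K. bubble E}"
proof -
  have "\<exists>z. itr n z = 0 \<and> (\<forall>i<n. itr i z \<in> V1)" for n
  proof (induction n)
    case (Suc n)
    then obtain y where y: "itr n y = 0" "\<And>i. i < n \<Longrightarrow> itr i y \<in> V1" by blast
    then have "y \<in> K" using itr_in_K_iff [of n y] zero_in_K by simp
    then obtain z where z: "z \<in> V1" "poly f z = y" using surj_V1 [of y] K_bound [of y 0] by auto
    have "itr i z \<in> V1" if "i < Suc n" for i
    proof (cases i)
      case (Suc k)
      then have "itr i z = itr k y" using z by (simp add: funpow_swap1)
      then show ?thesis using y(2) [of k] that Suc by simp
    qed (use z in simp)
    moreover have "itr (Suc n) z = 0" using y z by (simp add: funpow_swap1)
    ultimately show ?case by blast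
  qed (auto intro: exI [of _ 0])
  then obtain z where z: "\<And>n. itr n (z n) = 0" "\<And>n i. i < n \<Longrightarrow> itr i (z n) \<in> V1" by metis
  have zK: "z n \<in> K" for n using z(1) [of n] itr_in_K_iff [of n "z n"] zero_in_K by simp
  have ne: "comp (z m) \<noteq> comp (z n)" if "m < n" for m n
  proof
    assume "comp (z m) = comp (z n)"
    then have "z n \<in> comp (z m)" using in_comp [OF zK] by blast
    then have "itr m (z m) \<in> V1" using itr_comp_V(2) [OF zK] z(2) [OF that] by blast
    then show False using z(1) zero_notin_V1 by simp
  qed
  have "inj (\<lambda>n. comp (z n))"
  proof (rule injI)
    fix m n assume eq: "comp (z m) = comp (z n)"
    show "m = n"
      using ne [of m n] ne [of n m] eq by (cases m n rule: linorder_cases) auto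
  qed
  then have "infinite (range (\<lambda>n. comp (z n)))" by (rule range_inj_infinite)
  moreover have "bubble (comp (z n))" for n
    using preimage_bubble [OF zK, of n n] z(1) zero_in_K0 by simp
  then have "range (\<lambda>n. comp (z n)) \<subseteq> {E \<in> components K. bubble E}"
    using comp_component [OF zK] by blast
  ultimately show ?thesis using infinite_super by blast
qed

theorem cantor_bubbles_julia: "cantor_bubbles (julia_set f)"
  unfolding julia_set_eq
proof (rule cantor_bubbles_frontier)
  have f1: "poly f 1 = poly f 0" by (simp add: poly_f)
  have "poly f 0 \<in> K" using zero_in_K f_in_K_iff by blast
  then show one: "1 \<in> K" using f1 f_in_K_iff [of 1] by simp
  show "x islimpt K" if "x \<in> K" for x
    using K_islimpt [OF zero_in_K one _ that] by simp
  \<comment> \<open>The points \<open>w / (w - 1)\<close> form the circle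
    \<open>cmod z = cmod (z - 1) / 2\<close>, which separates \<open>0\<close> from
    \<open>1\<close>. It has distance at least \<open>1/3\<close> from \<open>0\<close> and at least
    \<open>2/3\<close> from \<open>1\<close>, so it misses \<open>V0\<close> and
    \<open>V1\<close>.\<close>
  fix w :: complex assume w: "cmod w = 1/2"
  then have ne: "w - 1 \<noteq> 0" by auto
  have le: "cmod (w - 1) \<le> 3/2" using w norm_triangle_ineq4 [of w 1] by simp
  have "cmod (w / (w - 1)) \<ge> 1/3"
    using w le ne by (simp add: norm_divide field_simps)
  moreover have "w / (w - 1) - 1 = 1 / (w - 1)" using ne by (simp add: field_simps)
  then have "cmod (w / (w - 1) - 1) \<ge> 2/3"
    using le ne by (simp add: norm_divide field_simps)
  ultimately have "w / (w - 1) \<notin> V0" "w / (w - 1) \<notin> V1"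
    using V0_norm [of "w / (w - 1)"] V1_norm [of "w / (w - 1)"] r r2 by linarith+
  then show "w / (w - 1) \<notin> K" using K_subset_V by blast
qed (use compact_K connected_Compl_K component_bubble_or_point infinite_bubbles
      uncountable_components zero_in_K in auto)

lemma superattracting: "superattracting_cycle f p ((\<lambda>k. itr k 0) ` {..<p})"
proof -
  have "itr k 0 \<noteq> 0" if "0 < k" "k < p" for k
    using crit_V1 [OF that] zero_notin_V1 by metis
  then have "periodic_cycle (poly f) p ((\<lambda>k. itr k 0) ` {..<p})"
    unfolding periodic_cycle_def using p periodic by blast
  moreover have "0 \<in> (\<lambda>k. itr k 0) ` {..<p}"
    using p by (intro image_eqI [of _ _ 0]) auto
  moreover have "poly (pderiv f) 0 = 0"
    by (simp add: f_eq pderiv_pCons)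
  ultimately show ?thesis unfolding superattracting_cycle_def by blast
qed

end

theorem theorem1p2:
  fixes p :: nat
  assumes "p \<ge> 1"
  shows "\<exists>f :: complex poly. degree f = 3 \<and>
           (\<exists>C. superattracting_cycle f p C) \<and>
           cantor_bubbles (julia_set f)"
proof -
  define r where "r = 1 / (100 * real p)"
  define A where "A = 8 / r\<^sup>2"
  interpret cubic_scale p r A
    by unfold_locales (fact assms r_def A_def)+
  obtain c :: complex where c: "((\<lambda>z. of_real A * z\<^sup>2 * (z - 1) + c) ^^ p) 0 = 0"
    "\<And>i. 0 < i \<Longrightarrow> i < p \<Longrightarrow> ((\<lambda>z. of_real A * z\<^sup>2 * (z - 1) + c) ^^ i) 0 \<in> cball 1 (r\<^sup>2)"
    using parameter_exists by blast
  define f where "f = [:c, 0, - of_real A, of_real A:]"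
  have f: "poly f = (\<lambda>z. of_real A * z\<^sup>2 * (z - 1) + c)"
    by (auto simp: f_def algebra_simps power2_eq_square)
  interpret cubic p r A c f
  proof
    show "(poly f ^^ p) 0 = 0" unfolding f by (rule c(1))
    show "(poly f ^^ i) 0 \<in> cball 1 (r\<^sup>2)" if "0 < i" "i < p" for i
      unfolding f using c(2) [OF that] .
  qed (rule f_def)
  have "degree f = 3" using A by (simp add: f_def)
  then show ?thesis using superattracting cantor_bubbles_julia by blast
qed

end
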